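(* Let $(p,q)\in[1,\infty]^2$. There is a constant $C=C(p,q)>0$ such that for every integer $N\ge2$ and every $\sigma=(\lambda_1,\dots,\lambda_N)\in\mathbb{D}^N$, the Blaschke product $B=B_\sigma$ satisfies the following (with $1/\infty=0$). 1) If $(p,q)\in[1,2]^2$, then $\|B\|_{\mathcal{B}^0_{p,q}}\le C(\log N)^{1/q-1/2}$. 2) If $1\le p\le q\le\infty$ and $q\ge2$, then $\|B\|_{\mathcal{B}^0_{p,q}}\le C$. 3) If $1\le q\le p<\infty$ and $p\ge2$, then $\|B\|_{\mathcal{B}^0_{p,q}}\le C(\log N)^{1/q-1/p}$. 4) If $1\le q<\infty$ and $p=\infty$, then $\|B\|_{\mathcal{B}^0_{p,q}}\le C N^{1/q}$. Moreover, in all these inequalities the growth in $N$ is best possible: for each of the cases 1)–4) and each $(p,q)$ in that case, denoting by $\varphi(N)$ the function of $N$ on the right-hand side (namely $(\log N)^{1/q-1/2}$, $1$, $(\log N)^{1/q-1/p}$, $N^{1/q}$, respectively), there exist a constant $c=c(p,q)>0$ and infinitely many integers $N$ for which some $\sigma\in\mathbb{D}^N$ satisfies $\|B_\sigma\|_{\mathcal{B}^0_{p,q}}\ge c\,\varphi(N)$.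
   Context: $\mathbb{D}$ is the open unit disc in $\mathbb{C}$, $\mathbb{T}$ is the unit circle with normalized Lebesgue measure. For $\sigma=(\lambda_1,\dots,\lambda_N)\in\mathbb{D}^N$, $B_\sigma(z)=\prod_{i=1}^N\frac{z-\lambda_i}{1-\overline{\lambda_i}z}$. Besov spaces of zero smoothness: for $1\le p,q\le\infty$, $\mathcal{B}^0_{p,q}$ is the Banach space of analytic functions $f$ on $\mathbb{D}$ with $\|f\|_{\mathcal{B}^0_{p,q}}=|f(0)|+\|f\|^*_{\mathcal{B}^0_{p,q}}<\infty$, where, with $f'_\rho(\zeta)=f'(\rho\zeta)$ for $\zeta\in\mathbb{T}$, $$\|f\|^*_{\mathcal{B}^0_{p,q}}=\Big(\int_0^1(1-\rho)^{q-1}\|f'_\rho\|^q_{L^p(\mathbb{T})}\,d\rho\Big)^{1/q}\ (q<\infty),\qquad \|f\|^*_{\mathcal{B}^0_{p,\infty}}=\sup_{0<\rho<1}(1-\rho)\|f'_\rho\|_{L^p(\mathbb{T})}.$$ *)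

theory Defs
  imports "HOL-Probability.Probability"
begin

definition blaschke :: "complex list \<Rightarrow> complex \<Rightarrow> complex" where
  "blaschke \<sigma> z = (\<Prod>a\<leftarrow>\<sigma>. (z - a) / (1 - cnj a * z))"

text \<open>The \<open>\<sigma>\<close>-algebra is that of the circle itself, not of the whole plane, so that measurability
  of a function only concerns its values on the circle.\<close>

definition circle_measure :: "complex measure" where
  "circle_measure =
     distr (uniform_measure lborel {0..<2 * pi}) (restrict_space borel (sphere 0 1)) cis"

lemma space_circle_measure: "space circle_measure = sphere 0 1"
  by (simp add: circle_measure_def space_restrict_space)

lemma prob_space_circle_measure: "prob_space circle_measure"
  unfolding circle_measure_def
proof (rule prob_space.prob_space_distr)
  show "prob_space (uniform_measure lborel {0..<2 * pi})"
    by (rule prob_space_uniform_measure) auto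
  have "cis \<in> borel_measurable borel"
    by (intro borel_measurable_continuous_onI continuous_intros)
  then show "cis \<in> uniform_measure lborel {0..<2 * pi} \<rightarrow>\<^sub>M restrict_space borel (sphere 0 1)"
    by (auto intro!: measurable_restrict_space2)
qed

text \<open>Powers with positive exponent on \<open>[0,\<infinity>]\<close>; for nonpositive \<open>a\<close> the value at \<open>\<infinity>\<close> is not
  the usual one.\<close>

definition ennreal_powr :: "ennreal \<Rightarrow> real \<Rightarrow> ennreal" where
  "ennreal_powr x a = (if x = \<infinity> then \<infinity> else ennreal (enn2real x powr a))"

text \<open>The real number \<open>1/p\<close>, with \<open>1/\<infinity> = 0\<close>.\<close>

definition recip :: "ennreal \<Rightarrow> real" where
  "recip p = enn2real (1 / p)"

definition Lp_norm :: "ennreal \<Rightarrow> 'a measure \<Rightarrow> ('a \<Rightarrow> complex) \<Rightarrow> ennreal" where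
  "Lp_norm p M f =
     (if p = \<infinity> then esssup M (\<lambda>x. ennreal (norm (f x)))
      else ennreal_powr (\<integral>\<^sup>+x. ennreal (norm (f x) powr enn2real p) \<partial>M) (recip p))"

text \<open>The norm and seminorm are extended-valued: a function analytic on the open unit disc belongs
  to the Besov space of zero smoothness with parameters \<open>p, q\<close> iff its \<open>besov_norm\<close> is finite.\<close>

definition besov_seminorm :: "ennreal \<Rightarrow> ennreal \<Rightarrow> (complex \<Rightarrow> complex) \<Rightarrow> ennreal" where
  "besov_seminorm p q f =
     (let m = (\<lambda>\<rho>::real. Lp_norm p circle_measure (\<lambda>\<zeta>. deriv f (of_real \<rho> * \<zeta>))) in
      if q = \<infinity> then (SUP \<rho>\<in>{0<..<1}. ennreal (1 - \<rho>) * m \<rho>)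
      else ennreal_powr
        (\<integral>\<^sup>+\<rho>\<in>{0<..<1}. ennreal ((1 - \<rho>) powr (enn2real q - 1)) * ennreal_powr (m \<rho>) (enn2real q)
           \<partial>lborel)
        (recip q))"

definition besov_norm :: "ennreal \<Rightarrow> ennreal \<Rightarrow> (complex \<Rightarrow> complex) \<Rightarrow> ennreal" where
  "besov_norm p q f = ennreal (norm (f 0)) + besov_seminorm p q f"

definition disc_tuples :: "nat \<Rightarrow> complex list set" where
  "disc_tuples N = {\<sigma>. length \<sigma> = N \<and> set \<sigma> \<subseteq> ball 0 1}"

text \<open>A lower bound of order \<open>\<phi>(N)\<close> for the norms of suitable Blaschke products of degree \<open>N\<close>,
  for infinitely many \<open>N\<close>. The restriction to \<open>N \<ge> 2\<close> is harmless.\<close>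

definition growth_attained :: "ennreal \<Rightarrow> ennreal \<Rightarrow> (nat \<Rightarrow> real) \<Rightarrow> bool" where
  "growth_attained p q \<phi> \<longleftrightarrow>
     (\<exists>c>0. infinite {N. N \<ge> 2 \<and>
        (\<exists>\<sigma>\<in>disc_tuples N. ennreal (c * \<phi> N) \<le> besov_norm p q (blaschke \<sigma>))})"

end

theory Submission
  imports Defs "HOL-Complex_Analysis.Complex_Analysis"
    "HOL-Computational_Algebra.Fundamental_Theorem_Algebra"
begin

text \<open>Write \<open>M\<^sub>p(\<rho>)\<close> for the \<open>L\<^sup>p\<close> mean of \<open>B'\<close> over the circle of radius \<open>\<rho>\<close>, and \<open>U(\<rho>) = (1 - \<rho>)\<^sup>2 M\<^sub>2(\<rho>)\<^sup>2\<close>.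

Upper bounds. Three facts about a Blaschke product \<open>B\<close> of degree \<open>N\<close> are used. Cauchy's estimate
gives \<open>(1 - \<rho>) \<bar>B'\<bar> \<le> 1\<close>; comparing \<open>B'\<close> with the sum of the derivatives of its factors gives
\<open>M\<^sub>1(\<rho>) \<le> N\<close>; and Parseval's identity, together with \<open>\<bar>B\<bar> \<le> 1\<close>, bounds the energy
\<open>\<integral> (1 - \<rho>) M\<^sub>2(\<rho>)\<^sup>2 d\<rho> = \<integral> U(\<rho>) / (1 - \<rho>) d\<rho>\<close> by \<open>1/2\<close> (\<open>energy_le\<close>). With
\<open>r = max p 2\<close> the first fact and Jensen's inequality give \<open>(1 - \<rho>) M\<^sub>p \<le> U\<^bsup>1/r\<^esup>\<close>, so that the integrand
of the \<open>q\<close>-th power of the seminorm is at most \<open>U\<^bsup>q/r\<^esup> / (1 - \<rho>)\<close>. If \<open>q \<ge> r\<close> this is at most the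
energy density. If \<open>q < r\<close>, the zone \<open>\<rho> > 1 - 1/N\<close> is controlled by \<open>U \<le> (1 - \<rho>) N\<close>, and the
remaining zone, whose mass for \<open>d\<rho> / (1 - \<rho>)\<close> is \<open>log N\<close>, by Young's inequality, which loses the
factor \<open>(log N)\<^bsup>1 - q/r\<^esup>\<close> (\<open>besov_norm_le_log\<close>). For \<open>p = \<infinity>\<close> the integrand is at most \<open>M\<^sub>\<infinity>(\<rho>)\<close>,
and each zero contributes at most \<open>2\<close> to its integral.

Lower bounds. A lower bound for \<open>(1 - \<rho>) M\<^sub>p(\<rho>)\<close> on \<open>K\<close> disjoint intervals of the form
\<open>(1 - u, 1 - u/2)\<close> yields one for the seminorm (\<open>besov_seminorm_ge\<close>), so it remains to produce
Blaschke products that are active on about \<open>log N\<close> scales (on \<open>N\<close> scales if \<open>p = \<infinity>\<close>).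

\<^item> For a bounded right-hand side, take zeros so close to the circle that \<open>\<bar>B(0)\<bar> \<ge> 1/2\<close>.
\<^item> For \<open>p = \<infinity>\<close>, put the zeros at \<open>1 - 16\<^bsup>-j\<^esup>\<close>. They are separated in the pseudohyperbolic metric,
  so \<open>\<bar>B'\<bar>\<close> is comparable to \<open>1/(1 - \<rho>)\<close> at each of them.
\<^item> For \<open>2 \<le> p < \<infinity>\<close>, multiply \<open>K\<close> factors \<open>(z\<^sup>n - r) / (1 - r z\<^sup>n)\<close> with \<open>n = 16\<^sup>j\<close> and
  \<open>1 - r = 1 / (16 K)\<close>. At scale \<open>1 / (n K)\<close> the derivative is as large as possible around the \<open>n\<close>
  zeros of one factor, that is, on a set of measure about \<open>1/K\<close>, whence \<open>(1 - \<rho>) M\<^sub>p\<close> is at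
  least of order \<open>K\<^bsup>-1/p\<^esup>\<close>.
\<^item> For \<open>p \<le> 2\<close> the derivative should be spread evenly instead. The iteration
  \<open>B(z) \<mapsto> (a + z B(z\<^sup>4)) / (1 + a z B(z\<^sup>4))\<close> with \<open>a\<close> of order \<open>K\<^bsup>-1/2\<^esup>\<close> produces
  \<open>K\<close> Taylor coefficients of order \<open>K\<^bsup>-1/2\<^esup>\<close> at lacunary frequencies, and a single Taylor coefficient
  already bounds \<open>M\<^sub>1 \<le> M\<^sub>p\<close> from below at the scale given by its frequency.\<close>

section \<open>Integrals over the unit circle\<close>

interpretation circle: prob_space circle_measure
  by (rule prob_space_circle_measure)

lemma borel_measurable_circle:
  fixes f :: "complex \<Rightarrow> 'a::topological_space"
  assumes "continuous_on (sphere 0 1) f"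
  shows "f \<in> borel_measurable circle_measure"
proof -
  have "f \<in> borel_measurable (restrict_space borel (sphere 0 1))"
    by (rule borel_measurable_continuous_on_restrict[OF assms])
  then show ?thesis
    by (simp add: circle_measure_def cong: measurable_cong_sets)
qed

lemma integrable_circle:
  fixes f :: "complex \<Rightarrow> 'a::{banach, second_countable_topology}"
  assumes "continuous_on (sphere 0 1) f"
  shows "integrable circle_measure f"
proof -
  have "compact (f ` sphere 0 1)"
    by (intro compact_continuous_image assms compact_sphere)
  then obtain B where "\<And>x. x \<in> sphere 0 1 \<Longrightarrow> norm (f x) \<le> B"
    by (meson bounded_iff compact_imp_bounded imageI)
  then show ?thesis
    by (intro circle.integrable_const_bound[of _ B] borel_measurable_circle assms AE_I2)
       (simp add: space_circle_measure)
qed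

lemma integral_circle_eq:
  fixes f :: "complex \<Rightarrow> complex"
  assumes "continuous_on (sphere 0 1) f"
  shows "(\<integral>\<zeta>. f \<zeta> \<partial>circle_measure) = (1 / (2 * pi)) *\<^sub>R integral {0..2 * pi} (\<lambda>t. f (cis t))"
proof -
  have cis_borel: "cis \<in> borel_measurable borel"
    by (intro borel_measurable_continuous_onI continuous_intros)
  have f: "f \<in> borel_measurable (restrict_space borel (sphere 0 1))"
    by (rule borel_measurable_continuous_on_restrict[OF assms])
  have cis: "cis \<in> lborel \<rightarrow>\<^sub>M restrict_space borel (sphere 0 1)"
    using cis_borel by (auto intro!: measurable_restrict_space2)
  have meas: "(\<lambda>t. f (cis t)) \<in> borel_measurable lborel"
    by (rule measurable_compose[OF cis f])
  have cont: "continuous_on UNIV (\<lambda>t. f (cis t))"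
    by (rule continuous_on_compose2[OF assms]) (auto intro: continuous_intros)
  have dens: "uniform_measure lborel {0..<2 * pi}
       = density lborel (\<lambda>t. ennreal (indicator {0..<2 * pi} t / (2 * pi)))"
    unfolding uniform_measure_def
    by (intro density_cong) (auto split: split_indicator simp: divide_ennreal intro!: AE_I2
        simp flip: ennreal_1)
  have int: "set_integrable lborel {0..2*pi} (\<lambda>t. f (cis t))"
    unfolding set_integrable_def
    by (rule borel_integrable_compact) (auto intro: continuous_on_subset[OF cont])
  have "(\<integral>\<zeta>. f \<zeta> \<partial>circle_measure) = (\<integral>t. f (cis t) \<partial>uniform_measure lborel {0..<2 * pi})"
    unfolding circle_measure_def
    by (rule integral_distr[OF _ f]) (use cis in simp)
  also have "\<dots> = (\<integral>t. (indicator {0..<2 * pi} t / (2 * pi)) *\<^sub>R f (cis t) \<partial>lborel)"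
    unfolding dens by (rule integral_density) (use meas in auto)
  also have "\<dots> = (\<integral>t. (1 / (2 * pi)) *\<^sub>R (indicator {0..<2 * pi} t *\<^sub>R f (cis t)) \<partial>lborel)"
    by (intro Bochner_Integration.integral_cong) (auto simp: field_simps)
  also have "\<dots> = (1 / (2 * pi)) *\<^sub>R (LINT t:{0..<2 * pi}|lborel. f (cis t))"
    unfolding set_lebesgue_integral_def by (rule Bochner_Integration.integral_scaleR_right)
  also have "(LINT t:{0..<2 * pi}|lborel. f (cis t)) = (LINT t:{0..2 * pi}|lborel. f (cis t))"
  proof (rule set_integral_cong_set)
    show "set_borel_measurable lborel {0..<2 * pi} (\<lambda>t. f (cis t))"
      unfolding set_borel_measurable_def using meas by measurable
    show "set_borel_measurable lborel {0..2 * pi} (\<lambda>t. f (cis t))"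
      unfolding set_borel_measurable_def using meas by measurable
    show "AE x in lborel. (x \<in> {0..2 * pi}) = (x \<in> {0..<2 * pi})"
      using AE_lborel_singleton[of "2 * pi"] by eventually_elim auto
  qed
  also have "\<dots> = integral {0..2 * pi} (\<lambda>t. f (cis t))"
    using int by (rule set_borel_integral_eq_integral)
  finally show ?thesis .
qed

text \<open>The bridge between the circle measure and contour integration: it turns the Cauchy formulas into statements about means.\<close>

lemma integral_circle_contour:
  assumes "continuous_on (sphere 0 1) h" and "(h has_contour_integral I) (circlepath 0 1)"
  shows "(\<integral>\<zeta>. h \<zeta> * \<zeta> \<partial>circle_measure) = I / (2 * pi * \<i>)"
proof -
  have "I = integral {0..2 * pi} (\<lambda>t. (h (cis t) * cis t) * \<i>)"
    using contour_integral_unique[OF assms(2)]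
    by (simp add: circlepath_def contour_integral_part_circlepath_eq mult_ac)
  also have "\<dots> = integral {0..2 * pi} (\<lambda>t. h (cis t) * cis t) * \<i>"
    by (rule integral_mult_left)
  finally show ?thesis
    by (subst integral_circle_eq)
       (auto intro!: continuous_intros assms simp: scaleR_conv_of_real field_simps)
qed

definition taylor_coeff :: "(complex \<Rightarrow> complex) \<Rightarrow> nat \<Rightarrow> complex" where
  "taylor_coeff f n = (deriv ^^ n) f 0 / fact n"

lemma dilate_in_ball:
  assumes "0 \<le> \<rho>" "\<rho> < 1" "norm (z::complex) \<le> 1"
  shows "of_real \<rho> * z \<in> ball 0 1"
proof -
  have "\<rho> * norm z \<le> \<rho>" using assms by (simp add: mult_left_le)
  then show ?thesis using assms by (simp add: norm_mult)
qed

lemma continuous_on_dilate: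
  assumes "f holomorphic_on ball 0 1" "0 \<le> \<rho>" "\<rho> < 1"
  shows "continuous_on (cball 0 1) (\<lambda>z. f (of_real \<rho> * z))"
proof (rule continuous_on_compose2[OF holomorphic_on_imp_continuous_on[OF assms(1)]])
  show "(\<lambda>z::complex. of_real \<rho> * z) ` cball 0 1 \<subseteq> ball 0 1"
    using dilate_in_ball assms by (intro image_subsetI) simp
qed (intro continuous_intros)

lemma holomorphic_on_dilate:
  assumes "f holomorphic_on ball 0 1" "0 \<le> \<rho>" "\<rho> < 1"
  shows "(\<lambda>z. f (of_real \<rho> * z)) holomorphic_on ball 0 1"
proof -
  have "(f \<circ> (\<lambda>z. of_real \<rho> * z)) holomorphic_on ball 0 1"
  proof (rule holomorphic_on_compose_gen[OF _ assms(1)])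
    show "(\<lambda>z::complex. of_real \<rho> * z) ` ball 0 1 \<subseteq> ball 0 1"
      using dilate_in_ball assms by (intro image_subsetI) simp
  qed (intro holomorphic_intros)
  then show ?thesis by (simp add: o_def)
qed

lemma taylor_coeff_dilate:
  assumes "f holomorphic_on ball 0 1" "0 \<le> \<rho>" "\<rho> < 1"
  shows "taylor_coeff (\<lambda>z. f (of_real \<rho> * z)) n = of_real \<rho> ^ n * taylor_coeff f n"
proof -
  have "(deriv ^^ n) (\<lambda>z. f (of_real \<rho> * z)) 0 = of_real \<rho> ^ n * (deriv ^^ n) f (of_real \<rho> * 0)"
  proof (rule higher_deriv_compose_linear[OF assms(1), of "ball 0 1"])
    fix z :: complex assume "z \<in> ball 0 1"
    then show "of_real \<rho> * z \<in> ball 0 1" using dilate_in_ball assms by simp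
  qed auto
  then show ?thesis by (simp add: taylor_coeff_def)
qed

lemma cnj_eq_inverse_on_circle: "norm z = 1 \<Longrightarrow> cnj z = 1 / z"
  by (metis complex_cnj_cancel_iff complex_cnj_one complex_mod_cnj complex_norm_square mult.commute
      nonzero_eq_divide_eq norm_zero of_real_1 one_power2 zero_neq_one)

lemma taylor_coeff_eq_integral:
  assumes "continuous_on (cball 0 1) f" "f holomorphic_on ball 0 1"
  shows "(\<integral>\<zeta>. f \<zeta> * cnj \<zeta> ^ n \<partial>circle_measure) = taylor_coeff f n"
proof -
  have cont: "continuous_on (sphere 0 1) f"
    by (rule continuous_on_subset[OF assms(1)]) auto
  have "(\<integral>\<zeta>. (f \<zeta> / (\<zeta> - 0) ^ Suc n) * \<zeta> \<partial>circle_measure)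
      = (complex_of_real (2 * pi) * \<i> / fact n * (deriv ^^ n) f 0) / (2 * pi * \<i>)"
    by (rule integral_circle_contour,
        (rule continuous_intros cont | force)+,
        rule Cauchy_has_contour_integral_higher_derivative_circlepath[OF assms]) auto
  moreover have "(\<integral>\<zeta>. (f \<zeta> / (\<zeta> - 0) ^ Suc n) * \<zeta> \<partial>circle_measure)
      = (\<integral>\<zeta>. f \<zeta> * cnj \<zeta> ^ n \<partial>circle_measure)"
    by (rule Bochner_Integration.integral_cong)
       (auto simp: space_circle_measure cnj_eq_inverse_on_circle field_simps)
  ultimately show ?thesis by (simp add: taylor_coeff_def)
qed

lemma cauchy_integral_circle:
  assumes "continuous_on (cball 0 1) f" "f holomorphic_on ball 0 1" "norm c < 1"
  shows "(\<integral>\<zeta>. f \<zeta> / (1 - c * cnj \<zeta>) \<partial>circle_measure) = f c"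
proof -
  have cont: "continuous_on (sphere 0 1) f"
    by (rule continuous_on_subset[OF assms(1)]) auto
  have "(\<integral>\<zeta>. (f \<zeta> / (\<zeta> - c) ^ Suc 0) * \<zeta> \<partial>circle_measure)
      = (complex_of_real (2 * pi) * \<i> / fact 0 * (deriv ^^ 0) f c) / (2 * pi * \<i>)"
    by (rule integral_circle_contour,
        (rule continuous_intros cont)+,
        use assms(3) in force,
        rule Cauchy_has_contour_integral_higher_derivative_circlepath[OF assms(1,2)])
       (use assms in auto)
  moreover have "(\<integral>\<zeta>. (f \<zeta> / (\<zeta> - c) ^ Suc 0) * \<zeta> \<partial>circle_measure)
      = (\<integral>\<zeta>. f \<zeta> / (1 - c * cnj \<zeta>) \<partial>circle_measure)"
  proof (rule Bochner_Integration.integral_cong, simp)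
    fix \<zeta> assume "\<zeta> \<in> space circle_measure"
    then have z: "norm \<zeta> = 1" by (simp add: space_circle_measure)
    then have "\<zeta> \<noteq> 0" by auto
    then show "(f \<zeta> / (\<zeta> - c) ^ Suc 0) * \<zeta> = f \<zeta> / (1 - c * cnj \<zeta>)"
      by (simp add: cnj_eq_inverse_on_circle[OF z] divide_simps)
  qed
  ultimately show ?thesis by simp
qed

definition poisson :: "complex \<Rightarrow> complex \<Rightarrow> real" where
  "poisson c \<zeta> = (1 - norm c ^ 2) / norm (1 - cnj c * \<zeta>) ^ 2"

lemma one_minus_mult_nonzero:
  assumes "norm (c::complex) < 1" "norm z \<le> 1"
  shows "1 - c * z \<noteq> 0"
proof
  assume "1 - c * z = 0"
  then have "norm (c * z) = 1" by simp
  moreover have "norm c * norm z \<le> norm c" using assms by (simp add: mult_left_le)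
  ultimately show False using assms by (simp add: norm_mult)
qed

lemma continuous_on_poisson [continuous_intros]:
  assumes "norm c < 1"
  shows "continuous_on (sphere 0 1) (poisson c)"
  unfolding poisson_def[abs_def]
  by (intro continuous_intros) (use one_minus_mult_nonzero[of "cnj c"] assms in auto)

text \<open>Applying Cauchy's formula to \<open>f(z) (1 - \<bar>c\<bar>\<^sup>2) / (1 - cnj c z)\<close> instead of \<open>f\<close> does not change the value
at \<open>c\<close>, but makes the kernel positive.\<close>

lemma poisson_formula:
  assumes "continuous_on (cball 0 1) f" "f holomorphic_on ball 0 1" "norm c < 1"
  shows "(\<integral>\<zeta>. f \<zeta> * poisson c \<zeta> \<partial>circle_measure) = f c"
proof -
  \<comment> \<open>The additional factor equals \<open>1\<close> at \<open>c\<close>.\<close>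
  define g where "g z = f z * (1 - norm c ^ 2) / (1 - cnj c * z)" for z
  have nz: "1 - cnj c * z \<noteq> 0" if "norm z \<le> 1" for z
    using one_minus_mult_nonzero[of "cnj c"] assms that by simp
  have "(\<integral>\<zeta>. g \<zeta> / (1 - c * cnj \<zeta>) \<partial>circle_measure) = g c"
    unfolding g_def[abs_def]
    by (rule cauchy_integral_circle; (intro continuous_intros holomorphic_intros assms)?)
       (use nz assms in auto)
  also have "g c = f c"
    using nz[of c] assms by (simp add: g_def complex_norm_square[symmetric] mult.commute)
  also have "(\<integral>\<zeta>. g \<zeta> / (1 - c * cnj \<zeta>) \<partial>circle_measure)
      = (\<integral>\<zeta>. f \<zeta> * poisson c \<zeta> \<partial>circle_measure)"
  proof (rule Bochner_Integration.integral_cong, simp)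
    fix \<zeta> assume "\<zeta> \<in> space circle_measure"
    have "complex_of_real (norm (1 - cnj c * \<zeta>) ^ 2) = (1 - cnj c * \<zeta>) * (1 - c * cnj \<zeta>)"
      by (subst complex_norm_square) simp
    then show "g \<zeta> / (1 - c * cnj \<zeta>) = f \<zeta> * poisson c \<zeta>"
      by (simp add: g_def poisson_def)
  qed
  finally show ?thesis by simp
qed

lemma integral_poisson:
  assumes "norm c < 1"
  shows "(\<integral>\<zeta>. poisson c \<zeta> \<partial>circle_measure) = 1"
proof -
  have "complex_of_real (\<integral>\<zeta>. poisson c \<zeta> \<partial>circle_measure) = (\<integral>\<zeta>. 1 * complex_of_real (poisson c \<zeta>) \<partial>circle_measure)"
    by simp
  also have "\<dots> = 1"
    by (rule poisson_formula) (use assms in auto)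
  finally show ?thesis by (metis of_real_eq_1_iff)
qed

lemma poisson_nonneg: "norm c < 1 \<Longrightarrow> 0 \<le> poisson c \<zeta>"
  by (auto simp: poisson_def intro!: divide_nonneg_nonneg simp: power_le_one abs_square_le_1)

text \<open>The graph of the convex function \<open>x \<mapsto> x\<^sup>p\<close> lies above its tangent at \<open>a\<close>.\<close>

lemma powr_tangent:
  fixes x a p :: real
  assumes "0 \<le> x" "0 < a" "1 \<le> p"
  shows "p * a powr (p - 1) * x - (p - 1) * a powr p \<le> x powr p"
proof (cases "x = 0")
  case True
  then show ?thesis using assms by (simp add: mult_nonneg_nonneg)
next
  case False
  then have x: "x > 0" using assms by simp
  have "(x powr p) powr (1/p) * (a powr p) powr (1 - 1/p) \<le> (1/p) * x powr p + (1 - 1/p) * a powr p"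
    using assms x by (intro Youngs_inequality_0) auto
  moreover have "(x powr p) powr (1/p) = x" using x assms by (simp add: powr_powr)
  moreover have "(a powr p) powr (1 - 1/p) = a powr (p - 1)"
    using assms by (simp add: powr_powr right_diff_distrib)
  ultimately have "p * (x * a powr (p - 1)) \<le> p * ((1/p) * x powr p + (1 - 1/p) * a powr p)"
    using assms by (intro mult_left_mono) auto
  also have "\<dots> = x powr p + (p - 1) * a powr p"
    using assms by (simp add: field_simps)
  finally show ?thesis by (simp add: algebra_simps)
qed

text \<open>Jensen's inequality for the weight \<open>W\<close>, obtained by integrating the tangent inequality; the bound
\<open>W \<le> H\<close> serves to pass to the unweighted mean. With the constant weight it compares \<open>L\<^sup>p\<close> means, with a sum of
Poisson kernels it turns values at points inside the disc into lower bounds for means.\<close>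

lemma weighted_mean_power:
  fixes u W :: "complex \<Rightarrow> real"
  assumes contu: "continuous_on (sphere 0 1) u" and contW: "continuous_on (sphere 0 1) W"
    and u: "\<And>\<zeta>. \<zeta> \<in> sphere 0 1 \<Longrightarrow> 0 \<le> u \<zeta>"
    and W: "\<And>\<zeta>. \<zeta> \<in> sphere 0 1 \<Longrightarrow> 0 \<le> W \<zeta>" "\<And>\<zeta>. \<zeta> \<in> sphere 0 1 \<Longrightarrow> W \<zeta> \<le> H"
    and intW: "(\<integral>\<zeta>. W \<zeta> \<partial>circle_measure) \<le> 1"
    and a: "0 \<le> a" "a \<le> (\<integral>\<zeta>. u \<zeta> * W \<zeta> \<partial>circle_measure)"
    and p: "1 \<le> p" and H: "0 < H"
  shows "a powr p / H \<le> (\<integral>\<zeta>. u \<zeta> powr p \<partial>circle_measure)"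
proof (cases "a = 0")
  case True
  then show ?thesis using p by simp
next
  case False
  then have a0: "a > 0" using a by simp
  have contp: "continuous_on (sphere 0 1) (\<lambda>\<zeta>. u \<zeta> powr p)"
    using p u by (intro continuous_on_powr' contu continuous_intros) auto
  note int = integrable_circle[OF continuous_on_mult[OF contu contW]]
    integrable_circle[OF contW] integrable_circle[OF continuous_on_mult[OF contp contW]]
    integrable_circle[OF contp]
  have "a powr p = p * a powr (p - 1) * a - (p - 1) * a powr p * 1"
    using a0 by (simp add: powr_diff field_simps)
  also have "\<dots> \<le> p * a powr (p - 1) * (\<integral>\<zeta>. u \<zeta> * W \<zeta> \<partial>circle_measure)
      - (p - 1) * a powr p * (\<integral>\<zeta>. W \<zeta> \<partial>circle_measure)"
    using p a intW by (intro diff_mono mult_left_mono) auto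
  also have "\<dots> = (\<integral>\<zeta>. p * a powr (p - 1) * (u \<zeta> * W \<zeta>) - (p - 1) * a powr p * W \<zeta> \<partial>circle_measure)"
    using int by simp
  also have "\<dots> \<le> (\<integral>\<zeta>. u \<zeta> powr p * W \<zeta> \<partial>circle_measure)"
  proof (rule integral_mono)
    fix \<zeta> assume "\<zeta> \<in> space circle_measure"
    then have z: "\<zeta> \<in> sphere 0 1" by (simp add: space_circle_measure)
    have "(p * a powr (p - 1) * u \<zeta> - (p - 1) * a powr p) * W \<zeta> \<le> u \<zeta> powr p * W \<zeta>"
      using powr_tangent[OF u[OF z] a0 p] W(1)[OF z] by (rule mult_right_mono)
    then show "p * a powr (p - 1) * (u \<zeta> * W \<zeta>) - (p - 1) * a powr p * W \<zeta> \<le> u \<zeta> powr p * W \<zeta>"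
      by (simp add: algebra_simps)
  qed (use int in auto)
  also have "\<dots> \<le> (\<integral>\<zeta>. u \<zeta> powr p * H \<partial>circle_measure)"
    by (rule integral_mono) (use int W in \<open>auto simp: space_circle_measure intro!: mult_left_mono\<close>)
  also have "\<dots> = (\<integral>\<zeta>. u \<zeta> powr p \<partial>circle_measure) * H"
    by simp
  finally show ?thesis using H by (simp add: field_simps)
qed

lemma mean_power:
  fixes u :: "complex \<Rightarrow> real"
  assumes "continuous_on (sphere 0 1) u" "\<And>\<zeta>. \<zeta> \<in> sphere 0 1 \<Longrightarrow> 0 \<le> u \<zeta>" "1 \<le> p"
  shows "(\<integral>\<zeta>. u \<zeta> \<partial>circle_measure) powr p \<le> (\<integral>\<zeta>. u \<zeta> powr p \<partial>circle_measure)"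
proof -
  have "0 \<le> (\<integral>\<zeta>. u \<zeta> \<partial>circle_measure)"
    using assms(2) by (intro integral_nonneg_AE AE_I2) (simp add: space_circle_measure)
  then show ?thesis
    using weighted_mean_power[OF assms(1), of "\<lambda>_. 1" 1 "\<integral>\<zeta>. u \<zeta> \<partial>circle_measure" p] assms
    by simp
qed

lemma parseval_circle:
  assumes "f holomorphic_on ball 0 1" "0 \<le> \<rho>" "\<rho> < 1"
  shows "(\<lambda>n. norm (taylor_coeff f n) ^ 2 * \<rho> ^ (2 * n)) sums
           (\<integral>\<zeta>. norm (f (of_real \<rho> * \<zeta>)) ^ 2 \<partial>circle_measure)"
proof -
  define g where "g z = f (of_real \<rho> * z)" for z
  have contg: "continuous_on (cball 0 1) g" and holg: "g holomorphic_on ball 0 1"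
    unfolding g_def using assms by (auto intro!: continuous_on_dilate holomorphic_on_dilate)
  have contgs: "continuous_on (sphere 0 1) g"
    by (rule continuous_on_subset[OF contg]) auto
  define b where "b n = taylor_coeff f n * of_real \<rho> ^ n" for n
  have coef: "taylor_coeff g n = b n" for n
    unfolding g_def b_def using taylor_coeff_dilate[OF assms] by simp
  have ser: "(\<lambda>n. b n * \<zeta> ^ n) sums g \<zeta>" if "norm \<zeta> \<le> 1" for \<zeta>
  proof -
    from holomorphic_power_series[OF assms(1) dilate_in_ball[OF assms(2,3) that]] show ?thesis
      by (simp add: b_def g_def taylor_coeff_def power_mult_distrib mult_ac)
  qed
  have summ: "summable (\<lambda>n. norm (b n))"
  proof -
    obtain s where s: "\<rho> < s" "s < 1" using assms dense by blast
    then have "of_real s \<in> ball (0::complex) 1" using assms by simp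
    from holomorphic_power_series[OF assms(1) this]
    have "summable (\<lambda>n. taylor_coeff f n * of_real s ^ n)"
      by (simp add: taylor_coeff_def sums_iff)
    from powser_insidea[OF this, of "of_real \<rho>"] show ?thesis
      using s assms by (simp add: b_def)
  qed
  have "(\<lambda>n. \<integral>\<zeta>. (b n * \<zeta> ^ n) * cnj (g \<zeta>) \<partial>circle_measure) sums
      (\<integral>\<zeta>. (\<Sum>n. (b n * \<zeta> ^ n) * cnj (g \<zeta>)) \<partial>circle_measure)"
  proof (rule sums_integral)
    show "integrable circle_measure (\<lambda>\<zeta>. b n * \<zeta> ^ n * cnj (g \<zeta>))" for n
      by (intro integrable_circle continuous_intros contgs)
    have "summable (\<lambda>n. norm (b n * \<zeta> ^ n * cnj (g \<zeta>)))" if "norm \<zeta> = 1" for \<zeta>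
      using summable_mult2[OF summ, of "norm (g \<zeta>)"] that by (simp add: norm_mult norm_power)
    then show "AE \<zeta> in circle_measure. summable (\<lambda>n. norm (b n * \<zeta> ^ n * cnj (g \<zeta>)))"
      by (intro AE_I2) (simp add: space_circle_measure)
    have "(\<integral>\<zeta>. norm (b n * \<zeta> ^ n * cnj (g \<zeta>)) \<partial>circle_measure)
        = norm (b n) * (\<integral>\<zeta>. norm (g \<zeta>) \<partial>circle_measure)" for n
      by (subst integral_mult_right_zero[symmetric], rule Bochner_Integration.integral_cong)
         (auto simp: space_circle_measure norm_mult norm_power)
    then show "summable (\<lambda>n. \<integral>\<zeta>. norm (b n * \<zeta> ^ n * cnj (g \<zeta>)) \<partial>circle_measure)"
      using summable_mult2[OF summ] by simp
  qed
  moreover have "(\<integral>\<zeta>. (b n * \<zeta> ^ n) * cnj (g \<zeta>) \<partial>circle_measure) = of_real (norm (b n) ^ 2)" for n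
  proof -
    have "(\<integral>\<zeta>. (b n * \<zeta> ^ n) * cnj (g \<zeta>) \<partial>circle_measure)
        = (\<integral>\<zeta>. b n * cnj (g \<zeta> * cnj \<zeta> ^ n) \<partial>circle_measure)"
      by (simp add: mult_ac)
    also have "\<dots> = b n * cnj (\<integral>\<zeta>. g \<zeta> * cnj \<zeta> ^ n \<partial>circle_measure)"
      by (simp only: integral_mult_right_zero Bochner_Integration.integral_cnj)
    also have "\<dots> = of_real (norm (b n) ^ 2)"
      by (simp only: taylor_coeff_eq_integral[OF contg holg] coef complex_norm_square)
    finally show ?thesis .
  qed
  moreover have "(\<integral>\<zeta>. (\<Sum>n. (b n * \<zeta> ^ n) * cnj (g \<zeta>)) \<partial>circle_measure)
      = of_real (\<integral>\<zeta>. norm (g \<zeta>) ^ 2 \<partial>circle_measure)"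
  proof -
    have "(\<Sum>n. (b n * \<zeta> ^ n) * cnj (g \<zeta>)) = of_real (norm (g \<zeta>) ^ 2)" if "norm \<zeta> = 1" for \<zeta>
    proof -
      have "(\<lambda>n. (b n * \<zeta> ^ n) * cnj (g \<zeta>)) sums (g \<zeta> * cnj (g \<zeta>))"
        by (rule sums_mult2[OF ser]) (use that in simp)
      then show ?thesis by (simp only: complex_norm_square sums_iff)
    qed
    then have "(\<integral>\<zeta>. (\<Sum>n. (b n * \<zeta> ^ n) * cnj (g \<zeta>)) \<partial>circle_measure)
        = (\<integral>\<zeta>. of_real (norm (g \<zeta>) ^ 2) \<partial>circle_measure)"
      by (intro Bochner_Integration.integral_cong) (auto simp: space_circle_measure)
    then show ?thesis by (simp only: integral_complex_of_real)
  qed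
  ultimately have "(\<lambda>n. complex_of_real (norm (b n) ^ 2)) sums
      of_real (\<integral>\<zeta>. norm (g \<zeta>) ^ 2 \<partial>circle_measure)"
    by simp
  then have "(\<lambda>n. norm (b n) ^ 2) sums (\<integral>\<zeta>. norm (g \<zeta>) ^ 2 \<partial>circle_measure)"
    by (simp only: sums_of_real_iff)
  then show ?thesis
    using assms by (simp add: b_def g_def norm_mult norm_power power_mult_distrib power_mult
        power_commutes mult.commute flip: power_mult)
qed

section \<open>Blaschke products and the energy of their derivative\<close>

lemma moebius_norm_identity:
  "norm (1 - cnj a * z) ^ 2 - norm (z - a) ^ 2 = (1 - norm a ^ 2) * (1 - norm z ^ 2)"
  by (simp add: cmod_power2) (simp add: algebra_simps power2_eq_square)

lemma norm_moebius_le_1: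
  assumes "norm a < 1" "norm z \<le> 1"
  shows "norm ((z - a) / (1 - cnj a * z)) \<le> 1"
proof -
  have "0 \<le> (1 - norm a ^ 2) * (1 - norm z ^ 2)"
    using assms by (intro mult_nonneg_nonneg) (auto simp: abs_square_le_1)
  then have "norm (z - a) ^ 2 \<le> norm (1 - cnj a * z) ^ 2"
    using moebius_norm_identity[of a z] by linarith
  then have "norm (z - a) \<le> norm (1 - cnj a * z)"
    by (rule power2_le_imp_le) auto
  then show ?thesis
    using one_minus_mult_nonzero[of "cnj a" z] assms by (simp add: norm_divide divide_le_eq_1)
qed

lemma blaschke_Nil [simp]: "blaschke [] z = 1"
  by (simp add: blaschke_def)

lemma blaschke_Cons: "blaschke (a # \<sigma>) z = (z - a) / (1 - cnj a * z) * blaschke \<sigma> z"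
  by (simp add: blaschke_def)

lemma norm_blaschke_le_1:
  assumes "set \<sigma> \<subseteq> ball 0 1" "norm z \<le> 1"
  shows "norm (blaschke \<sigma> z) \<le> 1"
  using assms(1)
proof (induction \<sigma>)
  case (Cons a \<sigma>)
  then have "norm ((z - a) / (1 - cnj a * z)) * norm (blaschke \<sigma> z) \<le> 1"
    by (intro mult_le_one norm_moebius_le_1) (use assms in auto)
  then show ?case by (simp add: blaschke_Cons norm_mult norm_divide)
qed simp

lemma holomorphic_on_blaschke:
  assumes "set \<sigma> \<subseteq> ball 0 1"
  shows "blaschke \<sigma> holomorphic_on ball 0 1"
  using assms
proof (induction \<sigma>)
  case Nil
  then show ?case by (simp add: blaschke_def[abs_def])
next
  case (Cons a \<sigma>)
  then have "(\<lambda>z. (z - a) / (1 - cnj a * z) * blaschke \<sigma> z) holomorphic_on ball 0 1"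
    by (intro holomorphic_intros) (use one_minus_mult_nonzero[of "cnj a"] in auto)
  then show ?case by (simp add: blaschke_Cons[abs_def])
qed

lemma moebius_has_derivative:
  assumes "norm a < 1" "norm z \<le> 1"
  shows "((\<lambda>z. (z - a) / (1 - cnj a * z)) has_field_derivative
            (1 - norm a ^ 2) / (1 - cnj a * z) ^ 2) (at z)"
proof -
  have nz: "1 - cnj a * z \<noteq> 0" using one_minus_mult_nonzero[of "cnj a" z] assms by simp
  have "((\<lambda>z. (z - a) / (1 - cnj a * z)) has_field_derivative
            ((1 - 0) * (1 - cnj a * z) - (z - a) * (0 - cnj a * 1)) / ((1 - cnj a * z) * (1 - cnj a * z))) (at z)"
    by (rule derivative_eq_intros refl nz | simp)+
  moreover have "(1 - 0) * (1 - cnj a * z) - (z - a) * (0 - cnj a * 1) = 1 - complex_of_real (norm a) ^ 2"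
    using complex_norm_square[of a] by (simp add: algebra_simps)
  ultimately show ?thesis by (simp only: power2_eq_square of_real_diff of_real_1 of_real_mult)
qed

text \<open>By the product rule, because the remaining factors are bounded by \<open>1\<close>.\<close>

lemma norm_deriv_blaschke_le_sum:
  assumes "set \<sigma> \<subseteq> ball 0 1" "norm z < 1"
  shows "norm (deriv (blaschke \<sigma>) z) \<le> (\<Sum>a\<leftarrow>\<sigma>. (1 - norm a ^ 2) / norm (1 - cnj a * z) ^ 2)"
  using assms(1)
proof (induction \<sigma>)
  case Nil
  then show ?case by (simp add: blaschke_def[abs_def])
next
  case (Cons a \<sigma>)
  have a: "norm a < 1" and s: "set \<sigma> \<subseteq> ball 0 1" using Cons.prems by auto
  let ?b = "(z - a) / (1 - cnj a * z)" and ?b' = "(1 - norm a ^ 2) / (1 - cnj a * z) ^ 2"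
  have z: "z \<in> ball 0 1" using assms by simp
  have "(blaschke \<sigma> has_field_derivative deriv (blaschke \<sigma>) z) (at z)"
    by (rule holomorphic_derivI[OF holomorphic_on_blaschke[OF s] _ z]) simp
  then have "((\<lambda>z. (z - a) / (1 - cnj a * z) * blaschke \<sigma> z) has_field_derivative
      ?b * deriv (blaschke \<sigma>) z + ?b' * blaschke \<sigma> z) (at z)"
    by (intro DERIV_mult'  moebius_has_derivative a) (use assms in auto)
  then have "deriv (blaschke (a # \<sigma>)) z = ?b * deriv (blaschke \<sigma>) z + ?b' * blaschke \<sigma> z"
    by (simp add: blaschke_Cons[abs_def] DERIV_imp_deriv)
  also have "norm \<dots> \<le> norm ?b * norm (deriv (blaschke \<sigma>) z) + norm ?b' * norm (blaschke \<sigma> z)"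
    by (metis norm_mult norm_triangle_ineq)
  also have "\<dots> \<le> 1 * norm (deriv (blaschke \<sigma>) z) + norm ?b' * 1"
    by (intro add_mono mult_mono norm_moebius_le_1 norm_blaschke_le_1 order_refl a s) (use assms in auto)
  also have "norm ?b' = (1 - norm a ^ 2) / norm (1 - cnj a * z) ^ 2"
  proof -
    have "norm a ^ 2 \<le> 1" using a by (simp add: abs_square_le_1)
    then have "norm (1 - complex_of_real (norm a ^ 2)) = 1 - norm a ^ 2"
      by (metis abs_of_nonneg diff_ge_0_iff_ge norm_of_real of_real_1 of_real_diff)
    then show ?thesis by (simp add: norm_divide norm_power)
  qed
  finally show ?case using Cons.IH[OF s] by simp
qed

text \<open>Cauchy's estimate on discs whose radius approaches \<open>1 - \<bar>z\<bar>\<close>.\<close>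

lemma norm_deriv_le_of_bounded:
  assumes "f holomorphic_on ball 0 1" "\<And>z. norm z < 1 \<Longrightarrow> norm (f z) \<le> 1" "norm z < 1"
  shows "(1 - norm z) * norm (deriv f z) \<le> 1"
proof (rule ccontr)
  assume "\<not> ?thesis"
  then have gt: "1 < (1 - norm z) * norm (deriv f z)" by simp
  then have nz: "norm (deriv f z) > 0" by (cases "deriv f z = 0") auto
  have less: "1 / norm (deriv f z) < 1 - norm z"
    using gt nz by (simp add: pos_divide_less_eq)
  obtain r where r: "1 / norm (deriv f z) < r" "r < 1 - norm z"
    using less dense by blast
  have r0: "0 < r" using r nz by (meson divide_pos_pos less_trans zero_less_one)
  have sub: "cball z r \<subseteq> ball 0 1"
  proof
    fix w assume "w \<in> cball z r"
    then have "norm w \<le> norm z + r" by (smt (verit) dist_norm mem_cball norm_minus_commute norm_triangle_sub)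
    then show "w \<in> ball 0 1" using r by simp
  qed
  have "norm ((deriv ^^ 1) f z) \<le> fact 1 * 1 / r ^ 1"
  proof (rule Cauchy_inequality)
    show "f holomorphic_on ball z r"
      by (rule holomorphic_on_subset[OF assms(1)]) (use sub ball_subset_cball in blast)
    show "continuous_on (cball z r) f"
      by (rule holomorphic_on_imp_continuous_on[OF holomorphic_on_subset[OF assms(1) sub]])
    fix w assume "norm (z - w) = r"
    then have "w \<in> cball z r" by (simp add: dist_norm)
    then show "norm (f w) \<le> 1" using sub assms(2) by (auto simp: dist_norm)
  qed (fact r0)
  then show False using r nz r0 by (simp add: field_simps)
qed

lemma holomorphic_on_deriv_blaschke:
  "set \<sigma> \<subseteq> ball 0 1 \<Longrightarrow> deriv (blaschke \<sigma>) holomorphic_on ball 0 1"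
  by (intro holomorphic_deriv holomorphic_on_blaschke) auto

lemma continuous_on_circle_dilate:
  assumes "f holomorphic_on ball 0 1" "0 \<le> \<rho>" "\<rho> < 1"
  shows "continuous_on (sphere 0 1) (\<lambda>\<zeta>. f (of_real \<rho> * \<zeta>))"
  by (rule continuous_on_subset[OF continuous_on_dilate[OF assms]]) auto

text \<open>Each term of \<open>norm_deriv_blaschke_le_sum\<close> is dominated on the circle of radius \<open>\<rho>\<close> by the Poisson kernel at
\<open>\<rho> a\<close>, whose mean is \<open>1\<close>.\<close>

lemma integral_deriv_blaschke_le:
  assumes "set \<sigma> \<subseteq> ball 0 1" "0 \<le> \<rho>" "\<rho> < 1"
  shows "(\<integral>\<zeta>. norm (deriv (blaschke \<sigma>) (of_real \<rho> * \<zeta>)) \<partial>circle_measure) \<le> length \<sigma>"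
proof -
  let ?c = "\<lambda>a::complex. of_real \<rho> * a"
  have c: "norm (?c a) < 1" if "a \<in> set \<sigma>" for a
    using dilate_in_ball[of \<rho> a] assms that by (auto simp: less_imp_le)
  have pc: "continuous_on (sphere 0 1) (poisson (?c a))" if "a \<in> set \<sigma>" for a
    by (intro continuous_intros c that)
  have sumc: "continuous_on (sphere 0 1) (\<lambda>\<zeta>. \<Sum>a\<leftarrow>\<tau>. poisson (?c a) \<zeta>)" if "set \<tau> \<subseteq> set \<sigma>" for \<tau>
    using that by (induction \<tau>) (auto intro!: continuous_intros c)
  have "(\<integral>\<zeta>. norm (deriv (blaschke \<sigma>) (of_real \<rho> * \<zeta>)) \<partial>circle_measure)
      \<le> (\<integral>\<zeta>. (\<Sum>a\<leftarrow>\<sigma>. poisson (?c a) \<zeta>) \<partial>circle_measure)"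
  proof (rule integral_mono)
    show "integrable circle_measure (\<lambda>\<zeta>. norm (deriv (blaschke \<sigma>) (of_real \<rho> * \<zeta>)))"
      by (intro integrable_circle continuous_intros continuous_on_circle_dilate
          holomorphic_on_deriv_blaschke assms)
    show "integrable circle_measure (\<lambda>\<zeta>. \<Sum>a\<leftarrow>\<sigma>. poisson (?c a) \<zeta>)"
      by (intro integrable_circle sumc order_refl)
    fix \<zeta> assume "\<zeta> \<in> space circle_measure"
    then have z: "norm (of_real \<rho> * \<zeta>) < 1"
      using assms by (simp add: space_circle_measure norm_mult)
    have "norm (deriv (blaschke \<sigma>) (of_real \<rho> * \<zeta>))
        \<le> (\<Sum>a\<leftarrow>\<sigma>. (1 - norm a ^ 2) / norm (1 - cnj a * (of_real \<rho> * \<zeta>)) ^ 2)"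
      by (rule norm_deriv_blaschke_le_sum[OF assms(1) z])
    also have "\<dots> \<le> (\<Sum>a\<leftarrow>\<sigma>. poisson (?c a) \<zeta>)"
    proof (rule sum_list_mono)
      fix a :: complex
      have "\<rho>\<^sup>2 * (norm a)\<^sup>2 \<le> (norm a)\<^sup>2"
        using assms by (simp add: mult_left_le_one_le abs_square_le_1)
      then show "(1 - norm a ^ 2) / norm (1 - cnj a * (of_real \<rho> * \<zeta>)) ^ 2 \<le> poisson (?c a) \<zeta>"
        unfolding poisson_def
        by (simp add: norm_mult power_mult_distrib mult_ac divide_right_mono)
    qed
    finally show "norm (deriv (blaschke \<sigma>) (of_real \<rho> * \<zeta>)) \<le> (\<Sum>a\<leftarrow>\<sigma>. poisson (?c a) \<zeta>)" .
  qed
  also have "(\<integral>\<zeta>. (\<Sum>a\<leftarrow>\<tau>. poisson (?c a) \<zeta>) \<partial>circle_measure) = length \<tau>" if "set \<tau> \<subseteq> set \<sigma>" for \<tau>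
    using that
  proof (induction \<tau>)
    case (Cons a \<tau>)
    then have "integrable circle_measure (poisson (?c a))"
        "integrable circle_measure (\<lambda>\<zeta>. \<Sum>a\<leftarrow>\<tau>. poisson (?c a) \<zeta>)"
      by (auto intro!: integrable_circle sumc pc)
    then show ?case using Cons by (simp add: integral_poisson c)
  qed simp
  from this[OF order_refl]
  have "(\<integral>\<zeta>. (\<Sum>a\<leftarrow>\<sigma>. poisson (?c a) \<zeta>) \<partial>circle_measure) = length \<sigma>" .
  finally show ?thesis .
qed

lemma ennreal_exponent_cases:
  assumes "1 \<le> (p::ennreal)"
  obtains (fin) P where "1 \<le> P" "p = ennreal P" "enn2real p = P" "recip p = 1 / P" "p \<noteq> \<infinity>"
  | (inf) "p = \<infinity>" "recip p = 0"
proof (cases p)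
  case (real P)
  then have P: "1 \<le> P" using assms by simp
  then have "1 / p = ennreal (1 / P)"
    using real divide_ennreal[of 1 P] by simp
  then show ?thesis using fin[of P] real P by (simp add: recip_def)
next
  case top
  then show ?thesis using inf by (simp add: recip_def)
qed

lemma ennreal_powr_ennreal: "0 \<le> x \<Longrightarrow> ennreal_powr (ennreal x) a = ennreal (x powr a)"
  by (simp add: ennreal_powr_def)

lemma ennreal_powr_mono:
  assumes "X \<le> Y" "0 \<le> a"
  shows "ennreal_powr X a \<le> ennreal_powr Y a"
proof (cases "Y = \<infinity>")
  case False
  then have "X \<noteq> \<infinity>" using assms by (auto simp: top_unique)
  then show ?thesis
    using False assms by (auto simp: ennreal_powr_def intro!: ennreal_leI powr_mono2 enn2real_mono simp: less_top)
qed (simp add: ennreal_powr_def)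

lemma Lp_norm_circle:
  assumes "continuous_on (sphere 0 1) F" "p = ennreal P" "1 \<le> P" "recip p = 1 / P"
  shows "Lp_norm p circle_measure F
       = ennreal ((\<integral>\<zeta>. norm (F \<zeta>) powr P \<partial>circle_measure) powr (1 / P))"
proof -
  have "continuous_on (sphere 0 1) (\<lambda>\<zeta>. norm (F \<zeta>) powr P)"
    using assms by (intro continuous_on_powr' continuous_intros) auto
  then have "(\<integral>\<^sup>+\<zeta>. ennreal (norm (F \<zeta>) powr P) \<partial>circle_measure)
      = ennreal (\<integral>\<zeta>. norm (F \<zeta>) powr P \<partial>circle_measure)"
    by (intro nn_integral_eq_integral integrable_circle) auto
  then show ?thesis
    using assms by (simp add: Lp_norm_def ennreal_powr_ennreal integral_nonneg_AE)
qed

lemma esssup_circle_le: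
  assumes "continuous_on (sphere 0 1) F" "\<And>\<zeta>. norm \<zeta> = 1 \<Longrightarrow> norm (F \<zeta>) \<le> M"
  shows "Lp_norm \<infinity> circle_measure F \<le> ennreal M"
proof -
  have "(\<lambda>\<zeta>. ennreal (norm (F \<zeta>))) \<in> borel_measurable circle_measure"
    by (intro measurable_compose[OF _ measurable_ennreal] borel_measurable_circle continuous_intros assms)
  then show ?thesis
    unfolding Lp_norm_def
    by (auto intro!: esssup_I AE_I2 ennreal_leI assms simp: space_circle_measure)
qed

text \<open>For \<open>P \<le> 2\<close> this is Jensen's inequality; for \<open>P \<ge> 2\<close> it holds because \<open>u\<^sup>P \<le> u\<^sup>2\<close>. The exponent
\<open>max P 2\<close> is what makes the two regimes of the theorem appear together.\<close>

lemma power_mean_le_square_mean: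
  fixes u :: "complex \<Rightarrow> real"
  assumes cont: "continuous_on (sphere 0 1) u" and u: "\<And>\<zeta>. norm \<zeta> = 1 \<Longrightarrow> 0 \<le> u \<zeta>" "\<And>\<zeta>. norm \<zeta> = 1 \<Longrightarrow> u \<zeta> \<le> 1"
    and P: "1 \<le> P"
  shows "(\<integral>\<zeta>. u \<zeta> powr P \<partial>circle_measure) powr (1 / P)
       \<le> (\<integral>\<zeta>. u \<zeta> ^ 2 \<partial>circle_measure) powr (1 / max P 2)"
proof -
  have contP: "continuous_on (sphere 0 1) (\<lambda>\<zeta>. u \<zeta> powr P)"
    using u P by (intro continuous_on_powr' continuous_intros cont) auto
  have nonneg: "0 \<le> (\<integral>\<zeta>. u \<zeta> powr P \<partial>circle_measure)"
    by (intro integral_nonneg_AE) auto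
  show ?thesis
  proof (cases "P \<le> 2")
    case True
    have "(\<integral>\<zeta>. u \<zeta> powr P \<partial>circle_measure) powr (2 / P)
        \<le> (\<integral>\<zeta>. (u \<zeta> powr P) powr (2 / P) \<partial>circle_measure)"
      by (rule mean_power[OF contP]) (use P True in auto)
    also have "\<dots> = (\<integral>\<zeta>. u \<zeta> ^ 2 \<partial>circle_measure)"
    proof (rule Bochner_Integration.integral_cong, simp)
      fix \<zeta> assume "\<zeta> \<in> space circle_measure"
      then have "0 \<le> u \<zeta>" using u by (simp add: space_circle_measure)
      then show "(u \<zeta> powr P) powr (2 / P) = u \<zeta> ^ 2"
        using P by (cases "u \<zeta> = 0") (auto simp: powr_powr powr_numeral)
    qed
    finally have "((\<integral>\<zeta>. u \<zeta> powr P \<partial>circle_measure) powr (2 / P)) powr (1/2)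
        \<le> (\<integral>\<zeta>. u \<zeta> ^ 2 \<partial>circle_measure) powr (1/2)"
      by (intro powr_mono2) auto
    then show ?thesis using True by (simp add: powr_powr max_def)
  next
    case False
    have "(\<integral>\<zeta>. u \<zeta> powr P \<partial>circle_measure) \<le> (\<integral>\<zeta>. u \<zeta> ^ 2 \<partial>circle_measure)"
    proof (rule integral_mono)
      show "integrable circle_measure (\<lambda>\<zeta>. u \<zeta> powr P)" by (rule integrable_circle[OF contP])
      show "integrable circle_measure (\<lambda>\<zeta>. u \<zeta> ^ 2)" by (intro integrable_circle continuous_intros cont)
      fix \<zeta> assume "\<zeta> \<in> space circle_measure"
      then have "0 \<le> u \<zeta>" "u \<zeta> \<le> 1" using u by (auto simp: space_circle_measure)
      then have "u \<zeta> powr P \<le> u \<zeta> powr 2" using False by (intro powr_mono') auto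
      then show "u \<zeta> powr P \<le> u \<zeta> ^ 2" using \<open>0 \<le> u \<zeta>\<close> by (cases "u \<zeta> = 0") (auto simp: powr_numeral)
    qed
    then show ?thesis using False nonneg by (auto simp: max_def intro!: powr_mono2)
  qed
qed

lemma taylor_coeff_deriv: "taylor_coeff (deriv f) n = of_nat (Suc n) * taylor_coeff f (Suc n)"
proof -
  have "(deriv ^^ n) (deriv f) = (deriv ^^ Suc n) f"
    by (simp only: funpow_Suc_right o_apply)
  then show ?thesis by (simp add: taylor_coeff_def field_simps del: funpow.simps of_nat_Suc)
qed

text \<open>Parseval's identity on circles of radius tending to \<open>1\<close>.\<close>

lemma sum_taylor_coeff_le_1:
  assumes "f holomorphic_on ball 0 1" "\<And>z. norm z < 1 \<Longrightarrow> norm (f z) \<le> 1"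
  shows "(\<Sum>i<n. norm (taylor_coeff f i) ^ 2) \<le> 1"
proof (rule tendsto_upperbound)
  show "((\<lambda>\<rho>. \<Sum>i<n. norm (taylor_coeff f i) ^ 2 * \<rho> ^ (2 * i)) \<longlongrightarrow> (\<Sum>i<n. norm (taylor_coeff f i) ^ 2)) (at_left 1)"
    by (auto intro!: tendsto_eq_intros)
  have "(\<Sum>i<n. norm (taylor_coeff f i) ^ 2 * \<rho> ^ (2 * i)) \<le> 1" if \<rho>: "0 < \<rho>" "\<rho> < 1" for \<rho>
  proof -
    have s: "(\<lambda>n. norm (taylor_coeff f n) ^ 2 * \<rho> ^ (2 * n)) sums
           (\<integral>\<zeta>. norm (f (of_real \<rho> * \<zeta>)) ^ 2 \<partial>circle_measure)"
      by (rule parseval_circle[OF assms(1)]) (use \<rho> in auto)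
    then have "(\<Sum>i<n. norm (taylor_coeff f i) ^ 2 * \<rho> ^ (2 * i))
        \<le> (\<integral>\<zeta>. norm (f (of_real \<rho> * \<zeta>)) ^ 2 \<partial>circle_measure)"
      using sum_le_suminf[of "\<lambda>n. norm (taylor_coeff f n) ^ 2 * \<rho> ^ (2 * n)" "{..<n}"] \<rho>
      by (auto simp: sums_iff)
    also have "\<dots> \<le> (\<integral>\<zeta>. 1 \<partial>circle_measure)"
      by (intro integral_mono integrable_circle continuous_intros continuous_on_circle_dilate assms)
         (use \<rho> in \<open>auto simp: space_circle_measure abs_square_le_1 norm_mult intro!: assms\<close>)
    finally show ?thesis by (simp add: circle.prob_space)
  qed
  then show "\<forall>\<^sub>F \<rho> in at_left 1. (\<Sum>i<n. norm (taylor_coeff f i) ^ 2 * \<rho> ^ (2 * i)) \<le> 1"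
    using eventually_at_left_real[of 0 1] by (auto elim!: eventually_mono)
qed simp

text \<open>By Parseval's identity this is \<open>(1 - \<rho>)\<close> times the mean of \<open>\<bar>f'\<bar>\<^sup>2\<close> over the circle of radius \<open>\<rho>\<close>, see
\<open>energy_density_eq\<close>. The series form makes measurability in \<open>\<rho>\<close> evident and allows termwise
integration.\<close>

definition energy_density :: "(complex \<Rightarrow> complex) \<Rightarrow> real \<Rightarrow> ennreal" where
  "energy_density f \<rho> = (\<Sum>n. ennreal ((1 - \<rho>) * (norm (taylor_coeff (deriv f) n) ^ 2 * \<rho> ^ (2 * n))))"

lemma energy_density_measurable [measurable]: "energy_density f \<in> borel_measurable borel"
  unfolding energy_density_def[abs_def] by measurable

lemma energy_density_eq:
  assumes "f holomorphic_on ball 0 1" "0 < \<rho>" "\<rho> < 1"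
  shows "energy_density f \<rho> =
           ennreal ((1 - \<rho>) * (\<integral>\<zeta>. norm (deriv f (of_real \<rho> * \<zeta>)) ^ 2 \<partial>circle_measure))"
proof -
  have "deriv f holomorphic_on ball 0 1" by (intro holomorphic_deriv assms) auto
  from parseval_circle[OF this, of \<rho>] assms
  have "(\<lambda>n. (1 - \<rho>) * (norm (taylor_coeff (deriv f) n) ^ 2 * \<rho> ^ (2 * n))) sums
      ((1 - \<rho>) * (\<integral>\<zeta>. norm (deriv f (of_real \<rho> * \<zeta>)) ^ 2 \<partial>circle_measure))"
    by (intro sums_mult) auto
  then show ?thesis
    unfolding energy_density_def using assms by (intro suminf_ennreal_eq) auto
qed

text \<open>The \<open>n\<close>-th term integrates to \<open>(n + 1) / (2 (2 n + 1))\<close> times the squared modulus of the Taylor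
coefficient of index \<open>n + 1\<close>, and these squares sum to at most \<open>1\<close>.\<close>

lemma energy_le:
  assumes "f holomorphic_on ball 0 1" "\<And>z. norm z < 1 \<Longrightarrow> norm (f z) \<le> 1"
  shows "(\<integral>\<^sup>+\<rho>\<in>{0..1}. energy_density f \<rho> \<partial>lborel) \<le> ennreal (1 / 2)"
proof -
  have term_int: "(\<integral>\<^sup>+\<rho>\<in>{0..1}. ennreal ((1 - \<rho>) * (norm (taylor_coeff (deriv f) n) ^ 2 * \<rho> ^ (2 * n))) \<partial>lborel)
      \<le> ennreal (1/2) * ennreal (norm (taylor_coeff f (Suc n)) ^ 2)" for n
  proof -
    let ?A = "norm (taylor_coeff (deriv f) n) ^ 2"
    let ?F = "\<lambda>\<rho>. ?A * (\<rho> ^ Suc (2 * n) / real (Suc (2 * n)) - \<rho> ^ Suc (Suc (2 * n)) / real (Suc (Suc (2 * n))))"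
    have pow: "((\<lambda>\<rho>. \<rho> ^ Suc k / real (Suc k)) has_real_derivative \<rho> ^ k) (at \<rho>)" for k \<rho>
      using DERIV_cdivide[OF DERIV_pow[of "Suc k"], of "real (Suc k)"]
      by (simp del: of_nat_Suc power_Suc)
    have "(\<integral>\<^sup>+\<rho>\<in>{0..1}. ennreal ((1 - \<rho>) * (?A * \<rho> ^ (2 * n))) \<partial>lborel) = ennreal (?F 1 - ?F 0)"
    proof (rule nn_integral_FTC_Icc)
      fix \<rho> :: real assume \<rho>: "\<rho> \<in> {0..1}"
      have "(?F has_real_derivative ?A * (\<rho> ^ (2 * n) - \<rho> ^ Suc (2 * n))) (at \<rho>)"
        by (intro DERIV_cmult DERIV_diff pow)
      then show "(?F has_real_derivative (1 - \<rho>) * (?A * \<rho> ^ (2 * n))) (at \<rho>)"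
        by (simp add: algebra_simps)
      show "0 \<le> (1 - \<rho>) * (?A * \<rho> ^ (2 * n))" using \<rho> by simp
    qed auto
    also have "?F 1 - ?F 0 = ?A / (real (2 * n + 1) * real (2 * n + 2))"
      by (simp add: divide_simps)
    also have "?A / (real (2 * n + 1) * real (2 * n + 2))
        = real (Suc n) ^ 2 * norm (taylor_coeff f (Suc n)) ^ 2 / (real (2 * n + 1) * real (2 * n + 2))"
      by (simp only: taylor_coeff_deriv norm_mult norm_of_nat power_mult_distrib)
    also have "real (Suc n) ^ 2 * norm (taylor_coeff f (Suc n)) ^ 2 / (real (2 * n + 1) * real (2 * n + 2))
        = real (Suc n) ^ 2 / (real (2 * n + 1) * real (2 * n + 2)) * norm (taylor_coeff f (Suc n)) ^ 2"
      by simp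
    also have "ennreal \<dots> \<le> ennreal (1/2 * norm (taylor_coeff f (Suc n)) ^ 2)"
      by (intro ennreal_leI mult_right_mono) (auto simp: divide_simps power2_eq_square algebra_simps)
    finally show ?thesis by (simp only: ennreal_mult'[symmetric])
  qed
  have "(\<integral>\<^sup>+\<rho>\<in>{0..1}. energy_density f \<rho> \<partial>lborel)
      = (\<integral>\<^sup>+\<rho>. (\<Sum>n. ennreal ((1 - \<rho>) * (norm (taylor_coeff (deriv f) n) ^ 2 * \<rho> ^ (2 * n))) * indicator {0..1} \<rho>) \<partial>lborel)"
    unfolding energy_density_def by simp
  also have "\<dots> = (\<Sum>n. \<integral>\<^sup>+\<rho>\<in>{0..1}. ennreal ((1 - \<rho>) * (norm (taylor_coeff (deriv f) n) ^ 2 * \<rho> ^ (2 * n))) \<partial>lborel)"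
    by (rule nn_integral_suminf) measurable
  also have "\<dots> \<le> (\<Sum>n. ennreal (1/2) * ennreal (norm (taylor_coeff f (Suc n)) ^ 2))"
    by (intro suminf_le term_int) auto
  also have "\<dots> = ennreal (1/2) * (\<Sum>n. ennreal (norm (taylor_coeff f (Suc n)) ^ 2))"
    by (rule ennreal_suminf_cmult)
  also have "\<dots> \<le> ennreal (1/2) * 1"
  proof (rule mult_left_mono)
    show "(\<Sum>n. ennreal (norm (taylor_coeff f (Suc n)) ^ 2)) \<le> 1"
    proof (rule suminf_le_const)
      fix n
      have "(\<Sum>i<n. ennreal (norm (taylor_coeff f (Suc i)) ^ 2)) = ennreal (\<Sum>i<n. norm (taylor_coeff f (Suc i)) ^ 2)"
        by (rule sum_ennreal) auto
      also have "(\<Sum>i<n. norm (taylor_coeff f (Suc i)) ^ 2) \<le> (\<Sum>i<Suc n. norm (taylor_coeff f i) ^ 2)"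
        by (simp only: sum.lessThan_Suc_shift) simp
      also have "\<dots> \<le> 1" by (rule sum_taylor_coeff_le_1[OF assms])
      finally show "(\<Sum>i<n. ennreal (norm (taylor_coeff f (Suc i)) ^ 2)) \<le> 1"
        by (simp add: ennreal_leI)
    qed auto
  qed auto
  finally show ?thesis by simp
qed

section \<open>Upper bounds for the Besov norm\<close>

abbreviation circle_norm :: "ennreal \<Rightarrow> (complex \<Rightarrow> complex) \<Rightarrow> real \<Rightarrow> ennreal" where
  "circle_norm p f \<rho> \<equiv> Lp_norm p circle_measure (\<lambda>\<zeta>. f (of_real \<rho> * \<zeta>))"

abbreviation besov_integrand :: "ennreal \<Rightarrow> real \<Rightarrow> (complex \<Rightarrow> complex) \<Rightarrow> real \<Rightarrow> ennreal" where
  "besov_integrand p Q f \<rho> \<equiv> ennreal ((1 - \<rho>) powr (Q - 1)) * ennreal_powr (circle_norm p (deriv f) \<rho>) Q"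

abbreviation scaled_square_mean :: "complex list \<Rightarrow> real \<Rightarrow> real" where
  "scaled_square_mean \<sigma> \<rho> \<equiv>
     (1 - \<rho>) ^ 2 * (\<integral>\<zeta>. norm (deriv (blaschke \<sigma>) (of_real \<rho> * \<zeta>)) ^ 2 \<partial>circle_measure)"

lemma disc_tuplesD:
  assumes "\<sigma> \<in> disc_tuples N"
  shows "length \<sigma> = N" "set \<sigma> \<subseteq> ball 0 1"
  using assms by (auto simp: disc_tuples_def)

lemma besov_seminorm_finite:
  assumes "q = ennreal Q" "enn2real q = Q" "recip q = 1 / Q"
  shows "besov_seminorm p q f = ennreal_powr
      (\<integral>\<^sup>+\<rho>\<in>{0<..<1}. besov_integrand p Q f \<rho> \<partial>lborel) (1 / Q)"
  using assms by (simp add: besov_seminorm_def Let_def)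

text \<open>The function \<open>u = (1 - \<rho>) \<bar>B'\<bar>\<close> takes values in \<open>[0, 1]\<close>, so all its means are controlled by its square mean
\<open>U\<close>, and \<open>U\<close> itself by the mean of \<open>u\<close>.\<close>

lemma scaled_mean_bounds:
  assumes \<sigma>: "\<sigma> \<in> disc_tuples N" and \<rho>: "0 < \<rho>" "\<rho> < 1" and P: "1 \<le> P"
  defines "U \<equiv> scaled_square_mean \<sigma> \<rho>"
  defines "m \<equiv> (\<integral>\<zeta>. norm (deriv (blaschke \<sigma>) (of_real \<rho> * \<zeta>)) powr P \<partial>circle_measure) powr (1 / P)"
  shows "(1 - \<rho>) * m \<le> U powr (1 / max P 2)" "0 \<le> U" "U \<le> 1" "U \<le> (1 - \<rho>) * N"
proof -
  note len = disc_tuplesD(1)[OF \<sigma>] and s = disc_tuplesD(2)[OF \<sigma>]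
  define v where "v \<zeta> = norm (deriv (blaschke \<sigma>) (of_real \<rho> * \<zeta>))" for \<zeta>
  define u where "u \<zeta> = (1 - \<rho>) * v \<zeta>" for \<zeta>
  have contv: "continuous_on (sphere 0 1) v"
    unfolding v_def by (intro continuous_intros continuous_on_circle_dilate holomorphic_on_deriv_blaschke s) (use \<rho> in auto)
  have contu: "continuous_on (sphere 0 1) u"
    unfolding u_def by (intro continuous_intros contv)
  have u: "0 \<le> u \<zeta>" "u \<zeta> \<le> 1" if "norm \<zeta> = 1" for \<zeta>
  proof -
    show "0 \<le> u \<zeta>" using \<rho> by (simp add: u_def v_def)
    have "(1 - norm (of_real \<rho> * \<zeta>)) * norm (deriv (blaschke \<sigma>) (of_real \<rho> * \<zeta>)) \<le> 1"
      by (rule norm_deriv_le_of_bounded[OF holomorphic_on_blaschke[OF s]])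
         (use that \<rho> in \<open>auto simp: norm_mult intro!: norm_blaschke_le_1 s\<close>)
    then show "u \<zeta> \<le> 1" using that \<rho> by (simp add: u_def v_def norm_mult)
  qed
  have U: "U = (\<integral>\<zeta>. u \<zeta> ^ 2 \<partial>circle_measure)"
    by (simp add: U_def u_def v_def power_mult_distrib)
  have "(\<integral>\<zeta>. u \<zeta> powr P \<partial>circle_measure) = (1 - \<rho>) powr P * (\<integral>\<zeta>. v \<zeta> powr P \<partial>circle_measure)"
    using \<rho> by (simp add: u_def v_def powr_mult)
  then have "(\<integral>\<zeta>. u \<zeta> powr P \<partial>circle_measure) powr (1 / P) = (1 - \<rho>) * m"
    using \<rho> P by (simp add: m_def v_def powr_mult powr_powr integral_nonneg_AE)
  then show "(1 - \<rho>) * m \<le> U powr (1 / max P 2)"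
    using power_mean_le_square_mean[OF contu u P] by (simp add: U)
  show "0 \<le> U" by (simp add: U integral_nonneg_AE)
  have int: "integrable circle_measure (\<lambda>\<zeta>. u \<zeta> ^ 2)" "integrable circle_measure u" "integrable circle_measure v"
    by (intro integrable_circle continuous_intros contu contv)+
  have Uu: "U \<le> (\<integral>\<zeta>. u \<zeta> \<partial>circle_measure)"
    unfolding U
    by (rule integral_mono) (use int u in \<open>auto simp: space_circle_measure power2_eq_square mult_left_le\<close>)
  also have "\<dots> \<le> (\<integral>\<zeta>. 1 \<partial>circle_measure)"
    by (rule integral_mono) (use int u in \<open>auto simp: space_circle_measure\<close>)
  finally show "U \<le> 1" by (simp add: circle.prob_space)
  note Uu
  also have "(\<integral>\<zeta>. u \<zeta> \<partial>circle_measure) = (1 - \<rho>) * (\<integral>\<zeta>. v \<zeta> \<partial>circle_measure)"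
    by (simp add: u_def)
  also have "\<dots> \<le> (1 - \<rho>) * N"
    using integral_deriv_blaschke_le[OF s, of \<rho>] \<rho> len
    by (intro mult_left_mono) (auto simp: v_def)
  finally show "U \<le> (1 - \<rho>) * N" .
qed

lemma weighted_Lp_norm_le:
  assumes \<sigma>: "\<sigma> \<in> disc_tuples N" and \<rho>: "0 < \<rho>" "\<rho> < 1"
    and p: "1 \<le> P" "p = ennreal P" "recip p = 1 / P" and Q: "1 \<le> Q"
  defines "U \<equiv> scaled_square_mean \<sigma> \<rho>"
  shows "besov_integrand p Q (blaschke \<sigma>) \<rho>
        \<le> ennreal (U powr (Q / max P 2) / (1 - \<rho>))"
proof -
  define m where "m = (\<integral>\<zeta>. norm (deriv (blaschke \<sigma>) (of_real \<rho> * \<zeta>)) powr P \<partial>circle_measure) powr (1 / P)"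
  have m: "circle_norm p (deriv (blaschke \<sigma>)) \<rho> = ennreal m"
    unfolding m_def
    by (rule Lp_norm_circle[OF _ p(2,1,3)])
       (intro continuous_on_circle_dilate holomorphic_on_deriv_blaschke disc_tuplesD(2)[OF \<sigma>], use \<rho> in auto)
  have m0: "0 \<le> m" by (simp add: m_def)
  note U = scaled_mean_bounds[OF \<sigma> \<rho> p(1), folded U_def m_def]
  have "(1 - \<rho>) powr (Q - 1) * m powr Q = ((1 - \<rho>) * m) powr Q / (1 - \<rho>)"
    using \<rho> m0 by (simp add: powr_mult powr_diff)
  also have "\<dots> \<le> (U powr (1 / max P 2)) powr Q / (1 - \<rho>)"
    using U(1) \<rho> m0 Q by (intro divide_right_mono powr_mono2) auto
  finally show ?thesis
    using \<rho> m0 by (simp add: m ennreal_powr_ennreal ennreal_mult'[symmetric] powr_powr)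
qed

text \<open>Young's inequality for \<open>U\<close> and \<open>1/L\<close>. It replaces Hoelder's inequality below: with \<open>L\<close> the total mass of the far zone,
the affine bound integrates to a constant.\<close>

lemma powr_le_affine:
  fixes U \<theta> L :: real
  assumes "0 \<le> U" "0 < \<theta>" "\<theta> \<le> 1" "0 < L"
  shows "U powr \<theta> \<le> L powr (1 - \<theta>) * (U + 1 / L)"
proof (cases "U = 0")
  case False
  then have "U powr \<theta> * (1 / L) powr (1 - \<theta>) \<le> \<theta> * U + (1 - \<theta>) * (1 / L)"
    using assms by (intro Youngs_inequality_0) auto
  also have "\<dots> \<le> 1 * U + 1 * (1 / L)"
    using assms by (intro add_mono mult_right_mono) auto
  finally have "L powr (1 - \<theta>) * (U powr \<theta> * (1 / L) powr (1 - \<theta>)) \<le> L powr (1 - \<theta>) * (U + 1 / L)"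
    by (intro mult_left_mono) auto
  then show ?thesis using assms by (simp add: powr_divide)
qed (use assms in auto)

lemma besov_norm_le:
  assumes \<sigma>: "\<sigma> \<in> disc_tuples N" and "q = ennreal Q" "enn2real q = Q" "recip q = 1 / Q" "1 \<le> Q" "0 \<le> X"
    and int: "(\<integral>\<^sup>+\<rho>\<in>{0<..<1}. besov_integrand p Q (blaschke \<sigma>) \<rho> \<partial>lborel) \<le> ennreal X"
  shows "besov_norm p q (blaschke \<sigma>) \<le> ennreal (1 + X powr (1 / Q))"
proof -
  have "besov_seminorm p q (blaschke \<sigma>) \<le> ennreal_powr (ennreal X) (1 / Q)"
    unfolding besov_seminorm_finite[OF assms(2-4)] using assms by (intro ennreal_powr_mono int) auto
  moreover have "ennreal (norm (blaschke \<sigma> 0)) \<le> 1"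
    using norm_blaschke_le_1[OF disc_tuplesD(2)[OF \<sigma>], of 0] by (simp add: ennreal_le_1)
  ultimately show ?thesis
    using assms by (simp add: besov_norm_def ennreal_powr_ennreal add_mono flip: ennreal_1)
qed

lemma scaled_square_mean_eq_energy:
  assumes "\<sigma> \<in> disc_tuples N" "0 < \<rho>" "\<rho> < (1::real)"
  shows "ennreal (scaled_square_mean \<sigma> \<rho> / (1 - \<rho>))
      = energy_density (blaschke \<sigma>) \<rho>"
  using assms
  by (subst energy_density_eq) (auto intro!: holomorphic_on_blaschke disc_tuplesD simp: power2_eq_square)

lemma energy_blaschke_le:
  assumes "\<sigma> \<in> disc_tuples N"
  shows "(\<integral>\<^sup>+\<rho>\<in>{0<..<1}. energy_density (blaschke \<sigma>) \<rho> \<partial>lborel) \<le> ennreal (1 / 2)"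
proof -
  have "(\<integral>\<^sup>+\<rho>\<in>{0<..<1}. energy_density (blaschke \<sigma>) \<rho> \<partial>lborel)
      \<le> (\<integral>\<^sup>+\<rho>\<in>{0..1}. energy_density (blaschke \<sigma>) \<rho> \<partial>lborel)"
    by (intro nn_integral_mono) (auto split: split_indicator)
  also have "\<dots> \<le> ennreal (1 / 2)"
    by (intro energy_le holomorphic_on_blaschke norm_blaschke_le_1 disc_tuplesD(2)[OF assms]) auto
  finally show ?thesis .
qed

text \<open>Since \<open>Q \<ge> max P 2\<close> and \<open>U \<le> 1\<close>, the integrand is at most \<open>U / (1 - \<rho>)\<close>, the energy density.\<close>

lemma besov_norm_le_const:
  assumes \<sigma>: "\<sigma> \<in> disc_tuples N"
    and p: "1 \<le> P" "p = ennreal P" "recip p = 1 / P"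
    and q: "1 \<le> Q" "q = ennreal Q" "enn2real q = Q" "recip q = 1 / Q" and le: "P \<le> Q" "2 \<le> Q"
  shows "besov_norm p q (blaschke \<sigma>) \<le> ennreal 2"
proof -
  have "(\<integral>\<^sup>+\<rho>\<in>{0<..<1}. besov_integrand p Q (blaschke \<sigma>) \<rho> \<partial>lborel)
     \<le> (\<integral>\<^sup>+\<rho>\<in>{0<..<1}. energy_density (blaschke \<sigma>) \<rho> \<partial>lborel)"
  proof (intro nn_integral_mono)
    fix \<rho> :: real
    show "besov_integrand p Q (blaschke \<sigma>) \<rho> * indicator {0<..<1} \<rho>
        \<le> energy_density (blaschke \<sigma>) \<rho> * indicator {0<..<1} \<rho>"
    proof (cases "\<rho> \<in> {0<..<1}")
      case True
      then have \<rho>: "0 < \<rho>" "\<rho> < 1" by auto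
      let ?U = "scaled_square_mean \<sigma> \<rho>"
      note U = scaled_mean_bounds[OF \<sigma> \<rho> p(1)]
      have "?U powr (Q / max P 2) \<le> ?U powr 1"
        by (rule powr_mono') (use U(2,3) le p in auto)
      then have "ennreal (?U powr (Q / max P 2) / (1 - \<rho>)) \<le> ennreal (?U / (1 - \<rho>))"
        using U(2) \<rho> by (intro ennreal_leI divide_right_mono) auto
      then show ?thesis
        using weighted_Lp_norm_le[OF \<sigma> \<rho> p q(1)] True scaled_square_mean_eq_energy[OF \<sigma> \<rho>] by auto
    qed simp
  qed
  also have "\<dots> \<le> ennreal (1 / 2)" by (rule energy_blaschke_le[OF \<sigma>])
  finally have "besov_norm p q (blaschke \<sigma>) \<le> ennreal (1 + (1/2) powr (1 / Q))"
    by (intro besov_norm_le[OF \<sigma> q(2,3,4,1)]) auto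
  also have "\<dots> \<le> ennreal 2"
    using powr_mono2[of "1/Q" "1/2" 1] q by (intro ennreal_leI) auto
  finally show ?thesis .
qed

lemma nn_integral_powr_reflected:
  fixes a c :: real
  assumes "-1 < a" "0 \<le> c"
  shows "(\<integral>\<^sup>+\<rho>\<in>{1 - c..1}. ennreal ((1 - \<rho>) powr a) \<partial>lborel) = ennreal (c powr (a + 1) / (a + 1))"
proof -
  let ?f = "\<lambda>y. if y \<in> {0..c} then y powr a else 0"
  have "(?f has_integral c powr (a + 1) / (a + 1)) UNIV"
    unfolding has_integral_restrict_UNIV by (rule has_integral_powr_from_0[OF assms])
  then have "ennreal (c powr (a + 1) / (a + 1)) = (\<integral>\<^sup>+y. ennreal (?f y) \<partial>lborel)"
    by (intro nn_integral_has_integral_lborel[symmetric]) auto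
  also have "(\<integral>\<^sup>+y. ennreal (?f y) \<partial>lborel) = (\<integral>\<^sup>+y. ennreal (?f (1 + (-1) * y)) \<partial>lborel)"
    by (subst nn_integral_real_affine[where c = "-1" and t = 1]) auto
  also have "\<dots> = (\<integral>\<^sup>+\<rho>\<in>{1 - c..1}. ennreal ((1 - \<rho>) powr a) \<partial>lborel)"
    by (intro nn_integral_cong) (auto split: split_indicator)
  finally show ?thesis ..
qed

text \<open>The far zone \<open>\<rho> \<le> 1 - c\<close> has logarithmic mass; for \<open>c = 1/N\<close> this is the source of \<open>log N\<close>.\<close>

lemma nn_integral_inverse_distance:
  fixes c :: real
  assumes "0 < c" "c \<le> 1"
  shows "(\<integral>\<^sup>+\<rho>\<in>{0..1 - c}. ennreal (1 / (1 - \<rho>)) \<partial>lborel) = ennreal (ln (1 / c))"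
proof -
  have "(\<integral>\<^sup>+\<rho>\<in>{0..1 - c}. ennreal (1 / (1 - \<rho>)) \<partial>lborel) = ennreal (- ln (1 - (1 - c)) - - ln (1 - 0))"
  proof (rule nn_integral_FTC_Icc)
    fix x assume "x \<in> {0..1 - c}"
    then have "0 < 1 - x" using assms by auto
    then show "((\<lambda>x. - ln (1 - x)) has_real_derivative 1 / (1 - x)) (at x)" "0 \<le> 1 / (1 - x)"
      by (auto intro!: derivative_eq_intros simp: field_simps)
  qed (use assms in auto)
  then show ?thesis using assms by (simp add: ln_div)
qed

text \<open>The split at \<open>\<rho> = 1 - 1/N\<close> balances the two bounds for \<open>U\<close>: near the circle \<open>U \<le> (1 - \<rho>) N\<close> makes
\<open>U\<^bsup>\<theta>\<^esup> / (1 - \<rho>)\<close> integrable with a bound independent of \<open>N\<close>, and on the rest \<open>powr_le_affine\<close>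
with \<open>L = log N\<close> reduces to the energy.\<close>

lemma besov_norm_le_log:
  assumes \<sigma>: "\<sigma> \<in> disc_tuples N" and N: "2 \<le> N"
    and p: "1 \<le> P" "p = ennreal P" "recip p = 1 / P"
    and q: "1 \<le> Q" "q = ennreal Q" "enn2real q = Q" "recip q = 1 / Q" and le: "Q \<le> max P 2"
  defines "r \<equiv> max P 2"
  shows "besov_norm p q (blaschke \<sigma>)
      \<le> ennreal ((2 + (3/2 + 2 * r / Q) powr (1 / Q)) * ln N powr (1 / Q - 1 / r))"
proof -
  define \<theta> where "\<theta> = Q / r"
  define L where "L = ln (real N)"
  have r: "r \<ge> 2" "r > 0" by (auto simp: r_def)
  have \<theta>: "0 < \<theta>" "\<theta> \<le> 1" using le q r by (auto simp: \<theta>_def r_def)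
  have L2: "ln 2 \<le> L" using N by (simp add: L_def)
  have L0: "0 < L" using L2 ln_gt_zero[of 2] by linarith
  \<comment> \<open>As \<open>L \<ge> ln 2\<close>, additive constants such as \<open>\<bar>B(0)\<bar> \<le> 1\<close> can be absorbed into powers of \<open>L\<close>.\<close>
  have half: "1 \<le> 2 * L powr e" if "0 \<le> e" "e \<le> 1" for e
  proof -
    have ln2: "1/2 \<le> ln (2::real)" using ln2_ge_two_thirds by simp
    have "(1/2) powr 1 \<le> (1/2) powr e" using that by (intro powr_mono') auto
    also have "\<dots> \<le> L powr e" using ln2 L2 that by (intro powr_mono2) auto
    finally show ?thesis by simp
  qed
  let ?near = "\<lambda>\<rho>. ennreal (N powr \<theta>) * (ennreal ((1 - \<rho>) powr (\<theta> - 1)) * indicator {1 - 1 / N..1} \<rho>)"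
  let ?far = "\<lambda>\<rho>. ennreal (L powr (1 - \<theta>) / L) * (ennreal (1 / (1 - \<rho>)) * indicator {0..1 - 1 / N} \<rho>)"
  let ?en = "\<lambda>\<rho>. ennreal (L powr (1 - \<theta>)) * (energy_density (blaschke \<sigma>) \<rho> * indicator {0<..<1} \<rho>)"
  have "(\<integral>\<^sup>+\<rho>\<in>{0<..<1}. besov_integrand p Q (blaschke \<sigma>) \<rho> \<partial>lborel)
     \<le> (\<integral>\<^sup>+\<rho>. ?near \<rho> + (?far \<rho> + ?en \<rho>) \<partial>lborel)"
  proof (intro nn_integral_mono)
    fix \<rho> :: real
    show "besov_integrand p Q (blaschke \<sigma>) \<rho> * indicator {0<..<1} \<rho>
        \<le> ?near \<rho> + (?far \<rho> + ?en \<rho>)"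
    proof (cases "\<rho> \<in> {0<..<1}")
      case True
      then have \<rho>: "0 < \<rho>" "\<rho> < 1" by auto
      define U where "U = scaled_square_mean \<sigma> \<rho>"
      note U = scaled_mean_bounds[OF \<sigma> \<rho> p(1), folded U_def]
      have "ennreal (U powr \<theta> / (1 - \<rho>)) \<le> ?near \<rho> + (?far \<rho> + ?en \<rho>)"
      proof (cases "\<rho> \<le> 1 - 1 / N")
        case far: True
        have "U powr \<theta> / (1 - \<rho>) \<le> L powr (1 - \<theta>) * (U + 1 / L) / (1 - \<rho>)"
          using powr_le_affine[OF U(2) \<theta> L0] \<rho> by (intro divide_right_mono) auto
        also have "\<dots> = L powr (1 - \<theta>) / L * (1 / (1 - \<rho>)) + L powr (1 - \<theta>) * (U / (1 - \<rho>))"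
          by (simp add: distrib_left add_divide_distrib)
        also have "ennreal \<dots> = ennreal (L powr (1 - \<theta>) / L) * ennreal (1 / (1 - \<rho>)) + ennreal (L powr (1 - \<theta>)) * ennreal (U / (1 - \<rho>))"
          using \<rho> L0 U(2) by (simp add: ennreal_mult'[symmetric] flip: ennreal_plus)
        also have "\<dots> = ?far \<rho> + ?en \<rho>"
          using far \<rho> scaled_square_mean_eq_energy[OF \<sigma> \<rho>] by (simp add: U_def)
        finally have "ennreal (U powr \<theta> / (1 - \<rho>)) \<le> ?far \<rho> + ?en \<rho>"
          using ennreal_leI by blast
        then show ?thesis by (rule order_trans) (simp add: add_increasing)
      next
        case False
        have "U powr \<theta> / (1 - \<rho>) \<le> ((1 - \<rho>) * N) powr \<theta> / (1 - \<rho>)"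
          using U \<rho> \<theta> by (intro divide_right_mono powr_mono2) auto
        also have "\<dots> = N powr \<theta> * (1 - \<rho>) powr (\<theta> - 1)"
          using \<rho> by (simp add: powr_mult powr_diff)
        also have "ennreal \<dots> = ?near \<rho>"
          using False \<rho> by (simp add: ennreal_mult')
        finally have "ennreal (U powr \<theta> / (1 - \<rho>)) \<le> ?near \<rho>"
          using ennreal_leI by blast
        then show ?thesis by (rule order_trans) (simp add: add_increasing2)
      qed
      then show ?thesis
        using weighted_Lp_norm_le[OF \<sigma> \<rho> p q(1)] True by (auto simp: \<theta>_def r_def U_def)
    qed simp
  qed
  also have "\<dots> = ennreal (N powr \<theta>) * (\<integral>\<^sup>+\<rho>\<in>{1 - 1 / N..1}. ennreal ((1 - \<rho>) powr (\<theta> - 1)) \<partial>lborel)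
     + (ennreal (L powr (1 - \<theta>) / L) * (\<integral>\<^sup>+\<rho>\<in>{0..1 - 1 / N}. ennreal (1 / (1 - \<rho>)) \<partial>lborel)
        + ennreal (L powr (1 - \<theta>)) * (\<integral>\<^sup>+\<rho>\<in>{0<..<1}. energy_density (blaschke \<sigma>) \<rho> \<partial>lborel))"
    by (simp add: nn_integral_add nn_integral_cmult)
  also have "\<dots> \<le> ennreal (N powr \<theta>) * ennreal ((1 / N) powr \<theta> / \<theta>)
     + (ennreal (L powr (1 - \<theta>) / L) * ennreal L + ennreal (L powr (1 - \<theta>)) * ennreal (1/2))"
    using nn_integral_powr_reflected[of "\<theta> - 1" "1 / N"] nn_integral_inverse_distance[of "1 / N"]
      energy_blaschke_le[OF \<sigma>] \<theta> N
    by (intro add_mono mult_left_mono) (auto simp: L_def)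
  also have "\<dots> = ennreal (1 / \<theta> + (L powr (1 - \<theta>) + L powr (1 - \<theta>) / 2))"
  proof -
    have "ennreal (N powr \<theta>) * ennreal ((1 / N) powr \<theta> / \<theta>) = ennreal (1 / \<theta>)"
      using \<theta> N by (subst ennreal_mult'[symmetric]) (auto simp: powr_divide)
    moreover have "ennreal (L powr (1 - \<theta>) / L) * ennreal L = ennreal (L powr (1 - \<theta>))"
      using L0 by (subst ennreal_mult'[symmetric]) auto
    moreover have "ennreal (L powr (1 - \<theta>)) * ennreal (1/2) = ennreal (L powr (1 - \<theta>) / 2)"
      by (subst ennreal_mult'[symmetric]) auto
    moreover have "ennreal (1 / \<theta> + (L powr (1 - \<theta>) + L powr (1 - \<theta>) / 2))
        = ennreal (1 / \<theta>) + ennreal (L powr (1 - \<theta>) + L powr (1 - \<theta>) / 2)"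
      using \<theta> by (intro ennreal_plus) auto
    moreover have "ennreal (L powr (1 - \<theta>) + L powr (1 - \<theta>) / 2) = ennreal (L powr (1 - \<theta>)) + ennreal (L powr (1 - \<theta>) / 2)"
      by (intro ennreal_plus) auto
    ultimately show ?thesis by (simp only:)
  qed
  also have "\<dots> \<le> ennreal ((3/2 + 2 / \<theta>) * L powr (1 - \<theta>))"
  proof (rule ennreal_leI)
    have "1 / \<theta> * 1 \<le> 1 / \<theta> * (2 * L powr (1 - \<theta>))"
      using half[of "1 - \<theta>"] \<theta> by (intro mult_left_mono) auto
    then show "1 / \<theta> + (L powr (1 - \<theta>) + L powr (1 - \<theta>) / 2) \<le> (3/2 + 2 / \<theta>) * L powr (1 - \<theta>)"
      by (simp add: algebra_simps)
  qed
  finally have "besov_norm p q (blaschke \<sigma>) \<le> ennreal (1 + ((3/2 + 2 / \<theta>) * L powr (1 - \<theta>)) powr (1 / Q))"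
    using \<theta> by (intro besov_norm_le[OF \<sigma> q(2,3,4,1)]) auto
  also have "((3/2 + 2 / \<theta>) * L powr (1 - \<theta>)) powr (1 / Q) = (3/2 + 2 / \<theta>) powr (1 / Q) * L powr (1 / Q - 1 / r)"
    using \<theta> q r by (simp add: powr_mult powr_powr \<theta>_def diff_divide_distrib)
  also have "ennreal (1 + (3/2 + 2 / \<theta>) powr (1 / Q) * L powr (1 / Q - 1 / r))
      \<le> ennreal ((2 + (3/2 + 2 / \<theta>) powr (1 / Q)) * L powr (1 / Q - 1 / r))"
  proof (rule ennreal_leI)
    have "1 / r \<le> 1 / Q" using le q by (simp add: r_def frac_le)
    moreover have "1 / Q \<le> 1" using q by simp
    moreover have "0 \<le> 1 / r" using r by simp
    ultimately have "1 \<le> 2 * L powr (1 / Q - 1 / r)" by (intro half) linarith+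
    then show "1 + (3/2 + 2 / \<theta>) powr (1 / Q) * L powr (1 / Q - 1 / r)
      \<le> (2 + (3/2 + 2 / \<theta>) powr (1 / Q)) * L powr (1 / Q - 1 / r)"
      by (simp add: algebra_simps)
  qed
  finally show ?thesis by (simp add: \<theta>_def L_def)
qed

lemma besov_norm_le_infinite_q:
  assumes \<sigma>: "\<sigma> \<in> disc_tuples N" and p: "1 \<le> p"
  shows "besov_norm p \<infinity> (blaschke \<sigma>) \<le> ennreal 2"
proof -
  note s = disc_tuplesD(2)[OF \<sigma>]
  have "ennreal (1 - \<rho>) * circle_norm p (deriv (blaschke \<sigma>)) \<rho> \<le> 1"
    if \<rho>: "0 < \<rho>" "\<rho> < 1" for \<rho>
    using p
  proof (cases rule: ennreal_exponent_cases)
    case (fin P)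
    let ?U = "scaled_square_mean \<sigma> \<rho>"
    note U = scaled_mean_bounds[OF \<sigma> \<rho> fin(1)]
    have "?U powr (1 / max P 2) \<le> 1 powr (1 / max P 2)"
      using U(2,3) by (intro powr_mono2) auto
    then have "(1 - \<rho>) * (\<integral>\<zeta>. norm (deriv (blaschke \<sigma>) (of_real \<rho> * \<zeta>)) powr P \<partial>circle_measure) powr (1 / P) \<le> 1"
      using U(1) by simp
    moreover have "circle_norm p (deriv (blaschke \<sigma>)) \<rho>
        = ennreal ((\<integral>\<zeta>. norm (deriv (blaschke \<sigma>) (of_real \<rho> * \<zeta>)) powr P \<partial>circle_measure) powr (1 / P))"
      by (rule Lp_norm_circle[OF _ fin(2,1,4)])
         (intro continuous_on_circle_dilate holomorphic_on_deriv_blaschke s, use \<rho> in auto)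
    ultimately show ?thesis
      using \<rho> by (simp add: ennreal_mult'[symmetric] ennreal_le_1)
  next
    case inf
    have "circle_norm \<infinity> (deriv (blaschke \<sigma>)) \<rho> \<le> ennreal (1 / (1 - \<rho>))"
    proof (rule esssup_circle_le)
      show "continuous_on (sphere 0 1) (\<lambda>\<zeta>. deriv (blaschke \<sigma>) (of_real \<rho> * \<zeta>))"
        by (intro continuous_on_circle_dilate holomorphic_on_deriv_blaschke s) (use \<rho> in auto)
      fix \<zeta> :: complex assume "norm \<zeta> = 1"
      then have "(1 - \<rho>) * norm (deriv (blaschke \<sigma>) (of_real \<rho> * \<zeta>)) \<le> 1"
        using norm_deriv_le_of_bounded[OF holomorphic_on_blaschke[OF s] norm_blaschke_le_1[OF s], of "of_real \<rho> * \<zeta>"] \<rho>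
        by (simp add: norm_mult)
      then show "norm (deriv (blaschke \<sigma>) (of_real \<rho> * \<zeta>)) \<le> 1 / (1 - \<rho>)"
        using \<rho> by (simp add: field_simps)
    qed
    then have "ennreal (1 - \<rho>) * circle_norm p (deriv (blaschke \<sigma>)) \<rho>
        \<le> ennreal (1 - \<rho>) * ennreal (1 / (1 - \<rho>))"
      unfolding inf by (intro mult_left_mono) auto
    also have "\<dots> = 1" using \<rho> by (simp add: ennreal_mult'[symmetric])
    finally show ?thesis .
  qed
  then have "besov_seminorm p \<infinity> (blaschke \<sigma>) \<le> 1"
    by (auto simp: besov_seminorm_def Let_def intro!: SUP_least)
  moreover have "ennreal (norm (blaschke \<sigma> 0)) \<le> 1"
    using norm_blaschke_le_1[OF s, of 0] by (simp add: ennreal_le_1)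
  ultimately have "besov_norm p \<infinity> (blaschke \<sigma>) \<le> 1 + 1"
    unfolding besov_norm_def by (rule add_mono[rotated])
  then show ?thesis by simp
qed

text \<open>Because \<open>(1 - \<rho>) M \<le> 1\<close> for the maximum \<open>M\<close> of \<open>\<bar>B'\<bar>\<close>, one has \<open>(1 - \<rho>)\<^bsup>Q - 1\<^esup> M\<^sup>Q \<le> M\<close>. The sum
\<open>S\<close> over the zeros bounds \<open>M\<close>, and a zero of modulus \<open>t\<close> contributes \<open>1 + t\<close> to its integral.\<close>

lemma besov_norm_le_infinite_p:
  assumes \<sigma>: "\<sigma> \<in> disc_tuples N" and N: "2 \<le> N"
    and q: "1 \<le> Q" "q = ennreal Q" "enn2real q = Q" "recip q = 1 / Q"
  shows "besov_norm \<infinity> q (blaschke \<sigma>) \<le> ennreal (3 * N powr (1 / Q))"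
proof -
  note len = disc_tuplesD(1)[OF \<sigma>] and s = disc_tuplesD(2)[OF \<sigma>]
  define S where "S \<tau> \<rho> = (\<Sum>a\<leftarrow>\<tau>. (1 - norm a ^ 2) / (1 - norm a * \<rho>) ^ 2)" for \<tau> :: "complex list" and \<rho> :: real
  have Smeas [measurable]: "S \<tau> \<in> borel_measurable borel" for \<tau>
    by (induction \<tau>) (auto simp: S_def[abs_def])
  have S0: "0 \<le> S \<tau> \<rho>" if "set \<tau> \<subseteq> ball 0 1" for \<tau> \<rho>
    unfolding S_def using that by (intro sum_list_nonneg) (auto simp: abs_square_le_1 less_imp_le)
  have Sint: "(\<integral>\<^sup>+\<rho>\<in>{0..1}. ennreal (S \<tau> \<rho>) \<partial>lborel) \<le> ennreal (2 * length \<tau>)" if "set \<tau> \<subseteq> ball 0 1" for \<tau>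
    using that
  proof (induction \<tau>)
    case Nil
    then show ?case by (simp add: S_def)
  next
    case (Cons a \<tau>)
    define t where "t = norm a"
    have t: "0 \<le> t" "t < 1" using Cons.prems by (auto simp: t_def)
    have pos: "0 < 1 - t * x" if "x \<in> {0..1}" for x
      using mult_left_le[of x t] that t by auto
    have "(\<integral>\<^sup>+\<rho>\<in>{0..1}. ennreal (S (a # \<tau>) \<rho>) \<partial>lborel)
        = (\<integral>\<^sup>+\<rho>. ennreal ((1 - t ^ 2) / (1 - t * \<rho>) ^ 2) * indicator {0..1} \<rho> + ennreal (S \<tau> \<rho>) * indicator {0..1} \<rho> \<partial>lborel)"
      using Cons.prems S0[of \<tau>] t
      by (intro nn_integral_cong) (auto simp: S_def t_def abs_square_le_1 ennreal_plus split: split_indicator)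
    also have "\<dots> = (\<integral>\<^sup>+\<rho>\<in>{0..1}. ennreal ((1 - t ^ 2) / (1 - t * \<rho>) ^ 2) \<partial>lborel) + (\<integral>\<^sup>+\<rho>\<in>{0..1}. ennreal (S \<tau> \<rho>) \<partial>lborel)"
      by (rule nn_integral_add) (auto intro: Smeas)
    also have "(\<integral>\<^sup>+\<rho>\<in>{0..1}. ennreal ((1 - t ^ 2) / (1 - t * \<rho>) ^ 2) \<partial>lborel)
        = ennreal ((1 - t ^ 2) * (1 / (1 - t * 1)) - (1 - t ^ 2) * (0 / (1 - t * 0)))"
    proof (rule nn_integral_FTC_Icc)
      fix x :: real assume x: "x \<in> {0..1}"
      note pos[OF x]
      then have "((\<lambda>x. (1 - t ^ 2) * (x / (1 - t * x))) has_real_derivative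
          (1 - t ^ 2) * ((1 * (1 - t * x) - x * (0 - t * 1)) / ((1 - t * x) * (1 - t * x)))) (at x)"
        by (rule_tac derivative_eq_intros refl | simp)+
      then show "((\<lambda>x. (1 - t ^ 2) * (x / (1 - t * x))) has_real_derivative (1 - t ^ 2) / (1 - t * x) ^ 2) (at x)"
        by (simp add: power2_eq_square)
      show "0 \<le> (1 - t ^ 2) / (1 - t * x) ^ 2" using t by (simp add: abs_square_le_1)
    qed auto
    also have "(1 - t ^ 2) * (1 / (1 - t * 1)) - (1 - t ^ 2) * (0 / (1 - t * 0)) = 1 + t"
      using t by (simp add: field_simps power2_eq_square)
    also have "ennreal (1 + t) + (\<integral>\<^sup>+\<rho>\<in>{0..1}. ennreal (S \<tau> \<rho>) \<partial>lborel) \<le> ennreal 2 + ennreal (2 * length \<tau>)"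
      using Cons t by (intro add_mono ennreal_leI) auto
    also have "\<dots> = ennreal (2 * length (a # \<tau>))"
      by (subst ennreal_plus[symmetric]) (auto simp: algebra_simps)
    finally show ?case .
  qed
  have "(\<integral>\<^sup>+\<rho>\<in>{0<..<1}. besov_integrand \<infinity> Q (blaschke \<sigma>) \<rho> \<partial>lborel)
     \<le> (\<integral>\<^sup>+\<rho>\<in>{0..1}. ennreal (S \<sigma> \<rho>) \<partial>lborel)"
  proof (intro nn_integral_mono)
    fix \<rho> :: real
    show "besov_integrand \<infinity> Q (blaschke \<sigma>) \<rho> * indicator {0<..<1} \<rho>
        \<le> ennreal (S \<sigma> \<rho>) * indicator {0..1} \<rho>"
    proof (cases "\<rho> \<in> {0<..<1}")
      case True
      then have \<rho>: "0 < \<rho>" "\<rho> < 1" by auto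
      \<comment> \<open>Both bounds for \<open>\<bar>B\'\<bar>\<close> are needed: \<open>1 / (1 - \<rho>)\<close> for \<open>Q - 1\<close> of the powers, \<open>S\<close> for the last one.\<close>
      define M where "M = min (1 / (1 - \<rho>)) (S \<sigma> \<rho>)"
      have M: "0 \<le> M" "M \<le> S \<sigma> \<rho>" "(1 - \<rho>) * M \<le> 1"
        using S0[OF s] \<rho> by (auto simp: M_def min_def field_simps)
      have "circle_norm \<infinity> (deriv (blaschke \<sigma>)) \<rho> \<le> ennreal M"
      proof (rule esssup_circle_le)
        show "continuous_on (sphere 0 1) (\<lambda>\<zeta>. deriv (blaschke \<sigma>) (of_real \<rho> * \<zeta>))"
          by (intro continuous_on_circle_dilate holomorphic_on_deriv_blaschke s) (use \<rho> in auto)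
        fix \<zeta> :: complex assume z: "norm \<zeta> = 1"
        then have "(1 - \<rho>) * norm (deriv (blaschke \<sigma>) (of_real \<rho> * \<zeta>)) \<le> 1"
          using norm_deriv_le_of_bounded[OF holomorphic_on_blaschke[OF s] norm_blaschke_le_1[OF s], of "of_real \<rho> * \<zeta>"] \<rho>
          by (simp add: norm_mult)
        then have "norm (deriv (blaschke \<sigma>) (of_real \<rho> * \<zeta>)) \<le> 1 / (1 - \<rho>)"
          using \<rho> by (simp add: field_simps)
        moreover have "norm (deriv (blaschke \<sigma>) (of_real \<rho> * \<zeta>)) \<le> S \<sigma> \<rho>"
        proof -
          have "norm (deriv (blaschke \<sigma>) (of_real \<rho> * \<zeta>)) \<le> (\<Sum>a\<leftarrow>\<sigma>. (1 - norm a ^ 2) / norm (1 - cnj a * (of_real \<rho> * \<zeta>)) ^ 2)"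
            by (rule norm_deriv_blaschke_le_sum[OF s]) (use z \<rho> in \<open>simp add: norm_mult\<close>)
          also have "\<dots> \<le> S \<sigma> \<rho>"
            unfolding S_def
          proof (rule sum_list_mono)
            fix a assume "a \<in> set \<sigma>"
            then have a: "norm a < 1" using s by auto
            have "norm (cnj a * (of_real \<rho> * \<zeta>)) = norm a * \<rho>" using \<rho> z by (simp add: norm_mult)
            then have "1 - norm a * \<rho> \<le> norm (1 - cnj a * (of_real \<rho> * \<zeta>))"
              by (metis norm_one norm_triangle_ineq2)
            moreover have "0 < 1 - norm a * \<rho>" using mult_strict_mono[of "norm a" 1 \<rho> 1] a \<rho> by auto
            ultimately show "(1 - norm a ^ 2) / norm (1 - cnj a * (of_real \<rho> * \<zeta>)) ^ 2 \<le> (1 - norm a ^ 2) / (1 - norm a * \<rho>) ^ 2"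
              using a by (intro divide_left_mono power_mono mult_pos_pos) (auto simp: abs_square_le_1 intro!: zero_less_power)
          qed
          finally show ?thesis .
        qed
        ultimately show "norm (deriv (blaschke \<sigma>) (of_real \<rho> * \<zeta>)) \<le> M" by (simp add: M_def)
      qed
      then have "ennreal_powr (circle_norm \<infinity> (deriv (blaschke \<sigma>)) \<rho>) Q \<le> ennreal (M powr Q)"
        using ennreal_powr_mono[of _ "ennreal M" Q] q M by (simp add: ennreal_powr_ennreal)
      then have "besov_integrand \<infinity> Q (blaschke \<sigma>) \<rho>
          \<le> ennreal ((1 - \<rho>) powr (Q - 1)) * ennreal (M powr Q)"
        by (intro mult_left_mono) auto
      also have "\<dots> = ennreal ((1 - \<rho>) powr (Q - 1) * M powr Q)" by (simp add: ennreal_mult')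
      also have "(1 - \<rho>) powr (Q - 1) * M powr Q = ((1 - \<rho>) * M) powr (Q - 1) * M"
        using M \<rho> q by (cases "M = 0") (auto simp: powr_mult powr_diff)
      also have "ennreal \<dots> \<le> ennreal (1 * S \<sigma> \<rho>)"
        using M \<rho> q by (intro ennreal_leI mult_mono powr_le1) auto
      finally show ?thesis using True by simp
    qed simp
  qed
  also have "\<dots> \<le> ennreal (2 * N)" using Sint[OF s] len by simp
  finally have "besov_norm \<infinity> q (blaschke \<sigma>) \<le> ennreal (1 + (2 * N) powr (1 / Q))"
    by (intro besov_norm_le[OF \<sigma> q(2,3,4,1)]) auto
  also have "\<dots> \<le> ennreal (3 * N powr (1 / Q))"
  proof (rule ennreal_leI)
    have "1 powr (1/Q) \<le> N powr (1 / Q)" using N q by (intro powr_mono2) auto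
    moreover have "2 powr (1 / Q) \<le> 2 powr 1" using q by (intro powr_mono) auto
    then have "(2 * N) powr (1 / Q) \<le> 2 * N powr (1 / Q)" by (simp add: powr_mult mult_right_mono)
    ultimately show "1 + (2 * N) powr (1 / Q) \<le> 3 * N powr (1 / Q)" by simp
  qed
  finally show ?thesis .
qed

section \<open>Lower bounds from separate scales\<close>

text \<open>On the interval \<open>(1 - u, 1 - u/2)\<close> the measure \<open>d\<rho> / (1 - \<rho>)\<close> has mass at least \<open>1/2\<close>, whatever \<open>u\<close> is; halving
\<open>u\<close> at every step keeps the intervals disjoint.\<close>

lemma besov_seminorm_ge:
  fixes u :: "nat \<Rightarrow> real"
  assumes q: "1 \<le> Q" "q = ennreal Q" "enn2real q = Q" "recip q = 1 / Q" and A: "0 \<le> A"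
    and u: "\<And>i. 0 < u i" "\<And>i. u i \<le> 1" "\<And>i. u (Suc i) \<le> u i / 2"
    and lower: "\<And>i \<rho>. i < K \<Longrightarrow> 1 - u i < \<rho> \<Longrightarrow> \<rho> < 1 - u i / 2 \<Longrightarrow>
       ennreal (A / (1 - \<rho>)) \<le> circle_norm p (deriv f) \<rho>"
  shows "ennreal ((real K * A powr Q / 2) powr (1 / Q)) \<le> besov_seminorm p q f"
proof -
  let ?I = "\<lambda>i. {1 - u i<..<1 - u i / 2}"
  let ?g = "\<lambda>\<rho>. besov_integrand p Q f \<rho>"
  have mono: "u j \<le> u i / 2" if "i < j" for i j
  proof -
    have "u j \<le> u (Suc i)"
    proof (rule lift_Suc_antimono_le[of u])
      show "u (Suc n) \<le> u n" for n using u(1)[of n] u(3)[of n] by linarith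
    qed (use that in simp)
    then show ?thesis using u(3)[of i] by linarith
  qed
  have disj: "i = j" if "\<rho> \<in> ?I i" "\<rho> \<in> ?I j" for i j \<rho>
    using that mono[of i j] mono[of j i] by (cases i j rule: linorder_cases) auto
  have piece: "ennreal (A powr Q / u i) \<le> ?g \<rho>" if i: "i < K" and \<rho>: "\<rho> \<in> ?I i" for i \<rho>
  proof -
    have r: "0 < 1 - \<rho>" "1 - \<rho> \<le> u i" using \<rho> u(1)[of i] by auto
    have "A powr Q / u i \<le> A powr Q / (1 - \<rho>)"
      using r by (intro divide_left_mono) auto
    also have "\<dots> = (1 - \<rho>) powr (Q - 1) * (A / (1 - \<rho>)) powr Q"
      using r A by (simp add: powr_divide powr_diff)
    also have "ennreal \<dots> = ennreal ((1 - \<rho>) powr (Q - 1)) * ennreal_powr (ennreal (A / (1 - \<rho>))) Q"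
      using r A by (simp add: ennreal_powr_ennreal ennreal_mult')
    also have "\<dots> \<le> ?g \<rho>"
      using lower[OF i] \<rho> q by (intro mult_left_mono ennreal_powr_mono) auto
    finally show ?thesis using ennreal_leI by fastforce
  qed
  have "ennreal (real K * A powr Q / 2) = (\<Sum>i<K. ennreal (A powr Q / 2))"
    by (subst sum_ennreal) auto
  also have "\<dots> = (\<Sum>i<K. \<integral>\<^sup>+\<rho>. ennreal (A powr Q / u i) * indicator (?I i) \<rho> \<partial>lborel)"
  proof (rule sum.cong)
    fix i
    have "(\<integral>\<^sup>+\<rho>. ennreal (A powr Q / u i) * indicator (?I i) \<rho> \<partial>lborel)
        = ennreal (A powr Q / u i) * ennreal (u i / 2)"
      using u(1)[of i] by (simp add: nn_integral_cmult_indicator)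
    also have "\<dots> = ennreal (A powr Q / 2)"
      using u(1)[of i] by (simp add: ennreal_mult'[symmetric])
    finally show "ennreal (A powr Q / 2) = (\<integral>\<^sup>+\<rho>. ennreal (A powr Q / u i) * indicator (?I i) \<rho> \<partial>lborel)" ..
  qed simp
  also have "\<dots> = (\<integral>\<^sup>+\<rho>. (\<Sum>i<K. ennreal (A powr Q / u i) * indicator (?I i) \<rho>) \<partial>lborel)"
    by (rule nn_integral_sum[symmetric]) auto
  also have "\<dots> \<le> (\<integral>\<^sup>+\<rho>\<in>{0<..<1}. ?g \<rho> \<partial>lborel)"
  proof (rule nn_integral_mono)
    fix \<rho> :: real
    show "(\<Sum>i<K. ennreal (A powr Q / u i) * indicator (?I i) \<rho>) \<le> ?g \<rho> * indicator {0<..<1} \<rho>"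
    proof (cases "\<exists>i<K. \<rho> \<in> ?I i")
      case True
      then obtain i where i: "i < K" "\<rho> \<in> ?I i" by blast
      have "(\<Sum>j<K. ennreal (A powr Q / u j) * indicator (?I j) \<rho>)
          = (\<Sum>j<K. if j = i then ennreal (A powr Q / u i) else 0)"
      proof (intro sum.cong refl)
        fix j
        show "ennreal (A powr Q / u j) * indicator (?I j) \<rho> = (if j = i then ennreal (A powr Q / u i) else 0)"
        proof (cases "\<rho> \<in> ?I j")
          case True
          then have "j = i" using disj[OF i(2)] by simp
          then show ?thesis using i(2) by simp
        next
          case False
          then have "j \<noteq> i" using i(2) by blast
          moreover have "indicator (?I j) \<rho> = (0::ennreal)" using False by (rule indicator_simps(2))
          ultimately show ?thesis by (simp only: mult_zero_right if_False)
        qed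
      qed
      also have "\<dots> = ennreal (A powr Q / u i)" using i by simp
      also have "\<dots> \<le> ?g \<rho>" by (rule piece[OF i])
      also have "\<rho> \<in> {0<..<1}" using i(2) u(1,2)[of i] by auto
      then have "?g \<rho> = ?g \<rho> * indicator {0<..<1} \<rho>" by simp
      finally show ?thesis .
    next
      case False
      then have "(\<Sum>j<K. ennreal (A powr Q / u j) * indicator (?I j) \<rho>) = 0"
        by (intro sum.neutral) (auto split: split_indicator)
      then show ?thesis by (simp only: zero_le)
    qed
  qed
  finally have "ennreal_powr (ennreal (real K * A powr Q / 2)) (1 / Q) \<le> besov_seminorm p q f"
    unfolding besov_seminorm_finite[OF q(2-4)] using q by (intro ennreal_powr_mono) auto
  then show ?thesis by (simp add: ennreal_powr_ennreal)
qed

section \<open>Finite Blaschke products up to a unimodular constant\<close>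

text \<open>The unimodular constant is allowed because compositions such as \<open>f(z\<^sup>n)\<close> and Moebius transforms of \<open>f\<close> are
Blaschke products only up to such a constant; it does not affect the Besov norms.\<close>

definition is_blaschke :: "nat \<Rightarrow> (complex \<Rightarrow> complex) \<Rightarrow> bool" where
  "is_blaschke N f \<longleftrightarrow>
     (\<exists>\<sigma>\<in>disc_tuples N. \<exists>c. norm c = 1 \<and> (\<forall>z\<in>ball 0 1. f z = c * blaschke \<sigma> z))"

lemma is_blaschke_holomorphic:
  assumes "is_blaschke N f"
  shows "f holomorphic_on ball 0 1"
proof -
  obtain \<sigma> c where \<sigma>: "\<sigma> \<in> disc_tuples N" and eq: "\<And>z. z \<in> ball 0 1 \<Longrightarrow> f z = c * blaschke \<sigma> z"
    using assms unfolding is_blaschke_def by blast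
  have "(\<lambda>z. c * blaschke \<sigma> z) holomorphic_on ball 0 1"
    by (intro holomorphic_intros holomorphic_on_blaschke disc_tuplesD(2)[OF \<sigma>])
  then show ?thesis by (rule holomorphic_transform) (use eq in simp)
qed

lemma is_blaschke_norm_le_1:
  assumes "is_blaschke N f" "norm z < 1"
  shows "norm (f z) \<le> 1"
  using assms by (auto simp: is_blaschke_def norm_mult intro!: norm_blaschke_le_1 disc_tuplesD)

lemma Lp_norm_cong_norm:
  assumes "f \<in> borel_measurable M" "g \<in> borel_measurable M" "\<And>x. x \<in> space M \<Longrightarrow> norm (f x) = norm (g x)"
  shows "Lp_norm p M f = Lp_norm p M g"
proof -
  have "esssup M (\<lambda>x. ennreal (norm (f x))) = esssup M (\<lambda>x. ennreal (norm (g x)))"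
    using assms by (intro esssup_AE_cong AE_I2) auto
  moreover have "(\<integral>\<^sup>+x. ennreal (norm (f x) powr enn2real p) \<partial>M) = (\<integral>\<^sup>+x. ennreal (norm (g x) powr enn2real p) \<partial>M)"
    using assms by (intro nn_integral_cong) simp
  ultimately show ?thesis by (simp add: Lp_norm_def)
qed

lemma besov_norm_blaschke_unimodular:
  assumes \<sigma>: "\<sigma> \<in> disc_tuples N" and c: "norm c = 1"
    and eq: "\<And>z. z \<in> ball 0 1 \<Longrightarrow> f z = c * blaschke \<sigma> z"
  shows "besov_norm p q f = besov_norm p q (blaschke \<sigma>)"
proof -
  note s = disc_tuplesD(2)[OF \<sigma>]
  have "is_blaschke N f" using assms by (auto simp: is_blaschke_def)
  then have hol: "f holomorphic_on ball 0 1" by (rule is_blaschke_holomorphic)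
  have der: "norm (deriv f z) = norm (deriv (blaschke \<sigma>) z)" if z: "z \<in> ball 0 1" for z
  proof -
    have "(blaschke \<sigma> has_field_derivative deriv (blaschke \<sigma>) z) (at z)"
      by (rule holomorphic_derivI[OF holomorphic_on_blaschke[OF s] _ z]) simp
    then have "((\<lambda>z. c * blaschke \<sigma> z) has_field_derivative c * deriv (blaschke \<sigma>) z) (at z)"
      by (rule DERIV_cmult)
    then have "(f has_field_derivative c * deriv (blaschke \<sigma>) z) (at z)"
      by (rule has_field_derivative_transform_within_open[where S = "ball 0 1"]) (use z eq in auto)
    then show ?thesis using c by (simp add: DERIV_imp_deriv norm_mult)
  qed
  have Lp: "circle_norm p (deriv f) \<rho>
      = circle_norm p (deriv (blaschke \<sigma>)) \<rho>" if "\<rho> \<in> {0<..<1}" for \<rho> :: real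
  proof (rule Lp_norm_cong_norm)
    show "(\<lambda>\<zeta>. deriv f (of_real \<rho> * \<zeta>)) \<in> borel_measurable circle_measure"
      "(\<lambda>\<zeta>. deriv (blaschke \<sigma>) (of_real \<rho> * \<zeta>)) \<in> borel_measurable circle_measure"
      using that by (auto intro!: borel_measurable_circle continuous_on_circle_dilate
          holomorphic_deriv hol holomorphic_on_blaschke s)
    fix \<zeta> assume "\<zeta> \<in> space circle_measure"
    then show "norm (deriv f (of_real \<rho> * \<zeta>)) = norm (deriv (blaschke \<sigma>) (of_real \<rho> * \<zeta>))"
      using that by (intro der) (simp add: space_circle_measure norm_mult)
  qed
  have "besov_seminorm p q f = besov_seminorm p q (blaschke \<sigma>)"
  proof (cases "q = \<infinity>")
    case True
    then show ?thesis using Lp by (auto simp: besov_seminorm_def Let_def intro!: SUP_cong)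
  next
    case False
    have "(\<integral>\<^sup>+\<rho>\<in>{0<..<1}. besov_integrand p (enn2real q) f \<rho> \<partial>lborel)
       = (\<integral>\<^sup>+\<rho>\<in>{0<..<1}. besov_integrand p (enn2real q) (blaschke \<sigma>) \<rho> \<partial>lborel)"
      by (intro nn_integral_cong) (use Lp in \<open>auto split: split_indicator\<close>)
    then show ?thesis using False by (simp add: besov_seminorm_def Let_def)
  qed
  moreover have "norm (f 0) = norm (blaschke \<sigma> 0)" using eq[of 0] c by (simp add: norm_mult)
  ultimately show ?thesis by (simp add: besov_norm_def)
qed

text \<open>The degrees are allowed to run through a sparse sequence, such as the partial sums of a geometric series.\<close>

lemma growth_attainedI:
  fixes n :: "nat \<Rightarrow> nat"
  assumes "c > 0" and "strict_mono n" and n2: "\<And>K. K0 \<le> K \<Longrightarrow> 2 \<le> n K"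
    and "\<And>K. K0 \<le> K \<Longrightarrow> \<exists>f. is_blaschke (n K) f \<and> ennreal (c * \<phi> (n K)) \<le> besov_norm p q f"
  shows "growth_attained p q \<phi>"
  unfolding growth_attained_def
proof (intro exI conjI)
  let ?S = "{N. N \<ge> 2 \<and> (\<exists>\<sigma>\<in>disc_tuples N. ennreal (c * \<phi> N) \<le> besov_norm p q (blaschke \<sigma>))}"
  have "n ` {K0..} \<subseteq> ?S"
  proof (intro image_subsetI)
    fix K assume "K \<in> {K0..}"
    then have K: "K0 \<le> K" by simp
    obtain f \<sigma> c' where f: "ennreal (c * \<phi> (n K)) \<le> besov_norm p q f" and \<sigma>: "\<sigma> \<in> disc_tuples (n K)"
      "norm c' = 1" "\<And>z. z \<in> ball 0 1 \<Longrightarrow> f z = c' * blaschke \<sigma> z"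
      using assms(4)[OF K] by (auto simp: is_blaschke_def)
    then show "n K \<in> ?S"
      using besov_norm_blaschke_unimodular[OF \<sigma>, of p q] n2[OF K] by auto
  qed
  moreover have "infinite (n ` {K0..})"
    using assms(2) by (auto dest!: finite_imageD simp: strict_mono_imp_inj_on inj_on_subset infinite_Ici)
  ultimately show "infinite ?S" using finite_subset by blast
qed (fact assms)

section \<open>Lower bounds for means over circles\<close>

text \<open>A Taylor coefficient is a mean of \<open>f\<close> against a unimodular function, hence bounded by the \<open>L\<^sup>1\<close> mean and, by Jensen's inequality, by the \<open>L\<^sup>p\<close> mean.\<close>

lemma Lp_norm_ge_taylor_coeff:
  assumes f: "f holomorphic_on ball 0 1" and \<rho>: "0 \<le> \<rho>" "\<rho> < 1" and p: "1 \<le> P" "p = ennreal P" "recip p = 1 / P"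
  shows "ennreal (norm (taylor_coeff f n) * \<rho> ^ n) \<le> circle_norm p f \<rho>"
proof -
  define g where "g \<zeta> = f (of_real \<rho> * \<zeta>)" for \<zeta>
  have cont: "continuous_on (sphere 0 1) g"
    unfolding g_def by (rule continuous_on_circle_dilate[OF f \<rho>])
  have "(\<integral>\<zeta>. g \<zeta> * cnj \<zeta> ^ n \<partial>circle_measure) = taylor_coeff g n"
    unfolding g_def by (intro taylor_coeff_eq_integral continuous_on_dilate holomorphic_on_dilate f \<rho>)
  also have "taylor_coeff g n = of_real \<rho> ^ n * taylor_coeff f n"
    unfolding g_def by (rule taylor_coeff_dilate[OF f \<rho>])
  finally have "norm (taylor_coeff f n) * \<rho> ^ n = norm (\<integral>\<zeta>. g \<zeta> * cnj \<zeta> ^ n \<partial>circle_measure)"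
    using \<rho> by (simp add: norm_mult norm_power)
  also have "\<dots> \<le> (\<integral>\<zeta>. norm (g \<zeta> * cnj \<zeta> ^ n) \<partial>circle_measure)"
    by (rule integral_norm_bound)
  also have "\<dots> = (\<integral>\<zeta>. norm (g \<zeta>) \<partial>circle_measure)"
    by (rule Bochner_Integration.integral_cong) (auto simp: space_circle_measure norm_mult norm_power)
  finally have le: "norm (taylor_coeff f n) * \<rho> ^ n \<le> (\<integral>\<zeta>. norm (g \<zeta>) \<partial>circle_measure)" .
  have "(\<integral>\<zeta>. norm (g \<zeta>) \<partial>circle_measure) powr P \<le> (\<integral>\<zeta>. norm (g \<zeta>) powr P \<partial>circle_measure)"
    by (intro mean_power continuous_intros cont) (use p in auto)
  then have "((\<integral>\<zeta>. norm (g \<zeta>) \<partial>circle_measure) powr P) powr (1 / P) \<le> (\<integral>\<zeta>. norm (g \<zeta>) powr P \<partial>circle_measure) powr (1 / P)"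
    using p by (intro powr_mono2) auto
  moreover have "0 \<le> (\<integral>\<zeta>. norm (g \<zeta>) \<partial>circle_measure)" by (intro integral_nonneg_AE) auto
  ultimately have "(\<integral>\<zeta>. norm (g \<zeta>) \<partial>circle_measure) \<le> (\<integral>\<zeta>. norm (g \<zeta>) powr P \<partial>circle_measure) powr (1 / P)"
    using p by (simp add: powr_powr)
  with le show ?thesis
    using Lp_norm_circle[OF cont p(2,1,3)] by (simp add: g_def[symmetric] ennreal_leI)
qed

lemma norm_le_poisson_integral:
  assumes f: "f holomorphic_on ball 0 1" and \<rho>: "0 \<le> \<rho>" "\<rho> < 1" and c: "norm c < 1"
  shows "norm (f (of_real \<rho> * c)) \<le> (\<integral>\<zeta>. norm (f (of_real \<rho> * \<zeta>)) * poisson c \<zeta> \<partial>circle_measure)"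
proof -
  have "f (of_real \<rho> * c) = (\<integral>\<zeta>. f (of_real \<rho> * \<zeta>) * poisson c \<zeta> \<partial>circle_measure)"
    by (rule poisson_formula[symmetric]) (intro continuous_on_dilate holomorphic_on_dilate f \<rho> c)+
  then have "norm (f (of_real \<rho> * c)) \<le> (\<integral>\<zeta>. norm (f (of_real \<rho> * \<zeta>) * poisson c \<zeta>) \<partial>circle_measure)"
    by (metis integral_norm_bound)
  then show ?thesis using poisson_nonneg[OF c] by (simp add: norm_mult)
qed

text \<open>The Poisson integral is an average, so an almost everywhere bound on the circle carries over to the interior; this avoids comparing the essential supremum with the maximum.\<close>

lemma sup_norm_ge:
  assumes f: "f holomorphic_on ball 0 1" and \<rho>: "0 \<le> \<rho>" "\<rho> < 1" and c: "norm c < 1"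
  shows "ennreal (norm (f (of_real \<rho> * c))) \<le> circle_norm \<infinity> f \<rho>"
proof -
  define M where "M = esssup circle_measure (\<lambda>\<zeta>. ennreal (norm (f (of_real \<rho> * \<zeta>))))"
  have AE: "AE \<zeta> in circle_measure. ennreal (norm (f (of_real \<rho> * \<zeta>))) \<le> M"
    unfolding M_def by (rule esssup_AE)
  have "ennreal (norm (f (of_real \<rho> * c))) \<le> M"
  proof (cases M)
    case (real m)
    note cont = continuous_on_circle_dilate[OF f \<rho>]
    have "norm (f (of_real \<rho> * c)) \<le> (\<integral>\<zeta>. norm (f (of_real \<rho> * \<zeta>)) * poisson c \<zeta> \<partial>circle_measure)"
      by (rule norm_le_poisson_integral[OF f \<rho> c])
    also have "\<dots> \<le> (\<integral>\<zeta>. m * poisson c \<zeta> \<partial>circle_measure)"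
    proof (rule integral_mono_AE)
      show "AE \<zeta> in circle_measure. norm (f (of_real \<rho> * \<zeta>)) * poisson c \<zeta> \<le> m * poisson c \<zeta>"
        using AE by eventually_elim (use real poisson_nonneg[OF c] in \<open>auto intro!: mult_right_mono\<close>)
    qed (intro integrable_circle continuous_intros cont c)+
    also have "\<dots> = m" using integral_poisson[OF c] by simp
    finally show ?thesis using real by (simp add: ennreal_leI)
  qed simp
  then show ?thesis by (simp add: Lp_norm_def M_def)
qed

text \<open>Expanding each summand into a finite geometric series, all powers of \<open>x\<close> except the constant one are cancelled by the sum over the roots of unity.\<close>

lemma sum_roots_of_unity_resolvent:
  assumes n: "1 \<le> n" and x: "norm (x::complex) < 1"
  defines "\<omega> \<equiv> exp (2 * of_real pi * \<i> / of_nat n)"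
  shows "(\<Sum>l<n. 1 / (1 - x * \<omega> ^ l)) = of_nat n / (1 - x ^ n)"
proof -
  have pow: "\<omega> ^ j = exp (2 * of_real pi * \<i> * of_nat j / of_nat n)" for j
    unfolding \<omega>_def by (simp add: exp_of_nat_mult[symmetric] mult_ac)
  have prim: "\<omega> ^ m \<noteq> 1" if "0 < m" "m < n" for m
    using complex_root_unity_eq_1[OF n] that nat_dvd_not_less by (auto simp: pow)
  have root: "\<omega> ^ n = 1" by (simp only: pow complex_root_unity_eq_1[OF n] dvd_refl)
  have nw: "norm (\<omega> ^ l) = 1" for l by (simp add: pow)
  have nz: "1 - x * \<omega> ^ l \<noteq> 0" for l
    by (rule one_minus_mult_nonzero) (use x nw in auto)
  have "norm (x ^ n) < 1" using x n by (simp add: norm_power power_less_one_iff)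
  then have nzn: "1 - x ^ n \<noteq> 0" by (metis eq_iff_diff_eq_0 less_irrefl norm_one)
  have "(1 - x ^ n) / (1 - x * \<omega> ^ l) = (\<Sum>m<n. x ^ m * (\<omega> ^ m) ^ l)" for l
  proof -
    have "(x * \<omega> ^ l) ^ n = x ^ n"
      by (simp add: power_mult_distrib power_mult[symmetric] mult.commute[of l] root power_mult)
    then have "1 - x ^ n = (1 - x * \<omega> ^ l) * (\<Sum>m<n. (x * \<omega> ^ l) ^ m)"
      using one_diff_power_eq[of "x * \<omega> ^ l" n] by simp
    then show ?thesis
      using nz[of l] by (simp add: power_mult_distrib power_mult[symmetric] mult.commute)
  qed
  then have "(1 - x ^ n) * (\<Sum>l<n. 1 / (1 - x * \<omega> ^ l)) = (\<Sum>l<n. \<Sum>m<n. x ^ m * (\<omega> ^ m) ^ l)"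
    by (simp add: sum_distrib_left)
  also have "\<dots> = (\<Sum>m<n. x ^ m * (\<Sum>l<n. (\<omega> ^ m) ^ l))"
    by (subst sum.swap) (simp add: sum_distrib_left)
  also have "\<dots> = (\<Sum>m<n. if m = 0 then of_nat n else 0)"
  proof (intro sum.cong refl)
    fix m assume m: "m \<in> {..<n}"
    show "x ^ m * (\<Sum>l<n. (\<omega> ^ m) ^ l) = (if m = 0 then of_nat n else 0)"
    proof (cases "m = 0")
      case False
      have "(\<omega> ^ m) ^ n = 1" by (metis root power_commutes power_mult power_one mult.commute)
      then have "(1 - \<omega> ^ m) * (\<Sum>l<n. (\<omega> ^ m) ^ l) = 0"
        using one_diff_power_eq[of "\<omega> ^ m" n] by simp
      then show ?thesis using prim[of m] False m by auto
    qed simp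
  qed
  also have "\<dots> = of_nat n" using n by simp
  finally show ?thesis using nzn by (simp add: field_simps)
qed

lemma poisson_eq_Re:
  assumes "norm c < 1" "norm \<zeta> = 1"
  shows "poisson c \<zeta> = 2 * Re (1 / (1 - cnj c * \<zeta>)) - 1"
proof -
  define x where "x = cnj c * \<zeta>"
  have nx: "norm x = norm c" using assms by (simp add: x_def norm_mult)
  have nz: "1 - x \<noteq> 0" unfolding x_def using one_minus_mult_nonzero[of "cnj c" \<zeta>] assms by simp
  have Re: "Re (1 / (1 - x)) = (1 - Re x) / norm (1 - x) ^ 2"
    by (simp add: Re_divide cmod_power2)
  have "norm (1 - x) ^ 2 = 1 - 2 * Re x + norm x ^ 2"
    by (simp add: cmod_power2) (simp add: power2_eq_square algebra_simps)
  then have *: "1 - norm x ^ 2 = 2 * (1 - Re x) - norm (1 - x) ^ 2" by simp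
  have "(1 - norm x ^ 2) / norm (1 - x) ^ 2 = 2 * ((1 - Re x) / norm (1 - x) ^ 2) - 1"
  proof -
    have "A / D = 2 * (B / D) - 1" if "A = 2 * B - D" "D \<noteq> 0" for A B D :: real
      using that by (simp add: field_simps)
    from this[OF *] show ?thesis using nz by simp
  qed
  with Re have "(1 - norm x ^ 2) / norm (1 - x) ^ 2 = 2 * Re (1 / (1 - x)) - 1" by simp
  then show ?thesis by (simp add: poisson_def x_def[symmetric] nx[symmetric])
qed

text \<open>Averaging the Poisson kernels at the \<open>n\<close> points gives a weight \<open>W\<close> of mean \<open>1\<close> that equals the Poisson kernel at
\<open>c\<^sup>n\<close> evaluated at \<open>\<zeta>\<^sup>n\<close>, hence is bounded by \<open>2 / (1 - c\<^sup>n)\<close>; a single kernel would be larger by a factor of up to \<open>n\<close>.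
The weighted Jensen inequality then applies.\<close>

lemma Lp_norm_ge_at_roots:
  assumes f: "f holomorphic_on ball 0 1" and \<rho>: "0 \<le> \<rho>" "\<rho> < 1" and p: "1 \<le> P" "p = ennreal P" "recip p = 1 / P"
    and n: "1 \<le> n" and c: "0 \<le> c" "c < 1" and a: "0 \<le> a"
    and lower: "\<And>w. w ^ n = of_real c ^ n \<Longrightarrow> a \<le> norm (f (of_real \<rho> * w))"
  shows "ennreal (a * ((1 - c ^ n) / 2) powr (1 / P)) \<le> circle_norm p f \<rho>"
proof -
  define \<omega> where "\<omega> = exp (2 * of_real pi * \<i> / of_nat n)"
  define w where "w l = of_real c * cnj \<omega> ^ l" for l :: nat
  define W where "W \<zeta> = (\<Sum>l<n. poisson (w l) \<zeta>) / n" for \<zeta>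
  define u where "u \<zeta> = norm (f (of_real \<rho> * \<zeta>))" for \<zeta>
  have n\<omega>: "norm \<omega> = 1" by (simp add: \<omega>_def)
  have \<omega>n: "\<omega> ^ n = 1"
  proof -
    have "\<omega> ^ j = exp (2 * of_real pi * \<i> * of_nat j / of_nat n)" for j
      unfolding \<omega>_def by (simp add: exp_of_nat_mult[symmetric] mult_ac)
    then show ?thesis by (simp only: complex_root_unity_eq_1[OF n] dvd_refl)
  qed
  have w: "norm (w l) < 1" for l using c by (simp add: w_def norm_mult norm_power n\<omega>)
  have wn: "w l ^ n = of_real c ^ n" for l
  proof -
    have "(cnj \<omega> ^ l) ^ n = cnj ((\<omega> ^ n) ^ l)" by (simp add: power_mult[symmetric] mult.commute)
    then show ?thesis by (simp add: w_def power_mult_distrib \<omega>n)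
  qed
  have cn: "c ^ n < 1" using c n by (simp add: power_less_one_iff)
  have contu: "continuous_on (sphere 0 1) u"
    unfolding u_def by (intro continuous_intros continuous_on_circle_dilate f \<rho>)
  have contW: "continuous_on (sphere 0 1) W"
    unfolding W_def using n w by (intro continuous_intros) auto
  have ip: "integrable circle_measure (poisson (w l))" for l
    by (intro integrable_circle continuous_intros w)
  have iup: "integrable circle_measure (\<lambda>\<zeta>. u \<zeta> * poisson (w l) \<zeta>)" for l
    by (intro integrable_circle continuous_intros w contu)
  have W0: "0 \<le> W \<zeta>" for \<zeta>
    unfolding W_def by (intro divide_nonneg_nonneg sum_nonneg poisson_nonneg w) auto
  have WH: "W \<zeta> \<le> 2 / (1 - c ^ n)" if "\<zeta> \<in> sphere 0 1" for \<zeta>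
  proof -
    have z: "norm \<zeta> = 1" using that by simp
    \<comment> \<open>The Poisson kernels at the points \<open>w l\<close> are \<open>2 Re (1 / (1 - x \<omega>\<^sup>l)) - 1\<close>, so their sum is a sum of resolvents over roots of unity.\<close>
    define x where "x = of_real c * \<zeta>"
    have x: "norm x < 1" using c z by (simp add: x_def norm_mult)
    have "poisson (w l) \<zeta> = 2 * Re (1 / (1 - x * \<omega> ^ l)) - 1" for l
      using poisson_eq_Re[OF w[of l] z] by (simp add: x_def w_def mult_ac)
    then have "W \<zeta> = (\<Sum>l<n. 2 * Re (1 / (1 - x * \<omega> ^ l)) - 1) / n"
      unfolding W_def by simp
    also have "\<dots> = (2 * Re (\<Sum>l<n. 1 / (1 - x * \<omega> ^ l)) - n) / n"
      by (simp add: sum_subtractf sum_distrib_left)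
    also have "(\<Sum>l<n. 1 / (1 - x * \<omega> ^ l)) = of_nat n / (1 - x ^ n)"
      unfolding \<omega>_def by (rule sum_roots_of_unity_resolvent[OF n x])
    also have "Re (of_nat n / (1 - x ^ n)) = n * Re (1 / (1 - x ^ n))"
    proof -
      have "of_nat n / (1 - x ^ n) = of_real n * (1 / (1 - x ^ n))" by simp
      then show ?thesis by (simp del: times_divide_eq_right)
    qed
    also have "(2 * (n * Re (1 / (1 - x ^ n))) - n) / n = 2 * Re (1 / (1 - x ^ n)) - 1"
      using n by (simp add: field_simps)
    also have "Re (1 / (1 - x ^ n)) \<le> norm (1 / (1 - x ^ n))" by (rule complex_Re_le_cmod)
    also have "norm (1 / (1 - x ^ n)) \<le> 1 / (1 - c ^ n)"
    proof -
      have "norm (x ^ n) = c ^ n" using c z by (simp add: x_def norm_mult norm_power power_mult_distrib)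
      then have "1 - c ^ n \<le> norm (1 - x ^ n)" by (metis norm_one norm_triangle_ineq2)
      then show ?thesis using cn by (simp add: norm_divide frac_le)
    qed
    finally show ?thesis by simp
  qed
  have intW: "(\<integral>\<zeta>. W \<zeta> \<partial>circle_measure) \<le> 1"
    unfolding W_def using n ip by (simp add: integral_poisson[OF w])
  have "real n * a = (\<Sum>l<n. a)" by simp
  also have "\<dots> \<le> (\<Sum>l<n. \<integral>\<zeta>. u \<zeta> * poisson (w l) \<zeta> \<partial>circle_measure)"
  proof (rule sum_mono)
    fix l
    show "a \<le> (\<integral>\<zeta>. u \<zeta> * poisson (w l) \<zeta> \<partial>circle_measure)"
      using lower[OF wn[of l]] norm_le_poisson_integral[OF f \<rho> w[of l]] by (simp add: u_def)
  qed
  also have "\<dots> = (\<integral>\<zeta>. (\<Sum>l<n. u \<zeta> * poisson (w l) \<zeta>) \<partial>circle_measure)"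
    using iup by (simp add: Bochner_Integration.integral_sum)
  also have "\<dots> = (\<integral>\<zeta>. real n * (u \<zeta> * W \<zeta>) \<partial>circle_measure)"
    using n by (intro Bochner_Integration.integral_cong) (auto simp: W_def simp flip: sum_distrib_left)
  finally have "a \<le> (\<integral>\<zeta>. u \<zeta> * W \<zeta> \<partial>circle_measure)" using n by simp
  then have "a powr P / (2 / (1 - c ^ n)) \<le> (\<integral>\<zeta>. u \<zeta> powr P \<partial>circle_measure)"
    using p cn WH W0 a intW
    by (intro weighted_mean_power[OF contu contW]) (auto simp: u_def)
  then have "(a powr P / (2 / (1 - c ^ n))) powr (1 / P) \<le> (\<integral>\<zeta>. u \<zeta> powr P \<partial>circle_measure) powr (1 / P)"
    using p cn by (intro powr_mono2) auto
  moreover have "(a powr P / (2 / (1 - c ^ n))) powr (1 / P) = a * ((1 - c ^ n) / 2) powr (1 / P)"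
  proof -
    have "a powr P / (2 / (1 - c ^ n)) = a powr P * ((1 - c ^ n) / 2)" by simp
    then show ?thesis using a p cn by (simp only: powr_mult) (simp add: powr_powr)
  qed
  ultimately show ?thesis
    using Lp_norm_circle[OF continuous_on_circle_dilate[OF f \<rho>] p(2,1,3)]
    by (simp add: u_def ennreal_leI)
qed

section \<open>Closure properties of finite Blaschke products\<close>

definition blaschke_num :: "complex list \<Rightarrow> complex poly" where
  "blaschke_num \<sigma> = (\<Prod>a\<leftarrow>\<sigma>. [:- a, 1:])"

definition blaschke_den :: "complex list \<Rightarrow> complex poly" where
  "blaschke_den \<sigma> = (\<Prod>a\<leftarrow>\<sigma>. [:1, - cnj a:])"

lemma blaschke_num_simps [simp]:
  "blaschke_num [] = 1" "blaschke_num (a # \<sigma>) = [:- a, 1:] * blaschke_num \<sigma>"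
  by (simp_all add: blaschke_num_def)

lemma blaschke_den_simps [simp]:
  "blaschke_den [] = 1" "blaschke_den (a # \<sigma>) = [:1, - cnj a:] * blaschke_den \<sigma>"
  by (simp_all add: blaschke_den_def)

lemma blaschke_eq_num_den: "blaschke \<sigma> z = poly (blaschke_num \<sigma>) z / poly (blaschke_den \<sigma>) z"
proof (induction \<sigma>)
  case (Cons a \<sigma>)
  have "poly (blaschke_num (a # \<sigma>)) z = (z - a) * poly (blaschke_num \<sigma>) z"
    "poly (blaschke_den (a # \<sigma>)) z = (1 - cnj a * z) * poly (blaschke_den \<sigma>) z"
    by (simp_all add: algebra_simps)
  then show ?case by (simp only: blaschke_Cons Cons.IH times_divide_times_eq)
qed simp

text \<open>Numerator and denominator are exchanged by reflection in the unit circle.\<close>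

lemma blaschke_num_den_reflect:
  assumes "z \<noteq> 0"
  shows "z ^ length \<sigma> * cnj (poly (blaschke_num \<sigma>) (1 / cnj z)) = poly (blaschke_den \<sigma>) z"
    and "z ^ length \<sigma> * cnj (poly (blaschke_den \<sigma>) (1 / cnj z)) = poly (blaschke_num \<sigma>) z"
proof (induction \<sigma>)
  case (Cons a \<sigma>)
  case 1
  have "z ^ length (a # \<sigma>) * cnj (poly (blaschke_num (a # \<sigma>)) (1 / cnj z))
      = (z * cnj (- a + 1 / cnj z)) * (z ^ length \<sigma> * cnj (poly (blaschke_num \<sigma>) (1 / cnj z)))"
    by (simp add: algebra_simps)
  also have "z * cnj (- a + 1 / cnj z) = 1 - cnj a * z"
    using assms by (simp add: algebra_simps)
  finally show ?case using Cons by (simp add: algebra_simps)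
next
  case (Cons a \<sigma>)
  case 2
  have "z ^ length (a # \<sigma>) * cnj (poly (blaschke_den (a # \<sigma>)) (1 / cnj z))
      = (z * cnj (1 - cnj a / cnj z)) * (z ^ length \<sigma> * cnj (poly (blaschke_den \<sigma>) (1 / cnj z)))"
    by (simp add: algebra_simps)
  also have "z * cnj (1 - cnj a / cnj z) = z - a"
    using assms by (simp add: algebra_simps)
  finally show ?case using Cons by (simp add: algebra_simps)
qed auto

lemma blaschke_den_nonzero:
  assumes "set \<sigma> \<subseteq> ball 0 1" "norm z \<le> 1"
  shows "poly (blaschke_den \<sigma>) z \<noteq> 0"
  using assms(1)
proof (induction \<sigma>)
  case (Cons a \<sigma>)
  then show ?case
    using one_minus_mult_nonzero[of "cnj a" z] assms(2) by (auto simp: mult.commute)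
qed simp

lemma blaschke_num_outside_disc:
  assumes "set \<sigma> \<subseteq> ball 0 1" "1 \<le> norm z"
  shows "poly (blaschke_num \<sigma>) z \<noteq> 0"
    and "norm (poly (blaschke_den \<sigma>) z) \<le> norm (poly (blaschke_num \<sigma>) z)"
  using assms(1)
proof (induction \<sigma>)
  case (Cons a \<sigma>)
  { case 1
    then show ?case using Cons assms(2) by auto
  next
    case 2
    then have a: "norm a < 1" by simp
    have "(1 - norm a ^ 2) * (1 - norm z ^ 2) \<le> 0"
      using a assms(2) by (intro mult_nonneg_nonpos) (auto simp: abs_square_le_1)
    then have "norm (1 - cnj a * z) ^ 2 \<le> norm (z - a) ^ 2"
      using moebius_norm_identity[of a z] by linarith
    then have "norm (1 - cnj a * z) \<le> norm (z - a)"
      by (rule power2_le_imp_le) auto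
    then have "norm (1 - cnj a * z) * norm (poly (blaschke_den \<sigma>) z) \<le> norm (z - a) * norm (poly (blaschke_num \<sigma>) z)"
      using Cons 2 by (intro mult_mono) auto
    then show ?case by (simp add: norm_mult[symmetric] algebra_simps) }
qed auto

lemma is_blaschke_cong:
  assumes "is_blaschke N f" "\<And>z. norm z < 1 \<Longrightarrow> g z = f z"
  shows "is_blaschke N g"
  using assms unfolding is_blaschke_def by (metis mem_ball_0)

lemma is_blaschke_cmult:
  assumes "is_blaschke N f" "norm c = 1"
  shows "is_blaschke N (\<lambda>z. c * f z)"
proof -
  obtain \<sigma> d where "\<sigma> \<in> disc_tuples N" "norm d = 1" "\<And>z. z \<in> ball 0 1 \<Longrightarrow> f z = d * blaschke \<sigma> z"
    using assms unfolding is_blaschke_def by blast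
  then show ?thesis
    unfolding is_blaschke_def using assms(2)
    by (intro bexI[of _ \<sigma>] exI[of _ "c * d"]) (auto simp: norm_mult)
qed

lemma blaschke_append: "blaschke (\<sigma> @ \<tau>) z = blaschke \<sigma> z * blaschke \<tau> z"
  by (simp add: blaschke_def)

lemma is_blaschke_mult:
  assumes "is_blaschke M f" "is_blaschke N g"
  shows "is_blaschke (M + N) (\<lambda>z. f z * g z)"
proof -
  obtain \<sigma> c where "\<sigma> \<in> disc_tuples M" "norm c = 1" "\<And>z. z \<in> ball 0 1 \<Longrightarrow> f z = c * blaschke \<sigma> z"
    using assms unfolding is_blaschke_def by blast
  moreover obtain \<tau> d where "\<tau> \<in> disc_tuples N" "norm d = 1" "\<And>z. z \<in> ball 0 1 \<Longrightarrow> g z = d * blaschke \<tau> z"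
    using assms unfolding is_blaschke_def by blast
  ultimately show ?thesis
    unfolding is_blaschke_def
    by (intro bexI[of _ "\<sigma> @ \<tau>"] exI[of _ "c * d"]) (auto simp: norm_mult blaschke_append disc_tuples_def)
qed

lemma is_blaschke_const: "norm c = 1 \<Longrightarrow> is_blaschke 0 (\<lambda>_. c)"
  unfolding is_blaschke_def by (intro bexI[of _ "[]"] exI[of _ c]) (auto simp: disc_tuples_def)

lemma is_blaschke_prod:
  assumes "\<And>j. j < K \<Longrightarrow> is_blaschke (n j) (f j)"
  shows "is_blaschke (\<Sum>j<(K::nat). n j) (\<lambda>z. \<Prod>j<K. f j z)"
  using assms by (induction K) (auto intro!: is_blaschke_const is_blaschke_mult)

text \<open>By the fundamental theorem of algebra \<open>P\<close> splits into linear factors, and its reflection is then the product of the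
matching denominators. This is the common source of the closure properties below.\<close>

lemma is_blaschke_reflected_quotient:
  fixes P :: "complex poly"
  assumes P0: "P \<noteq> 0" and deg: "degree P = N" and roots: "\<And>z. poly P z = 0 \<Longrightarrow> norm z < 1"
    and Q: "\<And>z. z \<noteq> 0 \<Longrightarrow> poly Q z = z ^ N * cnj (poly P (1 / cnj z))"
  shows "is_blaschke N (\<lambda>z. poly P z / poly Q z)"
proof -
  define c where "c = lead_coeff P"
  have c0: "c \<noteq> 0" using P0 by (simp add: c_def)
  obtain A where A: "size A = degree P" "P = smult c (\<Prod>x\<in>#A. [:- x, 1:])"
    using alg_closed_imp_factorization[OF P0] unfolding c_def by blast
  obtain \<sigma> where \<sigma>: "mset \<sigma> = A" using ex_mset by blast
  have len: "length \<sigma> = N" using A deg \<sigma> by auto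
  have Pn: "P = smult c (blaschke_num \<sigma>)"
    using A(2) by (simp add: blaschke_num_def \<sigma>[symmetric] prod_mset_prod_list[symmetric])
  have root: "poly (blaschke_num \<tau>) a = 0" if "a \<in> set \<tau>" for \<tau> and a :: complex
    using that by (induction \<tau>) auto
  have s: "set \<sigma> \<subseteq> ball 0 1"
    using roots root by (auto simp: Pn)
  have Qz: "poly Q z = cnj c * poly (blaschke_den \<sigma>) z" if "z \<noteq> 0" for z
    using Q[OF that] blaschke_num_den_reflect(1)[OF that, of \<sigma>] by (simp add: Pn len mult_ac)
  have "Q = smult (cnj c) (blaschke_den \<sigma>)"
  proof (rule ccontr)
    assume "Q \<noteq> smult (cnj c) (blaschke_den \<sigma>)"
    then have "finite {z. poly (Q - smult (cnj c) (blaschke_den \<sigma>)) z = 0}"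
      by (intro poly_roots_finite) simp
    moreover have "UNIV - {0} \<subseteq> {z. poly (Q - smult (cnj c) (blaschke_den \<sigma>)) z = 0}"
      using Qz by auto
    ultimately have "finite (UNIV - {0::complex})" by (rule finite_subset[rotated])
    then show False using infinite_UNIV_char_0[where 'a = complex] by simp
  qed
  then have "poly P z / poly Q z = (c / cnj c) * blaschke \<sigma> z" for z
    by (simp add: Pn blaschke_eq_num_den)
  moreover have "norm (c / cnj c) = 1" using c0 by (simp add: norm_divide)
  ultimately show ?thesis
    unfolding is_blaschke_def using s len
    by (intro bexI[of _ \<sigma>] exI[of _ "c / cnj c"]) (auto simp: disc_tuples_def)
qed

lemma degree_blaschke_den: "degree (blaschke_den \<sigma>) \<le> length \<sigma>"
proof (induction \<sigma>)
  case (Cons a \<sigma>)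
  have "degree (blaschke_den (a # \<sigma>)) \<le> degree [:1, - cnj a:] + degree (blaschke_den \<sigma>)"
    by (simp only: blaschke_den_simps degree_mult_le)
  then show ?case using Cons degree_pCons_le[of 1 "[:- cnj a:]"] by simp
qed simp

lemma degree_blaschke_num: "degree (blaschke_num \<sigma>) = length \<sigma>" "lead_coeff (blaschke_num \<sigma>) = 1"
proof -
  have "blaschke_num \<sigma> \<noteq> 0 \<and> degree (blaschke_num \<sigma>) = length \<sigma> \<and> lead_coeff (blaschke_num \<sigma>) = 1"
  proof (induction \<sigma>)
    case (Cons a \<sigma>)
    then have "degree ([:- a, 1:] * blaschke_num \<sigma>) = Suc (length \<sigma>)"
      by (subst degree_mult_eq) auto
    moreover have "lead_coeff ([:- a, 1:] * blaschke_num \<sigma>) = 1"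
    proof -
      have "lead_coeff [:- a, 1:] = 1" by simp
      then show ?thesis using Cons by (metis lead_coeff_mult mult_1)
    qed
    ultimately show ?case by (metis blaschke_num_simps(2) leading_coeff_0_iff length_Cons zero_neq_one)
  qed simp
  then show "degree (blaschke_num \<sigma>) = length \<sigma>" "lead_coeff (blaschke_num \<sigma>) = 1" by blast+
qed

lemma coeff_blaschke_den_le:
  assumes "set \<sigma> \<subseteq> ball 0 1"
  shows "norm (coeff (blaschke_den \<sigma>) (length \<sigma>)) \<le> 1"
  using assms
proof (induction \<sigma>)
  case (Cons a \<sigma>)
  have "coeff (blaschke_den \<sigma>) (Suc (length \<sigma>)) = 0"
    using degree_blaschke_den[of \<sigma>] by (intro coeff_eq_0) simp
  then have "coeff (blaschke_den (a # \<sigma>)) (length (a # \<sigma>)) = - cnj a * coeff (blaschke_den \<sigma>) (length \<sigma>)"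
    by simp
  moreover have "norm (- cnj a) * norm (coeff (blaschke_den \<sigma>) (length \<sigma>)) \<le> 1"
    using Cons by (intro mult_le_one) auto
  ultimately show ?case by (metis norm_mult)
qed simp

text \<open>The numerator of the transformed function has no root outside the disc since there the numerator of \<open>f\<close> dominates
its denominator in modulus and \<open>\<bar>a\<bar> < 1\<close>.\<close>

lemma is_blaschke_moebius:
  assumes f: "is_blaschke N f" and a: "norm a < 1"
  shows "is_blaschke N (\<lambda>z. (a + f z) / (1 + cnj a * f z))"
proof -
  obtain \<sigma> c where \<sigma>: "\<sigma> \<in> disc_tuples N" and c: "norm c = 1" and f: "\<And>z. z \<in> ball 0 1 \<Longrightarrow> f z = c * blaschke \<sigma> z"
    using f unfolding is_blaschke_def by blast
  note len = disc_tuplesD(1)[OF \<sigma>] and s = disc_tuplesD(2)[OF \<sigma>]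
  define P where "P = smult c (blaschke_num \<sigma>) + smult a (blaschke_den \<sigma>)"
  define Q where "Q = smult (cnj c) (blaschke_den \<sigma>) + smult (cnj a) (blaschke_num \<sigma>)"
  have cc: "c * cnj c = 1" using c by (simp add: complex_norm_square[symmetric])
  have c0: "c \<noteq> 0" using c by auto
  have "coeff P N = c + a * coeff (blaschke_den \<sigma>) N"
    using degree_blaschke_num[of \<sigma>] by (simp add: P_def len)
  moreover have "norm (a * coeff (blaschke_den \<sigma>) N) < 1"
  proof -
    have "norm a * norm (coeff (blaschke_den \<sigma>) N) \<le> norm a"
      using coeff_blaschke_den_le[OF s] by (simp add: mult_left_le len)
    then show ?thesis using a by (simp add: norm_mult)
  qed
  ultimately have cN: "coeff P N \<noteq> 0"
    using c by (metis add_eq_0_iff less_irrefl norm_minus_cancel)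
  have "degree P \<le> N"
    unfolding P_def using degree_blaschke_num[of \<sigma>] degree_blaschke_den[of \<sigma>] len
    by (intro degree_add_le order_trans[OF degree_smult_le]) auto
  then have deg: "degree P = N" using le_degree[OF cN] by simp
  have "is_blaschke N (\<lambda>z. poly P z / poly Q z)"
  proof (rule is_blaschke_reflected_quotient)
    show "P \<noteq> 0" using cN by auto
    fix z
    show "norm z < 1" if "poly P z = 0"
    proof (rule ccontr)
      assume "\<not> norm z < 1"
      then have z: "1 \<le> norm z" by simp
      note out = blaschke_num_outside_disc[OF s z]
      have "c * poly (blaschke_num \<sigma>) z = - (a * poly (blaschke_den \<sigma>) z)"
        using that by (simp add: P_def eq_neg_iff_add_eq_0)
      then have "norm (poly (blaschke_num \<sigma>) z) = norm a * norm (poly (blaschke_den \<sigma>) z)"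
        using c by (metis mult_1 norm_minus_cancel norm_mult)
      also have "\<dots> \<le> norm a * norm (poly (blaschke_num \<sigma>) z)"
        using out by (intro mult_left_mono) auto
      also have "\<dots> < 1 * norm (poly (blaschke_num \<sigma>) z)"
        using out a by (intro mult_strict_right_mono) auto
      finally show False by simp
    qed
    assume z: "z \<noteq> 0"
    have "z ^ N * cnj (poly P (1 / cnj z)) = cnj c * (z ^ length \<sigma> * cnj (poly (blaschke_num \<sigma>) (1 / cnj z)))
        + cnj a * (z ^ length \<sigma> * cnj (poly (blaschke_den \<sigma>) (1 / cnj z)))"
      by (simp add: P_def len algebra_simps)
    then show "poly Q z = z ^ N * cnj (poly P (1 / cnj z))"
      by (simp only: blaschke_num_den_reflect[OF z]) (simp add: Q_def)
  qed (fact deg)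
  then have "is_blaschke N (\<lambda>z. cnj c * (poly P z / poly Q z))"
    by (rule is_blaschke_cmult) (use c in simp)
  then show ?thesis
  proof (rule is_blaschke_cong)
    fix z :: complex assume z: "norm z < 1"
    define X Y where "X = poly (blaschke_num \<sigma>) z" and "Y = poly (blaschke_den \<sigma>) z"
    have Y: "Y \<noteq> 0" unfolding Y_def using blaschke_den_nonzero[OF s, of z] z by simp
    have fz: "f z = c * X / Y" using f z by (simp add: blaschke_eq_num_den X_def Y_def)
    have "(a + f z) / (1 + cnj a * f z) = (a * Y + c * X) / (Y + cnj a * c * X)"
    proof -
      have "a + f z = (a * Y + c * X) / Y" "1 + cnj a * f z = (Y + cnj a * c * X) / Y"
        using Y by (simp_all add: fz field_simps)
      then show ?thesis using Y by simp
    qed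
    also have "\<dots> = cnj c * (a * Y + c * X) / (cnj c * (Y + cnj a * c * X))"
      using c0 by simp
    also have "cnj c * (Y + cnj a * c * X) = cnj c * Y + cnj a * (c * cnj c) * X"
      by (simp add: algebra_simps)
    also have "\<dots> = poly Q z" by (simp add: cc Q_def X_def Y_def)
    also have "a * Y + c * X = poly P z" by (simp add: P_def X_def Y_def)
    finally show "(a + f z) / (1 + cnj a * f z) = cnj c * (poly P z / poly Q z)" by simp
  qed
qed

lemma is_blaschke_power_factor:
  assumes a: "norm a < 1" and n: "1 \<le> n"
  shows "is_blaschke n (\<lambda>z. (z ^ n - a) / (1 - cnj a * z ^ n))"
proof -
  define P where "P = monom 1 n - [:a:]"
  define Q where "Q = 1 - monom (cnj a) n"
  have cn: "coeff P n = 1" using n by (cases n) (auto simp: P_def)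
  have "degree P \<le> n" unfolding P_def by (intro degree_diff_le degree_monom_le) auto
  then have deg: "degree P = n" using cn le_degree[of P n] by simp
  have "is_blaschke n (\<lambda>z. poly P z / poly Q z)"
  proof (rule is_blaschke_reflected_quotient)
    show "P \<noteq> 0" using cn by auto
    fix z
    show "norm z < 1" if "poly P z = 0"
    proof -
      have "norm z ^ n < 1" using that a by (simp add: P_def poly_monom norm_power[symmetric])
      then show ?thesis using n by (simp add: power_less_one_iff)
    qed
    assume z: "z \<noteq> 0"
    show "poly Q z = z ^ n * cnj (poly P (1 / cnj z))"
      using z by (simp add: P_def Q_def poly_monom field_simps)
  qed (fact deg)
  then show ?thesis
    by (rule is_blaschke_cong) (simp add: P_def Q_def poly_monom)
qed

lemma is_blaschke_compose_power:
  assumes f: "is_blaschke N f" and n: "1 \<le> n"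
  shows "is_blaschke (n * N) (\<lambda>z. f (z ^ n))"
proof -
  obtain \<sigma> c where \<sigma>: "\<sigma> \<in> disc_tuples N" and c: "norm c = 1" and f: "\<And>z. z \<in> ball 0 1 \<Longrightarrow> f z = c * blaschke \<sigma> z"
    using f unfolding is_blaschke_def by blast
  have "is_blaschke (n * length \<tau>) (\<lambda>z. blaschke \<tau> (z ^ n))" if "set \<tau> \<subseteq> ball 0 1" for \<tau>
    using that
  proof (induction \<tau>)
    case Nil
    then show ?case by (simp add: is_blaschke_const)
  next
    case (Cons a \<tau>)
    then have "is_blaschke (n + n * length \<tau>) (\<lambda>z. (z ^ n - a) / (1 - cnj a * z ^ n) * blaschke \<tau> (z ^ n))"
      by (intro is_blaschke_mult is_blaschke_power_factor n) auto
    then show ?case by (simp add: blaschke_Cons)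
  qed
  from is_blaschke_cmult[OF this[OF disc_tuplesD(2)[OF \<sigma>]] c]
  have "is_blaschke (n * N) (\<lambda>z. c * blaschke \<sigma> (z ^ n))" by (simp add: disc_tuplesD(1)[OF \<sigma>])
  then show ?thesis
    by (rule is_blaschke_cong) (use n in \<open>auto simp: f norm_power power_less_one_iff\<close>)
qed

section \<open>Products with separated zeros\<close>

definition power_factor :: "nat \<Rightarrow> real \<Rightarrow> complex \<Rightarrow> complex" where
  "power_factor n r z = (z ^ n - of_real r) / (1 - of_real r * z ^ n)"

lemma is_blaschke_power_factor_real:
  assumes "0 \<le> r" "r < 1" "1 \<le> n"
  shows "is_blaschke n (power_factor n r)"
  using is_blaschke_power_factor[of "of_real r" n] assms by (simp add: power_factor_def[abs_def])

text \<open>The pseudohyperbolic distance is at least that of the moduli, and for moduli \<open>x \<le> y\<close> the latter is bounded below in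
terms of the ratio \<open>(1 - y) / (1 - x)\<close> alone.\<close>

lemma moebius_norm_ge:
  fixes w :: complex and r :: real
  assumes w: "norm w < 1" and r: "0 \<le> r" "r < 1"
  shows "norm w \<le> r \<Longrightarrow> 1 - 2 * (1 - r) / (1 - norm w) \<le> norm ((w - of_real r) / (1 - of_real r * w))"
    and "r \<le> norm w \<Longrightarrow> 1 - 2 * (1 - norm w) / (1 - r) \<le> norm ((w - of_real r) / (1 - of_real r * w))"
proof -
  define t where "t = norm w"
  define D where "D = norm (1 - of_real r * w)"
  define b where "b = norm ((w - of_real r) / (1 - of_real r * w))"
  have t: "0 \<le> t" "t < 1" using w by (auto simp: t_def)
  have rt: "r * t < 1" using r t mult_strict_mono[of r 1 t 1] by auto
  have D: "1 - r * t \<le> D"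
    unfolding D_def t_def using norm_triangle_ineq2[of 1 "of_real r * w"] r by (simp add: norm_mult)
  have D0: "0 < D" using D rt by linarith
  have id: "D\<^sup>2 - norm (w - of_real r) ^ 2 = (1 - r ^ 2) * (1 - t ^ 2)"
    using moebius_norm_identity[of "of_real r" w] r by (simp add: D_def t_def)
  have sq: "(1 - r ^ 2) * (1 - t ^ 2) = (1 - r * t) ^ 2 - (r - t) ^ 2"
    by (simp add: power2_eq_square algebra_simps)
  have "b = norm (w - of_real r) / D" by (simp add: b_def D_def norm_divide)
  \<comment> \<open>The norm identity shows that the square of the pseudohyperbolic distance increases with \<open>D\<close>.\<close>
  then have "b ^ 2 = 1 - (1 - r ^ 2) * (1 - t ^ 2) / D ^ 2"
    using D0 by (simp add: id[symmetric] power_divide diff_divide_distrib)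
  also have "\<dots> \<ge> 1 - (1 - r ^ 2) * (1 - t ^ 2) / (1 - r * t) ^ 2"
    using D rt r t by (intro diff_left_mono divide_left_mono power_mono mult_nonneg_nonneg mult_pos_pos)
      (auto simp: abs_square_le_1 intro!: zero_less_power D0)
  also have "1 - (1 - r ^ 2) * (1 - t ^ 2) / (1 - r * t) ^ 2 = (\<bar>r - t\<bar> / (1 - r * t)) ^ 2"
    using rt by (simp add: sq power_divide diff_divide_distrib)
  finally have "\<bar>r - t\<bar> / (1 - r * t) \<le> b"
    by (rule power2_le_imp_le) (simp add: b_def)
  moreover have "1 - 2 * (1 - y) / (1 - x) \<le> (y - x) / (1 - y * x)" if "0 \<le> x" "x \<le> y" "y < 1" for x y :: real
  proof -
    have xy: "0 < 1 - y * x" using that mult_strict_mono'[of y 1 x 1] by auto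
    have "y * x \<le> x" using that by (simp add: mult_left_le_one_le)
    have "1 - (y - x) / (1 - y * x) = (1 - y) * (1 + x) / (1 - y * x)"
      using xy by (simp add: field_simps)
    also have "\<dots> \<le> (1 - y) * 2 / (1 - x)"
      using that \<open>y * x \<le> x\<close> by (intro frac_le mult_left_mono mult_nonneg_nonneg) auto
    finally show ?thesis by (simp add: mult.commute)
  qed
  note this[of t r] this[of r t]
  ultimately show "norm w \<le> r \<Longrightarrow> 1 - 2 * (1 - r) / (1 - norm w) \<le> norm ((w - of_real r) / (1 - of_real r * w))"
    and "r \<le> norm w \<Longrightarrow> 1 - 2 * (1 - norm w) / (1 - r) \<le> norm ((w - of_real r) / (1 - of_real r * w))"
    unfolding t_def[symmetric] b_def[symmetric] using r t by (auto simp: mult.commute)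
qed

text \<open>Weierstrass' product inequality.\<close>

lemma prod_ge_one_minus_sum:
  fixes y d :: "'a \<Rightarrow> real"
  assumes "finite S" "\<And>j. j \<in> S \<Longrightarrow> 0 \<le> y j" "\<And>j. j \<in> S \<Longrightarrow> y j \<le> 1" "\<And>j. j \<in> S \<Longrightarrow> 1 - d j \<le> y j"
  shows "1 - (\<Sum>j\<in>S. d j) \<le> (\<Prod>j\<in>S. y j)"
  using assms
proof (induction S rule: finite_induct)
  case (insert j S)
  have P: "0 \<le> (\<Prod>j\<in>S. y j)" "(\<Prod>j\<in>S. y j) \<le> 1"
    using insert.prems by (auto intro!: prod_nonneg prod_le_1)
  have "(1 - y j) * (\<Prod>j\<in>S. y j) \<le> (1 - y j) * 1"
    using P insert.prems by (intro mult_left_mono) auto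
  moreover have "1 - (\<Sum>j\<in>S. d j) \<le> (\<Prod>j\<in>S. y j)" using insert by auto
  moreover have "1 - d j \<le> y j" using insert by auto
  ultimately show ?case using insert.hyps by (simp add: algebra_simps)
qed simp

lemma sum_geometric_distance_le:
  fixes x :: real
  assumes "0 \<le> x" "x < 1"
  shows "(\<Sum>j\<in>{..<K} - {k}. x ^ (if j < k then k - j else j - k)) \<le> 2 * x / (1 - x)"
proof -
  have geo: "(\<Sum>i<m. x ^ Suc i) \<le> x / (1 - x)" for m
  proof -
    have "(\<Sum>i<m. x ^ Suc i) = x * (\<Sum>i<m. x ^ i)" by (simp add: sum_distrib_left)
    also have "(\<Sum>i<m. x ^ i) = (1 - x ^ m) / (1 - x)"
      using one_diff_power_eq[of x m] assms by (simp add: field_simps)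
    also have "x * ((1 - x ^ m) / (1 - x)) \<le> x * (1 / (1 - x))"
      using assms by (intro mult_left_mono divide_right_mono) auto
    finally show ?thesis by simp
  qed
  have "(\<Sum>j\<in>{..<K} - {k}. x ^ (if j < k then k - j else j - k))
      \<le> (\<Sum>j\<in>{..<k} \<union> {Suc k..<Suc k + K}. x ^ (if j < k then k - j else j - k))"
    using assms by (intro sum_mono2) auto
  also have "\<dots> = (\<Sum>j<k. x ^ (if j < k then k - j else j - k)) + (\<Sum>j=Suc k..<Suc k + K. x ^ (if j < k then k - j else j - k))"
    by (intro sum.union_disjoint) auto
  also have "(\<Sum>j<k. x ^ (if j < k then k - j else j - k)) = (\<Sum>i<k. x ^ Suc i)"
    by (rule sum.reindex_bij_witness[of _ "\<lambda>i. k - Suc i" "\<lambda>j. k - Suc j"]) (auto simp: Suc_diff_Suc)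
  also have "(\<Sum>j=Suc k..<Suc k + K. x ^ (if j < k then k - j else j - k)) = (\<Sum>i<K. x ^ Suc i)"
    by (rule sum.reindex_bij_witness[of _ "\<lambda>i. i + Suc k" "\<lambda>j. j - Suc k"]) (auto simp: Suc_diff_Suc)
  finally show ?thesis using geo[of k] geo[of K] by simp
qed

text \<open>At a zero of one factor, the derivative of the product is the derivative of this factor times the other factors, and
these have a product of modulus at least \<open>1/2\<close> when the zeros are separated.\<close>

lemma norm_deriv_product_ge:
  fixes K k :: nat
  assumes r: "\<And>j. j < K \<Longrightarrow> 0 \<le> r j \<and> r j < 1" and n: "\<And>j. j < K \<Longrightarrow> 1 \<le> n j" and k: "k < K"
    and z: "norm z < 1" "z ^ n k = of_real (r k)"
    and d: "\<And>j. j < K \<Longrightarrow> j \<noteq> k \<Longrightarrow> 1 - d j \<le> norm (power_factor (n j) (r j) z)"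
    and sum: "(\<Sum>j\<in>{..<K} - {k}. d j) \<le> 1 / 2"
  shows "n k * norm z ^ (n k - 1) / (2 * (1 - r k ^ 2))
       \<le> norm (deriv (\<lambda>z. \<Prod>j<K. power_factor (n j) (r j) z) z)"
proof -
  define H where "H w = (\<Prod>j\<in>{..<K} - {k}. power_factor (n j) (r j) w)" for w
  have blj: "is_blaschke (n j) (power_factor (n j) (r j))" if "j < K" for j
    using r n that by (intro is_blaschke_power_factor_real) auto
  have "1 - (\<Sum>j\<in>{..<K} - {k}. d j) \<le> (\<Prod>j\<in>{..<K} - {k}. norm (power_factor (n j) (r j) z))"
    using d is_blaschke_norm_le_1[OF blj z(1)] by (intro prod_ge_one_minus_sum) auto
  then have H: "1 / 2 \<le> norm (H z)" using sum by (simp add: H_def prod_norm)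
  have "H holomorphic_on ball 0 1"
    unfolding H_def by (intro holomorphic_intros is_blaschke_holomorphic[OF blj]) auto
  then have derH: "(H has_field_derivative deriv H z) (at z)"
    by (rule holomorphic_derivI) (use z in auto)
  have split: "(\<lambda>z. \<Prod>j<K. power_factor (n j) (r j) z) = (\<lambda>z. power_factor (n k) (r k) z * H z)"
    unfolding H_def using k by (intro ext prod.remove) auto
  have rk: "0 \<le> r k" "r k < 1" using r[OF k] by auto
  then have rk2: "r k ^ 2 < 1" by (simp add: abs_square_less_1)
  have nz: "1 - of_real (r k) * z ^ n k \<noteq> 0"
    unfolding z(2) using rk2 by (metis eq_iff_diff_eq_0 less_irrefl of_real_1 of_real_eq_iff of_real_mult power2_eq_square)
  define g where "g = of_nat (n k) * z ^ (n k - 1) / of_real (1 - r k ^ 2)"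
  have "((\<lambda>w. w ^ n k) has_field_derivative of_nat (n k) * z ^ (n k - 1)) (at z)"
    by (rule derivative_eq_intros refl | simp)+
  moreover have "((\<lambda>w. (w - of_real (r k)) / (1 - cnj (of_real (r k)) * w)) has_field_derivative
       (1 - norm (complex_of_real (r k)) ^ 2) / (1 - cnj (of_real (r k)) * z ^ n k) ^ 2) (at (z ^ n k))"
    by (rule moebius_has_derivative) (use rk z in auto)
  ultimately have "((\<lambda>w. (w ^ n k - of_real (r k)) / (1 - cnj (of_real (r k)) * w ^ n k)) has_field_derivative
       (1 - norm (complex_of_real (r k)) ^ 2) / (1 - cnj (of_real (r k)) * z ^ n k) ^ 2 * (of_nat (n k) * z ^ (n k - 1))) (at z)"
    by (rule DERIV_chain2[rotated])
  moreover have "(1 - norm (complex_of_real (r k)) ^ 2) / (1 - cnj (of_real (r k)) * z ^ n k) ^ 2 * (of_nat (n k) * z ^ (n k - 1)) = g"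
  proof -
    have "complex_of_real (1 - r k ^ 2) \<noteq> 0" using rk2 by (simp only: of_real_eq_0_iff)
    moreover have "complex_of_real (1 - norm (complex_of_real (r k)) ^ 2) = of_real (1 - r k ^ 2)"
      "1 - cnj (of_real (r k)) * of_real (r k) = complex_of_real (1 - r k ^ 2)"
      by (simp_all add: power2_eq_square)
    moreover have "c / c ^ 2 * X = X / c" if "c \<noteq> 0" for c X :: complex
      using that by (simp add: power2_eq_square)
    ultimately show ?thesis
      unfolding z(2) g_def by (simp only:)
  qed
  ultimately have "(power_factor (n k) (r k) has_field_derivative g) (at z)"
    by (simp add: power_factor_def[abs_def])
  then have "((\<lambda>z. power_factor (n k) (r k) z * H z) has_field_derivative
      power_factor (n k) (r k) z * deriv H z + g * H z) (at z)"
    by (intro DERIV_mult' derH)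
  then have "deriv (\<lambda>z. \<Prod>j<K. power_factor (n j) (r j) z) z = g * H z"
    unfolding split by (simp add: DERIV_imp_deriv power_factor_def z(2))
  moreover have "norm g = n k * norm z ^ (n k - 1) / (1 - r k ^ 2)"
    unfolding g_def norm_divide norm_mult norm_power norm_of_real using rk2 by simp
  moreover have "norm g * (1/2) \<le> norm g * norm (H z)" using H by (intro mult_left_mono) auto
  ultimately show ?thesis by (simp add: norm_mult mult.commute)
qed

section \<open>Blaschke products active on many scales\<close>

text \<open>The value at the origin is a part of the norm, so it suffices that the product of the moduli of the zeros is at least \<open>1/2\<close>.\<close>

lemma growth_attained_const: "growth_attained p q (\<lambda>N. 1)"
proof (rule growth_attainedI[where c = "1/2" and n = "\<lambda>K. K" and ?K0.0 = 2])
  fix K :: nat assume K: "2 \<le> K"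
  define x where "x = 1 - 1 / (2 * real K)"
  have x: "0 \<le> x" "x < 1" using K by (auto simp: x_def field_simps)
  define \<sigma> where "\<sigma> = replicate K (complex_of_real x)"
  have \<sigma>: "\<sigma> \<in> disc_tuples K" using x by (auto simp: \<sigma>_def disc_tuples_def)
  then have bl: "is_blaschke K (blaschke \<sigma>)"
    unfolding is_blaschke_def by (intro bexI[of _ \<sigma>] exI[of _ 1]) auto
  have "blaschke \<sigma> 0 = (- of_real x) ^ K"
    by (simp add: blaschke_def \<sigma>_def prod_list_replicate)
  then have "norm (blaschke \<sigma> 0) = x ^ K" using x by (simp add: norm_power)
  moreover have "1 + real K * (- 1 / (2 * real K)) \<le> (1 + (- 1 / (2 * real K))) ^ K"
    using K by (intro Bernoulli_inequality) (simp add: field_simps)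
  then have "1 / 2 \<le> x ^ K" using K by (simp add: x_def)
  ultimately have "ennreal (1/2 * 1) \<le> ennreal (norm (blaschke \<sigma> 0))" by (intro ennreal_leI) simp
  also have "\<dots> \<le> besov_norm p q (blaschke \<sigma>)" by (simp add: besov_norm_def)
  finally show "\<exists>f. is_blaschke K f \<and> ennreal (1/2 * 1) \<le> besov_norm p q f" using bl by blast
qed (auto simp: strict_mono_def)

lemma besov_norm_ge_of_seminorm:
  assumes "ennreal X \<le> besov_seminorm p q f" "Y \<le> X"
  shows "ennreal Y \<le> besov_norm p q f"
  using order_trans[OF ennreal_leI[OF assms(2)] assms(1)] by (simp add: besov_norm_def add_increasing)

text \<open>The zeros \<open>1 - 16\<^bsup>-j\<^esup>\<close> lie on one radius, one on each scale. At the \<open>k\<close>-th zero the \<open>j\<close>-th factor has modulus at least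
\<open>1 - 2 \<cdot> 16\<^bsup>-\<bar>j - k\<bar>\<^esup>\<close>, so the derivative there has the maximal order, and it bounds the maximum on
all larger circles.\<close>

lemma growth_attained_sup_norm:
  assumes q: "1 \<le> Q" "q = ennreal Q" "enn2real q = Q" "recip q = 1 / Q"
  shows "growth_attained \<infinity> q (\<lambda>N. real N powr recip q)"
proof (rule growth_attainedI[where c = "1/16" and n = "\<lambda>K. K" and ?K0.0 = 2])
  fix K :: nat assume K: "2 \<le> K"
  define u where "u i = (1/16 :: real) ^ i" for i :: nat
  define r where "r i = 1 - u i" for i
  define f where "f z = (\<Prod>j<K. power_factor 1 (r j) z)" for z
  have u: "0 < u i" "u i \<le> 1" "u (Suc i) \<le> u i / 2" for i
    by (auto simp: u_def power_le_one)
  have r: "0 \<le> r i" "r i < 1" for i using u[of i] by (auto simp: r_def)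
  have nr: "norm (complex_of_real (r i)) = r i" for i using r(1)[of i] by simp
  have ur: "1 - r i = u i" for i by (simp add: r_def)
  have bl: "is_blaschke K f"
    using is_blaschke_prod[of K "\<lambda>_. 1" "\<lambda>j. power_factor 1 (r j)"] r
    by (simp add: f_def[abs_def] is_blaschke_power_factor_real)
  have der: "1 / (4 * u k) \<le> norm (deriv f (of_real (r k)))" if k: "k < K" for k
  proof -
    have "1 - 2 * (1/16) ^ (if j < k then k - j else j - k) \<le> norm (power_factor 1 (r j) (of_real (r k)))"
      if "j \<noteq> k" for j
    proof (cases "j < k")
      case True
      have ujk: "u k = u j * (1/16) ^ (k - j)" using True by (simp add: u_def flip: power_add)
      have "r j \<le> r k" using ujk u(1)[of j] by (simp add: r_def mult_left_le power_le_one)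
      then have "1 - 2 * u k / u j \<le> norm (power_factor 1 (r j) (of_real (r k)))"
        using moebius_norm_ge(2)[of "of_real (r k)" "r j", unfolded nr] r[of k] r[of j]
        by (simp add: power_factor_def ur)
      then show ?thesis using True u(1)[of j] by (simp add: ujk)
    next
      case False
      then have jk: "k < j" using that by simp
      have ukj: "u j = u k * (1/16) ^ (j - k)" using jk by (simp add: u_def flip: power_add)
      have "r k \<le> r j" using ukj u(1)[of k] by (simp add: r_def mult_left_le power_le_one)
      then have "1 - 2 * u j / u k \<le> norm (power_factor 1 (r j) (of_real (r k)))"
        using moebius_norm_ge(1)[of "of_real (r k)" "r j", unfolded nr] r[of k] r[of j]
        by (simp add: power_factor_def ur)
      then show ?thesis using jk u(1)[of k] by (simp add: ukj)
    qed
    moreover have "(\<Sum>j\<in>{..<K} - {k}. 2 * (1/16::real) ^ (if j < k then k - j else j - k)) \<le> 1 / 2"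
      using sum_geometric_distance_le[of "1/16" k K] by (simp add: sum_distrib_left[symmetric])
    ultimately have "real 1 * norm (complex_of_real (r k)) ^ (1 - 1) / (2 * (1 - r k ^ 2))
       \<le> norm (deriv (\<lambda>z. \<Prod>j<K. power_factor 1 (r j) z) (of_real (r k)))"
      by (intro norm_deriv_product_ge[where d = "\<lambda>j. 2 * (1/16) ^ (if j < k then k - j else j - k)"])
         (use r k in auto)
    moreover have "1 / (4 * u k) \<le> 1 / (2 * (1 - r k ^ 2))"
    proof (rule divide_left_mono)
      have "1 - r k ^ 2 = u k * (1 + r k)" by (simp add: r_def power2_eq_square algebra_simps)
      also have "\<dots> \<le> u k * 2" using u(1)[of k] r(2)[of k] by (intro mult_left_mono) auto
      finally show "2 * (1 - r k ^ 2) \<le> 4 * u k" by simp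
      have "r k ^ 2 < 1" using r[of k] by (simp add: abs_square_less_1)
      then show "0 < 4 * u k * (2 * (1 - r k ^ 2))" using u(1)[of k] by simp
    qed simp
    ultimately show ?thesis by (simp add: f_def[abs_def])
  qed
  have hol: "deriv f holomorphic_on ball 0 1"
    by (intro holomorphic_deriv is_blaschke_holomorphic[OF bl]) auto
  have "ennreal ((real K * (1/8) powr Q / 2) powr (1 / Q)) \<le> besov_seminorm \<infinity> q f"
  proof (rule besov_seminorm_ge[OF q, where u = u])
    fix i \<rho> assume i: "i < K" and \<rho>: "1 - u i < \<rho>" "\<rho> < 1 - u i / 2"
    have \<rho>1: "0 < \<rho>" "\<rho> < 1" using \<rho> u[of i] by linarith+
    have "(1/8) / (1 - \<rho>) \<le> (1/8) / (u i / 2)"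
      using \<rho> u(1)[of i] by (intro divide_left_mono) auto
    also have "\<dots> = 1 / (4 * u i)" by simp
    also have "\<dots> \<le> norm (deriv f (of_real (r i)))" by (rule der[OF i])
    finally have "ennreal ((1/8) / (1 - \<rho>)) \<le> ennreal (norm (deriv f (of_real \<rho> * of_real (r i / \<rho>))))"
      using \<rho>1 by (intro ennreal_leI) simp
    also have "\<dots> \<le> circle_norm \<infinity> (deriv f) \<rho>"
    proof (rule sup_norm_ge[OF hol])
      have "r i < \<rho>" using \<rho> by (simp add: r_def)
      then show "norm (complex_of_real (r i / \<rho>)) < 1" using r(1)[of i] \<rho>1 by (simp add: norm_divide)
    qed (use \<rho>1 in auto)
    finally show "ennreal ((1/8) / (1 - \<rho>)) \<le> circle_norm \<infinity> (deriv f) \<rho>" .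
  qed (use u in auto)
  moreover have "1/16 * real K powr (1 / Q) \<le> (real K * (1/8) powr Q / 2) powr (1 / Q)"
  proof -
    have "(1/2) powr 1 \<le> (1/2) powr (1 / Q)" using q by (intro powr_mono') auto
    then have "1/16 * real K powr (1 / Q) \<le> (1/2) powr (1 / Q) * (1/8) * real K powr (1 / Q)"
      by (intro mult_right_mono) auto
    also have "\<dots> = (real K * (1/8) powr Q / 2) powr (1 / Q)"
      using q by (simp add: powr_mult powr_divide powr_powr)
    finally show ?thesis .
  qed
  ultimately have "ennreal (1/16 * real K powr recip q) \<le> besov_norm \<infinity> q f"
    unfolding q(4) by (rule besov_norm_ge_of_seminorm)
  then show "\<exists>f. is_blaschke K f \<and> ennreal (1/16 * real K powr recip q) \<le> besov_norm \<infinity> q f"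
    using bl by blast
qed (auto simp: strict_mono_def)

text \<open>From \<open>y (2 - y) \<le> 1\<close> and Bernoulli\'s inequality for \<open>(2 - y)\<^sup>m\<close>.\<close>

lemma one_minus_ratio_le:
  fixes y :: real
  assumes "0 \<le> y" "y < 1" "1 \<le> m"
  shows "(1 - y) / (1 - y ^ m) \<le> 1 / m + (1 - y)"
proof -
  have ym: "y ^ m < 1" using assms by (simp add: power_less_one_iff)
  have m: "0 < real m" using assms by simp
  have "1 + real m * (1 - y) \<le> (1 + (1 - y)) ^ m"
    using assms by (intro Bernoulli_inequality) auto
  then have "y ^ m * (1 + real m * (1 - y)) \<le> y ^ m * (2 - y) ^ m"
    using assms by (intro mult_left_mono) auto
  also have "\<dots> = (1 - (1 - y) ^ 2) ^ m"
    by (simp add: power_mult_distrib[symmetric] power2_eq_square algebra_simps)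
  also have "\<dots> \<le> 1"
    using assms by (intro power_le_one) (auto simp: abs_square_le_1)
  finally have "real m * (1 - y) \<le> (1 + real m * (1 - y)) * (1 - y ^ m)"
    by (simp add: algebra_simps)
  then show ?thesis
    using ym m by (simp add: field_simps)
qed

lemma one_minus_le_power:
  fixes x :: real
  assumes "0 \<le> x" "x \<le> 1"
  shows "1 - real n * (1 - x) \<le> x ^ n"
  using Bernoulli_inequality[of "x - 1" n] assms by (simp add: algebra_simps)

text \<open>The factor with \<open>n = 16\<^sup>k\<close> has \<open>n\<close> equidistributed zeros at distance about \<open>e / n\<close> from the circle. At such a zero the
\<open>j\<close>-th factor differs in modulus from \<open>1\<close> by at most \<open>2 \<cdot> 16\<^bsup>-\<bar>j - k\<bar>\<^esup> + 2 e\<close>. The second term is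
summed over \<open>K\<close> factors, which forces \<open>e\<close> to be of order \<open>1/K\<close>; the means then are of order \<open>e\<^bsup>1/p\<^esup>\<close>.\<close>

lemma growth_attained_large_p:
  assumes p: "1 \<le> P" "p = ennreal P" "recip p = 1 / P"
    and q: "1 \<le> Q" "q = ennreal Q" "enn2real q = Q" "recip q = 1 / Q" and le: "Q \<le> P"
  shows "growth_attained p q (\<lambda>N. ln (real N) powr (recip q - recip p))"
proof (rule growth_attainedI[where c = "1/12288" and n = "\<lambda>K. \<Sum>j<K. 16 ^ j" and ?K0.0 = 2])
  show "strict_mono (\<lambda>K. \<Sum>j<K. 16 ^ j :: nat)" by (auto simp: strict_mono_Suc_iff)
  fix K :: nat assume K: "2 \<le> K"
  have "(\<Sum>j<2. 16 ^ j :: nat) \<le> (\<Sum>j<K. 16 ^ j)" using K by (intro sum_mono2) auto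
  then show N2: "2 \<le> (\<Sum>j<K. 16 ^ j :: nat)" by (simp add: eval_nat_numeral)
  define N where "N = (\<Sum>j<K. 16 ^ j :: nat)"
  define e where "e = 1 / (16 * real K)"
  define r where "r = 1 - e"
  define n where "n j = (16::nat) ^ j" for j :: nat
  define f where "f z = (\<Prod>j<K. power_factor (n j) r z)" for z
  have e: "0 < e" "e \<le> 1/32" using K by (auto simp: e_def field_simps)
  have r: "0 \<le> r" "r < 1" "1/2 \<le> r" using e by (auto simp: r_def)
  have n: "1 \<le> n j" for j by (simp add: n_def)
  have bl: "is_blaschke N f"
    using is_blaschke_prod[of K n "\<lambda>j. power_factor (n j) r"] r n
    by (simp add: f_def[abs_def] N_def n_def is_blaschke_power_factor_real)
  have der: "n k / (8 * e) \<le> norm (deriv f z)" if k: "k < K" and z: "z ^ n k = of_real r" for k z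
  proof -
    define t where "t j = norm z ^ n j" for j
    have tk: "t k = r" using z r by (simp add: t_def norm_power[symmetric])
    have "norm z ^ n k < 1" using tk r(2) by (simp only: t_def)
    then have z1: "norm z < 1" using n[of k] by (simp add: power_less_one_iff)
    have t: "0 \<le> t j" "t j < 1" for j using z1 n[of j] by (auto simp: t_def power_less_one_iff)
    have nz: "norm (z ^ n j) = t j" for j by (simp add: t_def norm_power)
    let ?d = "\<lambda>j. 2 * (1/16) ^ (if j < k then k - j else j - k) + 2 * e"
    have combine: "1 - (2 * a + 2 * e) \<le> Y" if "1 - 2 * X \<le> Y" "X \<le> a + b" "b \<le> e" for X Y a b :: real
      using that by linarith
    have "1 - ?d j \<le> norm (power_factor (n j) r z)" if "j \<noteq> k" for j
    proof (cases "j < k")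
      case True
      have "n j * 16 ^ (k - j) = n k" using True by (simp add: n_def flip: power_add)
      then have rt: "t j ^ (16 ^ (k - j)) = r" by (simp add: t_def tk[symmetric] flip: power_mult)
      have "r \<le> t j" unfolding rt[symmetric] using t[of j] power_decreasing[of 1 "16 ^ (k - j)" "t j"] by simp
      then have "1 - 2 * ((1 - t j) / (1 - r)) \<le> norm (power_factor (n j) r z)"
        using moebius_norm_ge(2)[of "z ^ n j" r] t[of j] r by (simp add: power_factor_def nz)
      moreover have "(1 - t j) / (1 - r) \<le> 1 / 16 ^ (k - j) + (1 - t j)"
        using one_minus_ratio_le[of "t j" "16 ^ (k - j)"] t[of j] by (simp add: rt)
      moreover have "1 - t j \<le> e" using \<open>r \<le> t j\<close> by (simp add: r_def)
      ultimately have "1 - (2 * (1 / 16 ^ (k - j)) + 2 * e) \<le> norm (power_factor (n j) r z)"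
        by (rule combine)
      then show ?thesis using True by (simp add: power_one_over)
    next
      case False
      then have jk: "k < j" using that by simp
      have "n k * 16 ^ (j - k) = n j" using jk by (simp add: n_def flip: power_add)
      then have rt: "t j = r ^ (16 ^ (j - k))" by (simp add: t_def tk[symmetric] flip: power_mult)
      have "t j \<le> r" unfolding rt using r power_decreasing[of 1 "16 ^ (j - k)" r] by simp
      then have "1 - 2 * ((1 - r) / (1 - t j)) \<le> norm (power_factor (n j) r z)"
        using moebius_norm_ge(1)[of "z ^ n j" r] t[of j] r by (simp add: power_factor_def nz)
      moreover have "(1 - r) / (1 - t j) \<le> 1 / 16 ^ (j - k) + (1 - r)"
        using one_minus_ratio_le[of r "16 ^ (j - k)"] r by (simp add: rt)
      moreover have "1 - r \<le> e" by (simp add: r_def)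
      ultimately have "1 - (2 * (1 / 16 ^ (j - k)) + 2 * e) \<le> norm (power_factor (n j) r z)"
        by (rule combine)
      then show ?thesis using jk by (simp add: power_one_over)
    qed
    moreover have "(\<Sum>j\<in>{..<K} - {k}. ?d j) \<le> 1 / 2"
    proof -
      have "(\<Sum>j\<in>{..<K} - {k}. ?d j) = 2 * (\<Sum>j\<in>{..<K} - {k}. (1/16) ^ (if j < k then k - j else j - k)) + real (card ({..<K} - {k})) * (2 * e)"
        by (simp add: sum.distrib sum_distrib_left)
      also have "\<dots> \<le> 2 * (2 * (1/16) / (1 - 1/16)) + real K * (2 * e)"
        using e by (intro add_mono mult_left_mono mult_right_mono sum_geometric_distance_le)
          (auto intro: order_trans[OF card_Diff1_le])
      also have "\<dots> \<le> 1 / 2" using K by (simp add: e_def)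
      finally show ?thesis .
    qed
    ultimately have "n k * norm z ^ (n k - 1) / (2 * (1 - r ^ 2))
       \<le> norm (deriv (\<lambda>z. \<Prod>j<K. power_factor (n j) r z) z)"
      by (intro norm_deriv_product_ge[where d = ?d and r = "\<lambda>_. r"]) (use r k z z1 n in auto)
    moreover have "n k / (8 * e) \<le> n k * norm z ^ (n k - 1) / (2 * (1 - r ^ 2))"
    proof -
      have "1/2 \<le> norm z ^ n k" using tk r by (simp add: t_def)
      also have "\<dots> \<le> norm z ^ (n k - 1)" using z1 by (intro power_decreasing) auto
      finally have a: "1/2 \<le> norm z ^ (n k - 1)" .
      have "1 - r ^ 2 = e * (1 + r)" by (simp add: r_def power2_eq_square algebra_simps)
      also have "\<dots> \<le> e * 2" using e r by (intro mult_left_mono) auto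
      finally have b: "2 * (1 - r ^ 2) \<le> 4 * e" by simp
      have c: "0 < 2 * (1 - r ^ 2)" using r by (simp add: abs_square_less_1)
      have "n k / (8 * e) = n k * (1/2) / (4 * e)" by simp
      also have "\<dots> \<le> n k * norm z ^ (n k - 1) / (2 * (1 - r ^ 2))"
        using a b c by (intro frac_le mult_left_mono) auto
      finally show ?thesis .
    qed
    ultimately show ?thesis by (simp add: f_def[abs_def])
  qed
  have hol: "deriv f holomorphic_on ball 0 1"
    by (intro holomorphic_deriv is_blaschke_holomorphic[OF bl]) auto
  define A where "A = (1/32) * (e / 4) powr (1 / P)"
  \<comment> \<open>Half the distance of the zeros from the circle, so that the circles considered pass outside of them.\<close>
  define u where "u i = e / (2 * n i)" for i
  have "ennreal ((real K * A powr Q / 2) powr (1 / Q)) \<le> besov_seminorm p q f"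
  proof (rule besov_seminorm_ge[OF q, where u = u])
    show "0 \<le> A" by (simp add: A_def)
    show u: "0 < u i" for i using e n[of i] by (simp add: u_def)
    show u1: "u i \<le> 1" for i
    proof -
      have "e / (2 * n i) \<le> e / 2" using e n[of i] by (intro divide_left_mono) auto
      then show ?thesis using e by (simp add: u_def)
    qed
    show "u (Suc i) \<le> u i / 2" for i using e by (auto simp: u_def n_def intro!: divide_left_mono)
    fix i \<rho> assume i: "i < K" and \<rho>: "1 - u i < \<rho>" "\<rho> < 1 - u i / 2"
    have "u i \<le> e / 2" using e n[of i] by (simp add: u_def field_simps)
    then have \<rho>1: "0 < \<rho>" "\<rho> < 1" using \<rho> u[of i] e by linarith+
    \<comment> \<open>The zeros of the \<open>i\<close>-th factor, seen from the circle of radius \<open>\<rho>\<close>, are the points \<open>\<rho> w\<close> with \<open>w\<^bsup>n i\<^esup> = c\<^bsup>n i\<^esup>\<close>.\<close>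
    define c where "c = root (n i) r / \<rho>"
    have cn: "c ^ n i = r / \<rho> ^ n i" using n[of i] r by (simp add: c_def power_divide)
    have c0: "0 \<le> c" using r \<rho>1 by (simp add: c_def real_root_ge_zero)
    have "real (n i) * (1 - \<rho>) \<le> real (n i) * u i" using \<rho> by (intro mult_left_mono) auto
    also have "\<dots> = e / 2" using n[of i] by (simp add: u_def)
    finally have "1 - e / 2 \<le> \<rho> ^ n i" using one_minus_le_power[of \<rho> "n i"] \<rho>1 by simp
    then have gap: "e / 2 \<le> \<rho> ^ n i - r" by (simp add: r_def)
    have \<rho>n: "0 < \<rho> ^ n i" "\<rho> ^ n i \<le> 1" using \<rho>1 by (auto simp: power_le_one)
    have "e / 2 \<le> (\<rho> ^ n i - r) / \<rho> ^ n i"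
      using gap \<rho>n e by (simp add: pos_le_divide_eq) (smt (verit) mult_left_le)
    also have "\<dots> = 1 - c ^ n i" using \<rho>1(1) by (simp add: cn diff_divide_distrib)
    finally have gap': "e / 2 \<le> 1 - c ^ n i" .
    then have "c ^ n i < 1" using e by linarith
    then have c1: "c < 1" using n[of i] c0 by (simp add: power_less_one_iff)
    have "A / (1 - \<rho>) \<le> A / (u i / 2)"
      using \<rho> u[of i] \<open>0 \<le> A\<close> by (intro divide_left_mono) auto
    also have "\<dots> = n i / (8 * e) * (e / 4) powr (1 / P)"
      using e n[of i] by (simp add: A_def u_def field_simps)
    also have "\<dots> \<le> n i / (8 * e) * ((1 - c ^ n i) / 2) powr (1 / P)"
      using gap' e p by (intro mult_left_mono powr_mono2) auto
    finally have "ennreal (A / (1 - \<rho>)) \<le> ennreal (n i / (8 * e) * ((1 - c ^ n i) / 2) powr (1 / P))"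
      by (rule ennreal_leI)
    also have "\<dots> \<le> circle_norm p (deriv f) \<rho>"
    proof (rule Lp_norm_ge_at_roots[OF hol _ _ p n c0 c1])
      fix w :: complex assume w: "w ^ n i = of_real c ^ n i"
      have "(of_real \<rho> * w) ^ n i = complex_of_real (\<rho> ^ n i * c ^ n i)"
        by (simp add: power_mult_distrib w)
      also have "\<rho> ^ n i * c ^ n i = r" using \<rho>1(1) by (simp add: cn)
      finally show "n i / (8 * e) \<le> norm (deriv f (of_real \<rho> * w))" by (rule der[OF i])
    qed (use \<rho>1 e in auto)
    finally show "ennreal (A / (1 - \<rho>)) \<le> circle_norm p (deriv f) \<rho>" .
  qed
  moreover have "1/12288 * ln (real N) powr (1 / Q - 1 / P) \<le> (real K * A powr Q / 2) powr (1 / Q)"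
  proof -
    define s where "s = 1 / Q - 1 / P"
    have s: "0 \<le> s" "s \<le> 1"
    proof -
      have "1 / P \<le> 1 / Q" using le q by (simp add: frac_le)
      moreover have "1 / Q \<le> 1" "0 \<le> 1 / P" using q p by auto
      ultimately show "0 \<le> s" "s \<le> 1" unfolding s_def by linarith+
    qed
    have "N \<le> 16 ^ K" unfolding N_def by (induction K) auto
    then have "ln (real N) \<le> ln (real (16 ^ K))"
      using N2 by (intro iffD2[OF ln_le_cancel_iff]) (auto simp: N_def[symmetric] simp del: of_nat_power)
    also have "\<dots> = real K * ln (2 ^ 4)" by (simp add: ln_realpow)
    also have "\<dots> \<le> real K * 3"
    proof (rule mult_left_mono)
      have "ln (2 ^ 4) = 4 * ln (2::real)" by (subst ln_realpow) auto
      then show "ln (2 ^ 4) \<le> (3::real)" using ln2_le_25_over_36 by simp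
    qed simp
    finally have lnN: "ln (real N) \<le> 3 * real K" by simp
    have "0 \<le> ln (real N)" using N2 by (simp add: N_def[symmetric])
    then have "ln (real N) powr s \<le> (3 * real K) powr s" using lnN s by (intro powr_mono2) auto
    also have "\<dots> = 3 powr s * real K powr s" by (simp add: powr_mult)
    also have "\<dots> \<le> 3 powr 1 * real K powr s" using s by (intro mult_right_mono powr_mono) auto
    finally have "1/12288 * ln (real N) powr s \<le> (1/2) * (1/32) * (1/64) * real K powr s" by simp
    also have "\<dots> \<le> (1/2) powr (1/Q) * (1/32) * (1/64) powr (1/P) * real K powr s"
      using powr_mono'[of "1/Q" 1 "1/2"] powr_mono'[of "1/P" 1 "1/64"] q p
      by (intro mult_right_mono mult_mono) auto
    also have "\<dots> = (real K * A powr Q / 2) powr (1 / Q)"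
    proof -
      have "A = (1/32) * ((1/64) powr (1/P) * real K powr (- 1/P))"
        using K by (simp add: A_def e_def powr_divide powr_mult powr_minus_divide)
      moreover have "(real K * A powr Q / 2) powr (1 / Q) = real K powr (1/Q) * A * (1/2) powr (1/Q)"
        using q by (simp add: powr_mult powr_divide powr_powr A_def)
      ultimately show ?thesis by (simp add: s_def powr_diff powr_minus_divide)
    qed
    finally show ?thesis by (simp add: s_def)
  qed
  ultimately have "ennreal (1/12288 * ln (real N) powr (recip q - recip p)) \<le> besov_norm p q f"
    unfolding q(4) p(3) by (rule besov_norm_ge_of_seminorm)
  then show "\<exists>f. is_blaschke (\<Sum>j<K. 16 ^ j) f \<and>
      ennreal (1/12288 * ln (real (\<Sum>j<K. 16 ^ j)) powr (recip q - recip p)) \<le> besov_norm p q f"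
    using bl by (auto simp: N_def)
qed simp

section \<open>Schur iterates with lacunary Taylor coefficients\<close>

text \<open>Schur's algorithm run backwards, with the constant Schur parameter \<open>a\<close>. The substitution \<open>z \<mapsto> z\<^sup>4\<close> makes the frequencies
lacunary. The power \<open>4\<close> is chosen because the error in \<open>taylor_coeff_schur_step\<close> is then of order \<open>a\<^sup>4\<close>, negligible
against \<open>a\<close> even after \<open>K\<close> steps, where \<open>K\<close> is of order \<open>1 / a\<^sup>2\<close>.\<close>

fun schur_iterate :: "real \<Rightarrow> nat \<Rightarrow> complex \<Rightarrow> complex" where
  "schur_iterate a 0 = (\<lambda>z. 1)"
| "schur_iterate a (Suc k) = (\<lambda>z. (of_real a + z * schur_iterate a k (z ^ 4)) /
     (1 + of_real a * (z * schur_iterate a k (z ^ 4))))"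

text \<open>Both the degree of \<open>schur_iterate a k\<close> and the position of the \<open>k\<close>-th large Taylor coefficient.\<close>

fun schur_freq :: "nat \<Rightarrow> nat" where
  "schur_freq 0 = 0"
| "schur_freq (Suc i) = 4 * schur_freq i + 1"

lemma is_blaschke_id: "is_blaschke 1 (\<lambda>z. z)"
  using is_blaschke_power_factor[of 0 1] by simp

lemma is_blaschke_schur_iterate:
  assumes "0 \<le> a" "a < 1"
  shows "is_blaschke (schur_freq k) (schur_iterate a k)"
proof (induction k)
  case 0
  then show ?case by (simp add: is_blaschke_const)
next
  case (Suc k)
  have "is_blaschke (1 + 4 * schur_freq k) (\<lambda>z. z * schur_iterate a k (z ^ 4))"
    by (intro is_blaschke_mult is_blaschke_id is_blaschke_compose_power Suc) simp
  from is_blaschke_moebius[OF this, of "of_real a"] assms show ?case by simp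
qed

lemma norm_taylor_coeff_le_1:
  assumes "f holomorphic_on ball 0 1" "\<And>z. norm z < 1 \<Longrightarrow> norm (f z) \<le> 1"
  shows "norm (taylor_coeff f n) \<le> 1"
proof -
  have "norm (taylor_coeff f n) ^ 2 \<le> (\<Sum>i<Suc n. norm (taylor_coeff f i) ^ 2)"
    by (intro member_le_sum) auto
  also have "\<dots> \<le> 1" by (rule sum_taylor_coeff_le_1[OF assms])
  finally show ?thesis by (simp add: abs_square_le_1)
qed

lemma fps_expansion_disc:
  assumes "f holomorphic_on ball 0 1"
  shows "f has_fps_expansion fps_expansion f 0"
  by (rule has_fps_expansion_fps_expansion[OF _ _ assms]) auto

lemma taylor_coeff_fps: "f has_fps_expansion F \<Longrightarrow> taylor_coeff f n = fps_nth F n"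
  by (simp add: taylor_coeff_def fps_nth_fps_expansion)

text \<open>With \<open>w = z f(z\<^sup>4)\<close> the Moebius transform of \<open>w\<close> is expanded up to the fourth power of \<open>w\<close>. Only exponents congruent to \<open>j\<close> modulo \<open>4\<close>
occur in \<open>w\<^sup>j\<close>, so at the exponent \<open>4 n + 1\<close> the powers \<open>j = 2, 3, 4\<close> contribute nothing, and the first power
contributes the coefficient of \<open>f\<close> of index \<open>n\<close>. The remainder is bounded on the disc, hence so are its coefficients.\<close>

lemma taylor_coeff_schur_step:
  assumes f: "f holomorphic_on ball 0 1" "\<And>z. norm z < 1 \<Longrightarrow> norm (f z) \<le> 1" and a: "0 \<le> a" "a < 1"
  shows "(1 - a ^ 2) * (norm (taylor_coeff f n) - a ^ 4 / (1 - a))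
    \<le> norm (taylor_coeff (\<lambda>z. (of_real a + z * f (z ^ 4)) / (1 + of_real a * (z * f (z ^ 4)))) (4 * n + 1))"
proof -
  define w where "w z = z * f (z ^ 4)" for z
  \<comment> \<open>The remainder of the expansion is \<open>a\<^sup>4 / (1 - a)\<close> times \<open>E\<close>; the factor \<open>1 - a\<close> normalises \<open>E\<close> to modulus at most \<open>1\<close>.\<close>
  define E where "E z = of_real (1 - a) * w z ^ 5 / (1 + of_real a * w z)" for z
  define T where "T z = (of_real a + w z) / (1 + of_real a * w z)" for z
  have pow4: "z ^ 4 \<in> ball 0 1" if "z \<in> ball 0 1" for z :: complex
    using that by (simp add: norm_power power_less_one_iff)
  have nw: "norm (w z) \<le> 1" if "z \<in> ball 0 1" for z
  proof -
    have "norm z * norm (f (z ^ 4)) \<le> 1"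
      using that pow4[OF that] by (intro mult_le_one f(2)) auto
    then show ?thesis by (simp add: w_def norm_mult)
  qed
  have den: "1 - a \<le> norm (1 + of_real a * w z)" if "z \<in> ball 0 1" for z
  proof -
    have "norm (of_real a * w z) \<le> a" using nw[OF that] a by (simp add: norm_mult mult_left_le)
    moreover have "norm (1::complex) - norm (of_real a * w z) \<le> norm (1 + of_real a * w z)" by (rule norm_diff_ineq)
    ultimately show ?thesis by simp
  qed
  have nz: "1 + of_real a * w z \<noteq> 0" if "z \<in> ball 0 1" for z
    using den[OF that] a by (metis diff_gt_0_iff_gt linorder_not_less norm_zero)
  have "(f \<circ> (\<lambda>z. z ^ 4)) holomorphic_on ball 0 1"
    using pow4 by (intro holomorphic_on_compose_gen[OF _ f(1)] holomorphic_intros) blast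
  then have holw: "w holomorphic_on ball 0 1"
    unfolding w_def by (intro holomorphic_intros) (simp add: o_def)
  have holE: "E holomorphic_on ball 0 1"
    unfolding E_def by (intro holomorphic_intros holw nz)
  have nE: "norm (E z) \<le> 1" if "norm z < 1" for z
  proof -
    have z: "z \<in> ball 0 1" using that by simp
    have "(1 - a) * norm (w z) ^ 5 \<le> (1 - a) * 1"
      using a nw[OF z] by (intro mult_left_mono power_le_one) auto
    also have "\<dots> \<le> norm (1 + of_real a * w z)" using den[OF z] by simp
    finally have "(1 - a) * norm (w z) ^ 5 \<le> norm (1 + of_real a * w z)" .
    moreover have "norm (complex_of_real (1 - a)) = 1 - a" using a by (metis abs_of_nonneg diff_ge_0_iff_ge less_imp_le norm_of_real)
    ultimately show ?thesis
      using nz[OF z] by (simp add: E_def norm_divide norm_mult norm_power divide_le_eq_1 del: of_real_diff)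
  qed
  define F where "F = fps_expansion f 0"
  define W where "W = fps_X * (F oo fps_X ^ 4)"
  define G where "G = fps_expansion E 0"
  have expf: "f has_fps_expansion F" unfolding F_def by (rule fps_expansion_disc[OF f(1)])
  have "(f \<circ> (\<lambda>z. z ^ 4)) has_fps_expansion (F oo fps_X ^ 4)"
    by (intro has_fps_expansion_compose expf fps_expansion_intros) simp
  then have expw: "w has_fps_expansion W"
    unfolding w_def[abs_def] W_def by (intro fps_expansion_intros) (simp add: o_def)
  have expE: "E has_fps_expansion G" unfolding G_def by (rule fps_expansion_disc[OF holE])
  define b where "b = complex_of_real a"
  define c where "c = complex_of_real (a ^ 4 / (1 - a))"
  have expT: "(\<lambda>z. b + (1 - b ^ 2) * (w z - b * w z ^ 2 + b ^ 2 * w z ^ 3 - b ^ 3 * w z ^ 4 + c * E z))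
      has_fps_expansion
      fps_const b + fps_const (1 - b ^ 2) * (W - fps_const b * W ^ 2 + fps_const (b ^ 2) * W ^ 3 - fps_const (b ^ 3) * W ^ 4 + fps_const c * G)"
    by (intro fps_expansion_intros expw expE)
  have eqT: "T z = b + (1 - b ^ 2) * (w z - b * w z ^ 2 + b ^ 2 * w z ^ 3 - b ^ 3 * w z ^ 4 + c * E z)" if z: "z \<in> ball 0 1" for z
  proof -
    have D: "1 + b * w z \<noteq> 0" using nz[OF z] by (simp add: b_def)
    have "complex_of_real (a ^ 4 / (1 - a)) * of_real (1 - a) = b ^ 4"
      unfolding of_real_mult[symmetric] using a by (simp add: b_def)
    then have "c * E z = b ^ 4 * w z ^ 5 / (1 + b * w z)"
      unfolding c_def E_def b_def by (metis (no_types, opaque_lifting) mult.assoc times_divide_eq_right)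
    moreover have "(1 - b ^ 2) * (x - b * x ^ 2 + b ^ 2 * x ^ 3 - b ^ 3 * x ^ 4 + b ^ 4 * x ^ 5 / (1 + b * x)) + b
        = (b + x) / (1 + b * x)" if "1 + b * x \<noteq> 0" for x
      using that by (simp add: field_simps) algebra
    ultimately show ?thesis using D by (simp add: T_def b_def[symmetric] add.commute)
  qed
  have "T has_fps_expansion
      fps_const b + fps_const (1 - b ^ 2) * (W - fps_const b * W ^ 2 + fps_const (b ^ 2) * W ^ 3 - fps_const (b ^ 3) * W ^ 4 + fps_const c * G)"
  proof -
    have "\<forall>\<^sub>F z in nhds 0. z \<in> ball (0::complex) 1" by (intro eventually_nhds_in_open) auto
    then have "\<forall>\<^sub>F z in nhds 0. T z = b + (1 - b ^ 2) * (w z - b * w z ^ 2 + b ^ 2 * w z ^ 3 - b ^ 3 * w z ^ 4 + c * E z)"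
      by eventually_elim (rule eqT)
    then show ?thesis using expT by (subst has_fps_expansion_cong[OF _ refl]) auto
  qed
  then have T: "taylor_coeff T (4 * n + 1) = fps_nth (fps_const b + fps_const (1 - b ^ 2) * (W - fps_const b * W ^ 2 + fps_const (b ^ 2) * W ^ 3 - fps_const (b ^ 3) * W ^ 4 + fps_const c * G)) (4 * n + 1)"
    by (rule taylor_coeff_fps)
  have Wj: "W ^ j = fps_X ^ j * (F ^ j oo fps_X ^ 4)" for j
    by (simp add: W_def power_mult_distrib fps_compose_power)
  have Wcoef: "fps_nth (W ^ j) (4 * n + 1) = (if j > 4 * n + 1 then 0 else if 4 dvd (4 * n + 1 - j) then fps_nth (F ^ j) ((4 * n + 1 - j) div 4) else 0)" for j
    by (simp add: Wj fps_X_power_mult_nth fps_nth_compose_X_power)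
  have ndvd: "\<not> 4 dvd (4 * n + 1 - j)" if "j \<in> {2, 3, 4}" "\<not> j > 4 * n + 1" for j
    using that by auto presburger+
  have W1: "fps_nth W (4 * n + 1) = fps_nth F n" using Wcoef[of 1] by simp
  have Wz: "fps_nth (W ^ j) (4 * n + 1) = 0" if "j \<in> {2, 3, 4}" for j
    using Wcoef[of j] ndvd[of j] that by auto
  have "taylor_coeff T (4 * n + 1) = (1 - b ^ 2) * (fps_nth F n + c * fps_nth G (4 * n + 1))"
    unfolding T using W1 Wz[of 2] Wz[of 3] Wz[of 4] by simp
  then have "norm (taylor_coeff T (4 * n + 1)) = norm (1 - b ^ 2) * norm (fps_nth F n + c * fps_nth G (4 * n + 1))"
    by (simp add: norm_mult)
  moreover have "norm (1 - b ^ 2) = 1 - a ^ 2"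
  proof -
    have "a ^ 2 \<le> 1" using a by (simp add: abs_square_le_1)
    moreover have "1 - b ^ 2 = complex_of_real (1 - a ^ 2)" by (simp add: b_def)
    then have "norm (1 - b ^ 2) = \<bar>1 - a ^ 2\<bar>" by (simp only: norm_of_real)
    ultimately show ?thesis by simp
  qed
  moreover have "norm (taylor_coeff f n) - a ^ 4 / (1 - a) \<le> norm (fps_nth F n + c * fps_nth G (4 * n + 1))"
  proof -
    have "norm (fps_nth G (4 * n + 1)) \<le> 1"
      using norm_taylor_coeff_le_1[OF holE nE] taylor_coeff_fps[OF expE] by metis
    then have "norm (c * fps_nth G (4 * n + 1)) \<le> norm c"
      by (simp add: norm_mult mult_left_le)
    moreover have "norm c = a ^ 4 / (1 - a)" unfolding c_def using a by (simp only: norm_of_real) simp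
    ultimately have "norm (c * fps_nth G (4 * n + 1)) \<le> a ^ 4 / (1 - a)" by (simp only:)
    moreover have "norm (fps_nth F n) - norm (c * fps_nth G (4 * n + 1)) \<le> norm (fps_nth F n + c * fps_nth G (4 * n + 1))"
      by (rule norm_diff_ineq)
    ultimately show ?thesis using taylor_coeff_fps[OF expf, of n] by simp
  qed
  moreover have "0 \<le> 1 - a ^ 2" using a by (simp add: abs_square_le_1)
  ultimately have "(1 - a ^ 2) * (norm (taylor_coeff f n) - a ^ 4 / (1 - a)) \<le> norm (taylor_coeff T (4 * n + 1))"
    by (simp add: mult_left_mono)
  then show ?thesis by (simp add: T_def[abs_def] w_def)
qed

text \<open>The value \<open>a\<close> at the origin is the newest coefficient; each later step moves a coefficient from the frequency \<open>n\<close> to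
\<open>4 n + 1\<close>.\<close>

lemma taylor_coeff_schur_iterate:
  assumes a: "0 \<le> a" "a < 1" and i: "i < k"
  shows "(1 - a ^ 2) ^ i * a - i * (a ^ 4 / (1 - a)) \<le> norm (taylor_coeff (schur_iterate a k) (schur_freq i))"
  using i
proof (induction k arbitrary: i)
  case (Suc k)
  note bl = is_blaschke_schur_iterate[OF a, of k]
  show ?case
  proof (cases i)
    case 0
    then show ?thesis using a by (simp add: taylor_coeff_def)
  next
    case (Suc m)
    define \<delta> where "\<delta> = a ^ 4 / (1 - a)"
    define x where "x = 1 - a ^ 2"
    have x: "0 \<le> x" "x \<le> 1" using a by (auto simp: x_def abs_square_le_1)
    have \<delta>: "0 \<le> \<delta>" using a by (simp add: \<delta>_def)
    have IH: "x ^ m * a - m * \<delta> \<le> norm (taylor_coeff (schur_iterate a k) (schur_freq m))"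
      unfolding x_def \<delta>_def by (rule Suc.IH) (use Suc.prems Suc in simp)
    have "x ^ i * a - i * \<delta> \<le> x * (x ^ m * a) - x * ((m + 1) * \<delta>)"
      using mult_right_mono[OF x(2), of "(m + 1) * \<delta>"] \<delta> by (simp add: Suc algebra_simps)
    also have "\<dots> = x * ((x ^ m * a - m * \<delta>) - \<delta>)" by (simp add: algebra_simps)
    also have "\<dots> \<le> x * (norm (taylor_coeff (schur_iterate a k) (schur_freq m)) - \<delta>)"
      using IH x by (intro mult_left_mono) auto
    also have "\<dots> \<le> norm (taylor_coeff (schur_iterate a (Suc k)) (schur_freq i))"
      unfolding x_def \<delta>_def Suc schur_iterate.simps schur_freq.simps
      by (rule taylor_coeff_schur_step[OF is_blaschke_holomorphic[OF bl] is_blaschke_norm_le_1[OF bl] a])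
    finally show ?thesis by (simp add: x_def \<delta>_def)
  qed
qed simp

lemma schur_freq_le: "schur_freq K \<le> 4 ^ K"
proof -
  have "3 * schur_freq K + 1 = 4 ^ K" by (induction K) auto
  then show ?thesis by simp
qed

text \<open>With \<open>a = 1 / (2 sqrt K)\<close> the products \<open>(1 - a\<^sup>2)\<^sup>i\<close> stay above \<open>3/4\<close> for \<open>i < K\<close> and the accumulated errors below \<open>a/4\<close>, so
all \<open>K\<close> coefficients are at least \<open>a/2\<close>.\<close>

lemma growth_attained_small_p:
  assumes p: "1 \<le> P" "p = ennreal P" "recip p = 1 / P"
    and q: "1 \<le> Q" "q = ennreal Q" "enn2real q = Q" "recip q = 1 / Q" and le: "Q \<le> 2"
  shows "growth_attained p q (\<lambda>N. ln (real N) powr (recip q - 1 / 2))"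
proof (rule growth_attainedI[where c = "1/256" and n = schur_freq and ?K0.0 = 2])
  show mono: "strict_mono schur_freq" by (auto simp: strict_mono_Suc_iff)
  fix K :: nat assume K: "2 \<le> K"
  have "schur_freq 2 \<le> schur_freq K" using mono K by (simp add: strict_mono_less_eq)
  then show N2: "2 \<le> schur_freq K" by (simp add: eval_nat_numeral)
  define a where "a = 1 / (2 * sqrt (real K))"
  have sq: "1 \<le> sqrt (real K)" using K by simp
  have a: "0 < a" "a \<le> 1/2" using sq by (auto simp: a_def field_simps)
  have Ka: "real K * a ^ 2 = 1/4" using K by (simp add: a_def power_divide power_mult_distrib)
  define f where "f = schur_iterate a K"
  have bl: "is_blaschke (schur_freq K) f" unfolding f_def using a by (intro is_blaschke_schur_iterate) auto
  have coef: "a / 2 \<le> norm (taylor_coeff f (schur_freq i))" if i: "i < K" for i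
  proof -
    have "1 - real i * (1 - (1 - a ^ 2)) \<le> (1 - a ^ 2) ^ i"
      using a by (intro one_minus_le_power) (auto simp: abs_square_le_1)
    moreover have "real i * a ^ 2 \<le> real K * a ^ 2" using i by (intro mult_right_mono) auto
    ultimately have "3/4 \<le> (1 - a ^ 2) ^ i" using Ka by simp
    then have "3/4 * a \<le> (1 - a ^ 2) ^ i * a" using a by (intro mult_right_mono) auto
    moreover have "real i * (a ^ 4 / (1 - a)) \<le> a / 4"
    proof -
      have "a ^ 4 / (1 - a) \<le> a ^ 4 / (1 / 2)" using a by (intro divide_left_mono) auto
      then have "real i * (a ^ 4 / (1 - a)) \<le> real K * (a ^ 4 / (1 / 2))"
        using i a by (intro mult_mono) auto
      also have "\<dots> = (real K * a ^ 2) * (2 * a * a)" by (simp add: power2_eq_square power4_eq_xxxx)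
      also have "\<dots> \<le> a / 4" using a by (simp add: Ka)
      finally show ?thesis .
    qed
    ultimately have "a / 2 \<le> (1 - a ^ 2) ^ i * a - i * (a ^ 4 / (1 - a))" by simp
    also have "\<dots> \<le> norm (taylor_coeff f (schur_freq i))"
      unfolding f_def using a i by (intro taylor_coeff_schur_iterate) auto
    finally show ?thesis .
  qed
  have hol: "deriv f holomorphic_on ball 0 1"
    by (intro holomorphic_deriv is_blaschke_holomorphic[OF bl]) auto
  have freq: "1 \<le> schur_freq (Suc i)" for i by simp
  define u where "u i = 1 / (2 * real (schur_freq (Suc i)))" for i
  have "ennreal ((real (K - 1) * (a / 16) powr Q / 2) powr (1 / Q)) \<le> besov_seminorm p q f"
  proof (rule besov_seminorm_ge[OF q, where u = u])
    show "0 \<le> a / 16" using a by simp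
    show u: "0 < u i" for i by (simp add: u_def)
    show u1: "u i \<le> 1" for i using freq[of i] by (simp add: u_def field_simps)
    show "u (Suc i) \<le> u i / 2" for i by (simp add: u_def field_simps)
    fix i \<rho> assume i: "i < K - 1" and \<rho>: "1 - u i < \<rho>" "\<rho> < 1 - u i / 2"
    define m where "m = schur_freq (Suc i)"
    have m: "1 \<le> m" using freq[of i] by (simp add: m_def)
    have um: "u i = 1 / (2 * real m)" by (simp add: u_def m_def)
    have \<rho>1: "0 < \<rho>" "\<rho> < 1" using \<rho> u[of i] u1[of i] by linarith+
    have "real (m - 1) * (1 - \<rho>) \<le> real m * u i" using \<rho> \<rho>1 by (intro mult_mono) auto
    also have "\<dots> = 1 / 2" using m by (simp add: um)
    finally have pow: "1 / 2 \<le> \<rho> ^ (m - 1)" using one_minus_le_power[of \<rho> "m - 1"] \<rho>1 by simp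
    have "(a / 16) / (1 - \<rho>) \<le> (a / 16) / (u i / 2)"
      using \<rho> u[of i] a by (intro divide_left_mono) auto
    also have "\<dots> = (real m * (a / 2)) * (1 / 2)" using m by (simp add: um)
    also have "\<dots> \<le> (real m * norm (taylor_coeff f m)) * \<rho> ^ (m - 1)"
      using coef[of "Suc i"] i pow a by (intro mult_mono mult_left_mono) (auto simp: m_def simp del: schur_freq.simps)
    also have "real m * norm (taylor_coeff f m) = norm (taylor_coeff (deriv f) (m - 1))"
      using m by (simp add: taylor_coeff_deriv norm_mult del: of_nat_Suc)
    finally have "ennreal ((a / 16) / (1 - \<rho>)) \<le> ennreal (norm (taylor_coeff (deriv f) (m - 1)) * \<rho> ^ (m - 1))"
      by (rule ennreal_leI)
    also have "\<dots> \<le> circle_norm p (deriv f) \<rho>"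
      by (rule Lp_norm_ge_taylor_coeff[OF hol _ _ p]) (use \<rho>1 in auto)
    finally show "ennreal ((a / 16) / (1 - \<rho>)) \<le> circle_norm p (deriv f) \<rho>" .
  qed
  moreover have "1/256 * ln (real (schur_freq K)) powr (1 / Q - 1 / 2) \<le> (real (K - 1) * (a / 16) powr Q / 2) powr (1 / Q)"
  proof -
    define s where "s = 1 / Q - 1 / 2"
    have s: "0 \<le> s" "s \<le> 1" using le q by (auto simp: s_def field_simps)
    have "ln (real (schur_freq K)) \<le> ln (real (4 ^ K))"
      using N2 schur_freq_le[of K] by (intro iffD2[OF ln_le_cancel_iff]) (auto simp del: of_nat_power)
    also have "\<dots> = real K * ln (2 ^ 2)" by (simp add: ln_realpow)
    also have "\<dots> \<le> real K * 2"
    proof (rule mult_left_mono)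
      have "ln (2 ^ 2) = 2 * ln (2::real)" by (subst ln_realpow) auto
      then show "ln (2 ^ 2) \<le> (2::real)" using ln2_le_25_over_36 by simp
    qed simp
    finally have lnN: "ln (real (schur_freq K)) \<le> 2 * real K" by simp
    have "0 \<le> ln (real (schur_freq K))" using N2 by simp
    then have "ln (real (schur_freq K)) powr s \<le> (2 * real K) powr s" using lnN s by (intro powr_mono2) auto
    also have "\<dots> = 2 powr s * real K powr s" by (simp add: powr_mult)
    also have "\<dots> \<le> 2 powr 1 * real K powr s" using s by (intro mult_right_mono powr_mono) auto
    finally have "1/256 * ln (real (schur_freq K)) powr s \<le> (1/4) * (1/32) * real K powr s" by simp
    also have "\<dots> \<le> (1/4) powr (1/Q) * (1/32) * real K powr s"
      using powr_mono'[of "1/Q" 1 "1/4"] q by (intro mult_right_mono) auto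
    also have "\<dots> = (real K / 2 * (a / 16) powr Q / 2) powr (1 / Q)"
    proof -
      have "a / 16 = (1/32) * real K powr (- 1/2)"
        using K by (simp add: a_def powr_minus_divide powr_half_sqrt)
      moreover have "(real K / 2 * (a / 16) powr Q / 2) powr (1 / Q) = (real K * (1/4) * (a / 16) powr Q) powr (1 / Q)"
        by (simp add: mult_ac)
      moreover have "\<dots> = real K powr (1/Q) * (1/4) powr (1/Q) * (a / 16)"
        using q a by (simp only: powr_mult powr_powr) simp
      ultimately show ?thesis by (simp add: s_def powr_diff powr_minus_divide)
    qed
    also have "\<dots> \<le> (real (K - 1) * (a / 16) powr Q / 2) powr (1 / Q)"
      using K q a by (intro powr_mono2 divide_right_mono mult_right_mono) auto
    finally show ?thesis by (simp add: s_def)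
  qed
  ultimately have "ennreal (1/256 * ln (real (schur_freq K)) powr (recip q - 1 / 2)) \<le> besov_norm p q f"
    unfolding q(4) by (rule besov_norm_ge_of_seminorm)
  then show "\<exists>f. is_blaschke (schur_freq K) f \<and>
      ennreal (1/256 * ln (real (schur_freq K)) powr (recip q - 1 / 2)) \<le> besov_norm p q f"
    using bl by blast
qed simp

section \<open>The growth of the Besov norms\<close>

theorem proposition10:
  fixes p q :: ennreal
  assumes "1 \<le> p" and "1 \<le> q"
  shows
    "(\<exists>C>0. \<forall>N\<ge>2. \<forall>\<sigma>\<in>disc_tuples N.
        (p \<le> 2 \<and> q \<le> 2 \<longrightarrow>
           besov_norm p q (blaschke \<sigma>) \<le> ennreal (C * ln (real N) powr (recip q - 1 / 2))) \<and>
        (p \<le> q \<and> 2 \<le> q \<longrightarrow>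
           besov_norm p q (blaschke \<sigma>) \<le> ennreal C) \<and>
        (q \<le> p \<and> p < \<infinity> \<and> 2 \<le> p \<longrightarrow>
           besov_norm p q (blaschke \<sigma>) \<le> ennreal (C * ln (real N) powr (recip q - recip p))) \<and>
        (q < \<infinity> \<and> p = \<infinity> \<longrightarrow>
           besov_norm p q (blaschke \<sigma>) \<le> ennreal (C * real N powr recip q)))
     \<and> (p \<le> 2 \<and> q \<le> 2 \<longrightarrow> growth_attained p q (\<lambda>N. ln (real N) powr (recip q - 1 / 2)))
     \<and> (p \<le> q \<and> 2 \<le> q \<longrightarrow> growth_attained p q (\<lambda>N. 1))
     \<and> (q \<le> p \<and> p < \<infinity> \<and> 2 \<le> p \<longrightarrow>
          growth_attained p q (\<lambda>N. ln (real N) powr (recip q - recip p)))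
     \<and> (q < \<infinity> \<and> p = \<infinity> \<longrightarrow> growth_attained p q (\<lambda>N. real N powr recip q))"
proof -
  have two: "(2::ennreal) = ennreal 2" by simp
  from assms(1) show ?thesis
  proof (cases p rule: ennreal_exponent_cases)
    case p: (fin P)
    from assms(2) show ?thesis
    proof (cases q rule: ennreal_exponent_cases)
      case q: (fin Q)
      define r where "r = max P 2"
      define C where "C = 2 + (3/2 + 2 * r / Q) powr (1 / Q)"
      have C: "2 \<le> C" by (simp add: C_def)
      have le: "p \<le> 2 \<longleftrightarrow> P \<le> 2" "q \<le> 2 \<longleftrightarrow> Q \<le> 2" "2 \<le> q \<longleftrightarrow> 2 \<le> Q" "2 \<le> p \<longleftrightarrow> 2 \<le> P"
        "p \<le> q \<longleftrightarrow> P \<le> Q" "q \<le> p \<longleftrightarrow> Q \<le> P"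
        unfolding two p(2) q(2) using p(1) q(1) by (subst ennreal_le_iff; simp)+
      have log: "besov_norm p q (blaschke \<sigma>) \<le> ennreal (C * ln (real N) powr (1 / Q - 1 / r))"
        if "\<sigma> \<in> disc_tuples N" "2 \<le> N" "Q \<le> r" for \<sigma> N
        using besov_norm_le_log[OF that(1,2) p(1,2,4) q(1,2,3,4)] that(3) by (simp add: C_def r_def)
      have const: "besov_norm p q (blaschke \<sigma>) \<le> ennreal C" if "\<sigma> \<in> disc_tuples N" "P \<le> Q" "2 \<le> Q" for \<sigma> N
        using besov_norm_le_const[OF that(1) p(1,2,4) q(1,2,3,4) that(2,3)] ennreal_leI[OF C] by (rule order_trans)
      show ?thesis
      proof (intro conjI impI)
        show "\<exists>C>0. \<forall>N\<ge>2. \<forall>\<sigma>\<in>disc_tuples N.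
        (p \<le> 2 \<and> q \<le> 2 \<longrightarrow>
           besov_norm p q (blaschke \<sigma>) \<le> ennreal (C * ln (real N) powr (recip q - 1 / 2))) \<and>
        (p \<le> q \<and> 2 \<le> q \<longrightarrow>
           besov_norm p q (blaschke \<sigma>) \<le> ennreal C) \<and>
        (q \<le> p \<and> p < \<infinity> \<and> 2 \<le> p \<longrightarrow>
           besov_norm p q (blaschke \<sigma>) \<le> ennreal (C * ln (real N) powr (recip q - recip p))) \<and>
        (q < \<infinity> \<and> p = \<infinity> \<longrightarrow>
           besov_norm p q (blaschke \<sigma>) \<le> ennreal (C * real N powr recip q))"
        proof (intro exI[of _ C] conjI allI ballI impI)
          show "0 < C" using C by simp
          fix N :: nat and \<sigma> assume N: "2 \<le> N" and \<sigma>: "\<sigma> \<in> disc_tuples N"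
          show "besov_norm p q (blaschke \<sigma>) \<le> ennreal (C * ln (real N) powr (recip q - 1 / 2))"
            if "p \<le> 2 \<and> q \<le> 2"
            using log[OF \<sigma> N] that by (simp add: le r_def q(4))
          show "besov_norm p q (blaschke \<sigma>) \<le> ennreal C" if "p \<le> q \<and> 2 \<le> q"
            using const[OF \<sigma>] that by (simp add: le)
          show "besov_norm p q (blaschke \<sigma>) \<le> ennreal (C * ln (real N) powr (recip q - recip p))"
            if "q \<le> p \<and> p < \<infinity> \<and> 2 \<le> p"
            using log[OF \<sigma> N] that by (simp add: le r_def q(4) p(4))
          show "besov_norm p q (blaschke \<sigma>) \<le> ennreal (C * real N powr recip q)"
            if "q < \<infinity> \<and> p = \<infinity>"
            using that p(5) by simp
        qed
        show "growth_attained p q (\<lambda>N. ln (real N) powr (recip q - 1 / 2))" if "p \<le> 2 \<and> q \<le> 2"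
          using growth_attained_small_p[OF p(1,2,4) q(1,2,3,4)] that by (simp add: le)
        show "growth_attained p q (\<lambda>N. 1)" by (rule growth_attained_const)
        show "growth_attained p q (\<lambda>N. ln (real N) powr (recip q - recip p))"
          if "q \<le> p \<and> p < \<infinity> \<and> 2 \<le> p"
          using growth_attained_large_p[OF p(1,2,4) q(1,2,3,4)] that by (simp add: le)
        show "growth_attained p q (\<lambda>N. real N powr recip q)" if "q < \<infinity> \<and> p = \<infinity>"
          using that p(5) by simp
      qed
    next
      case inf
      have "\<forall>N\<ge>2. \<forall>\<sigma>\<in>disc_tuples N. besov_norm p q (blaschke \<sigma>) \<le> ennreal 2"
        using besov_norm_le_infinite_q[OF _ assms(1)] inf by blast
      moreover have "\<not> q \<le> 2" "\<not> q \<le> p" "\<not> q < \<infinity>"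
        using inf p(5) by (auto simp: two top_unique simp del: ennreal_numeral)
      ultimately show ?thesis
        using growth_attained_const by (auto intro!: exI[of _ 2])
    qed
  next
    case p: inf
    have np: "\<not> p \<le> 2" "\<not> p < \<infinity>" using p by (auto simp: two top_unique simp del: ennreal_numeral)
    from assms(2) show ?thesis
    proof (cases q rule: ennreal_exponent_cases)
      case q: (fin Q)
      have "\<forall>N\<ge>2. \<forall>\<sigma>\<in>disc_tuples N. besov_norm p q (blaschke \<sigma>) \<le> ennreal (3 * real N powr recip q)"
        using besov_norm_le_infinite_p[OF _ _ q(1,2,3,4)] p(1) q(4) by simp
      moreover have "\<not> p \<le> q" using p q(5) by (auto simp: top_unique)
      moreover have "growth_attained p q (\<lambda>N. real N powr recip q)"
        using growth_attained_sup_norm[OF q(1,2,3,4)] p(1) by simp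
      ultimately show ?thesis using np by (auto intro!: exI[of _ 3])
    next
      case q: inf
      have "\<forall>N\<ge>2. \<forall>\<sigma>\<in>disc_tuples N. besov_norm p q (blaschke \<sigma>) \<le> ennreal 2"
        using besov_norm_le_infinite_q[OF _ assms(1)] q by blast
      then show ?thesis
        using growth_attained_const np q by (auto intro!: exI[of _ 2])
    qed
  qed
qed

end
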